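(* Let $\omega\in C(\mathbb{R}^d;\mathbb{R})$ and, for $t\in\mathbb{R}$, let $K_t=\mathcal{F}^{-1}[e^{-it\omega}]\in\mathcal{S}'(\mathbb{R}^d)$. Then $\omega(\xi)=\sum_{|\boldsymbol\alpha|\le1}a_{\boldsymbol\alpha}\xi^{\boldsymbol\alpha}$ for some $a_{\boldsymbol\alpha}\in\mathbb{R}$, with $\boldsymbol\alpha\in\mathbb{N}_0^d$ multi-indices, if and only if $\operatorname{supp}(K_t)\subseteq\mathbb{R}^d$ is compact for some $t\ne0$.
   Context: $\mathcal{S}'(\mathbb{R}^d)$ is the space of tempered distributions. The Fourier transform is $\widehat f(\xi)=\int f(x)e^{-ix\cdot\xi}\,dx$, with inverse $\mathcal{F}^{-1}[f](x)=(2\pi)^{-d}\int f(\xi)e^{ix\cdot\xi}\,d\xi$, extended to tempered distributions. $K_t$ is the fundamental solution of $i\partial_t u=Lu$, where $\widehat{Lf}=\omega\widehat f$; that is, $K_t=U(t)\delta$, where $U(t)=e^{-itL}$ is the Fourier multiplier with symbol $e^{-it\omega}$. *)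

theory Defs
  imports "HOL-Probability.Probability"
begin

section \<open>Schwartz functions\<close>

definition partial_deriv :: "'n::finite \<Rightarrow> (real^'n \<Rightarrow> complex) \<Rightarrow> real^'n \<Rightarrow> complex" where
  "partial_deriv j f x = vector_derivative (\<lambda>h. f (x + h *\<^sub>R axis j 1)) (at 0)"

text \<open>Iterated partial derivatives are indexed by the list of directions, \<open>[j, k]\<close> standing for
  \<open>\<partial>\<^sub>j \<partial>\<^sub>k\<close>. For smooth functions the order is irrelevant, and the lists of length
  \<open>m\<close> give exactly the derivatives \<open>\<partial>\<^sup>\<beta>\<close> with \<open>\<bar>\<beta>\<bar> = m\<close>.\<close>

definition iter_deriv :: "'n::finite list \<Rightarrow> (real^'n \<Rightarrow> complex) \<Rightarrow> real^'n \<Rightarrow> complex" where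
  "iter_deriv l f = foldr partial_deriv l f"

definition smooth :: "(real^'n::finite \<Rightarrow> complex) \<Rightarrow> bool" where
  "smooth f \<longleftrightarrow> (\<forall>l x. iter_deriv l f differentiable (at x))"

definition schwartz :: "(real^'n::finite \<Rightarrow> complex) set" where
  "schwartz = {f. smooth f \<and>
     (\<forall>k l. bdd_above (range (\<lambda>x. (1 + norm x) ^ k * norm (iter_deriv l f x))))}"

definition schwartz_seminorm :: "nat \<Rightarrow> 'n::finite list \<Rightarrow> (real^'n \<Rightarrow> complex) \<Rightarrow> real" where
  "schwartz_seminorm k l f = (SUP x. (1 + norm x) ^ k * norm (iter_deriv l f x))"

definition schwartz_topology :: "(real^'n::finite \<Rightarrow> complex) topology" where
  "schwartz_topology = topology_generated_by
     {{g \<in> schwartz. schwartz_seminorm k l (\<lambda>x. g x - f x) < e} | f k l e. f \<in> schwartz \<and> 0 < e}"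

definition test_function :: "(real^'n::finite) set \<Rightarrow> (real^'n \<Rightarrow> complex) \<Rightarrow> bool" where
  "test_function U f \<longleftrightarrow>
     smooth f \<and> compact (closure {x. f x \<noteq> 0}) \<and> closure {x. f x \<noteq> 0} \<subseteq> U"

definition inverse_fourier :: "(real^'n::finite \<Rightarrow> complex) \<Rightarrow> real^'n \<Rightarrow> complex" where
  "inverse_fourier f x =
     (1 / (2 * pi) ^ CARD('n)) *\<^sub>R (LINT \<xi>|lborel. f \<xi> * exp (\<i> * complex_of_real (x \<bullet> \<xi>)))"


subsection \<open>Iterated derivatives\<close>

lemma iter_deriv_Nil [simp]: "iter_deriv [] f = f"
  and iter_deriv_Cons: "iter_deriv (j # l) f = partial_deriv j (iter_deriv l f)"
  and iter_deriv_append: "iter_deriv (l @ l') f = iter_deriv l (iter_deriv l' f)"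
  by (simp_all add: iter_deriv_def)

lemma partial_deriv_eq:
  assumes "(f has_derivative f') (at x)"
  shows "partial_deriv j f x = f' (axis j 1)"
proof -
  have "((\<lambda>h. x + h *\<^sub>R axis j 1) has_derivative (\<lambda>h. h *\<^sub>R axis j 1)) (at 0)"
    by (auto intro!: derivative_eq_intros)
  moreover have "(f has_derivative f') (at (x + 0 *\<^sub>R axis j 1))" using assms by simp
  ultimately have "((\<lambda>h. f (x + h *\<^sub>R axis j 1)) has_derivative (\<lambda>h. f' (h *\<^sub>R axis j 1))) (at 0)"
    using has_derivative_compose by blast
  moreover have "f' (h *\<^sub>R axis j 1) = h *\<^sub>R f' (axis j 1)" for h
    using has_derivative_linear[OF assms] by (simp add: linear_cmul)
  ultimately show ?thesis
    unfolding partial_deriv_def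
    by (intro vector_derivative_at) (simp add: has_vector_derivative_def)
qed

lemma smoothD: "smooth f \<Longrightarrow> iter_deriv l f differentiable (at x)"
  by (auto simp: smooth_def)

lemma smooth_iter_deriv: "smooth f \<Longrightarrow> smooth (iter_deriv l f)"
  unfolding smooth_def by (metis iter_deriv_append)

lemma smooth_has_derivative:
  assumes "smooth f"
  obtains f' where "(f has_derivative f') (at x)"
  using smoothD[OF assms, of "[]" x] by (auto simp: differentiable_def)

lemma smooth_continuous_on:
  assumes "smooth f" shows "continuous_on A (iter_deriv l f)"
  using smoothD[OF assms, of l]
  by (meson continuous_at_imp_continuous_on differentiable_imp_continuous_within)

lemma partial_deriv_add:
  assumes "f differentiable (at x)" "g differentiable (at x)"
  shows "partial_deriv j (\<lambda>x. f x + g x) x = partial_deriv j f x + partial_deriv j g x"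
proof -
  obtain f' g' where d: "(f has_derivative f') (at x)" "(g has_derivative g') (at x)"
    using assms by (auto simp: differentiable_def)
  show ?thesis
    using partial_deriv_eq[OF has_derivative_add[OF d], of j] d
    by (simp add: partial_deriv_eq)
qed

lemma partial_deriv_mult:
  assumes "f differentiable (at x)" "g differentiable (at x)"
  shows "partial_deriv j (\<lambda>x. f x * g x) x = f x * partial_deriv j g x + partial_deriv j f x * g x"
proof -
  obtain f' g' where d: "(f has_derivative f') (at x)" "(g has_derivative g') (at x)"
    using assms by (auto simp: differentiable_def)
  show ?thesis
    using partial_deriv_eq[OF has_derivative_mult[OF d], of j] d
    by (simp add: partial_deriv_eq)
qed

lemma partial_deriv_const [simp]: "partial_deriv j (\<lambda>x. c) x = 0"
  using partial_deriv_eq[OF has_derivative_const[of c "at x"]] by simp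

lemma iter_deriv_add:
  assumes "smooth f" "smooth g"
  shows "iter_deriv l (\<lambda>x. f x + g x) = (\<lambda>x. iter_deriv l f x + iter_deriv l g x)"
  by (induction l) (auto simp: iter_deriv_Cons partial_deriv_add smoothD[OF assms(1)] smoothD[OF assms(2)])

lemma iter_deriv_cmul:
  assumes "smooth f"
  shows "iter_deriv l (\<lambda>x. c * f x) = (\<lambda>x. c * iter_deriv l f x)"
  by (induction l) (auto simp: iter_deriv_Cons partial_deriv_mult smoothD[OF assms])

lemma smooth_add: "smooth f \<Longrightarrow> smooth g \<Longrightarrow> smooth (\<lambda>x. f x + g x)"
  by (subst smooth_def) (simp add: iter_deriv_add smoothD)

lemma smooth_cmul: "smooth f \<Longrightarrow> smooth (\<lambda>x. c * f x)"
  by (subst smooth_def) (simp add: iter_deriv_cmul smoothD)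

text \<open>The Leibniz terms in which a derivative hits the factor \<open>x\<^sub>j\<close>.\<close>

fun hits :: "'n \<Rightarrow> 'n list \<Rightarrow> 'n list list" where
  "hits j [] = []"
| "hits j (i # l) = (if i = j then [l] else []) @ map ((#) i) (hits j l)"

lemma differentiable_sum_list:
  fixes g :: "'b \<Rightarrow> 'a::real_normed_vector \<Rightarrow> 'c::real_normed_vector"
  shows "(\<And>a. a \<in> set L \<Longrightarrow> g a differentiable (at x)) \<Longrightarrow> (\<lambda>x. \<Sum>a\<leftarrow>L. g a x) differentiable (at x)"
  by (induction L) auto

lemma partial_deriv_sum_list:
  "(\<And>a. a \<in> set L \<Longrightarrow> g a differentiable (at x)) \<Longrightarrow>
   partial_deriv j (\<lambda>x. \<Sum>a\<leftarrow>L. g a x) x = (\<Sum>a\<leftarrow>L. partial_deriv j (g a) x)"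
  by (induction L) (auto simp: partial_deriv_add differentiable_sum_list)

lemma coord_has_derivative:
  "((\<lambda>x::real^'n::finite. complex_of_real (x $ j)) has_derivative (\<lambda>h. of_real (h $ j))) (at x)"
  by (intro bounded_linear_imp_has_derivative
      bounded_linear_compose[OF bounded_linear_of_real bounded_linear_vec_nth])

lemma partial_deriv_coord:
  "partial_deriv i (\<lambda>x. complex_of_real (x $ j)) x = (if i = j then 1 else 0)"
  by (subst partial_deriv_eq[OF coord_has_derivative]) (auto simp: axis_def)

lemma coord_differentiable: "(\<lambda>x::real^'n::finite. complex_of_real (x $ j)) differentiable (at x)"
  using coord_has_derivative by (auto simp: differentiable_def)

lemma iter_deriv_coord:
  assumes "smooth f"
  shows "iter_deriv l (\<lambda>x. of_real (x $ j) * f x) =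
    (\<lambda>x. of_real (x $ j) * iter_deriv l f x + (\<Sum>l'\<leftarrow>hits j l. iter_deriv l' f x))"
proof (induction l)
  case (Cons i l)
  have "partial_deriv i (\<lambda>x. of_real (x $ j) * iter_deriv l f x + (\<Sum>l'\<leftarrow>hits j l. iter_deriv l' f x)) x
    = of_real (x $ j) * iter_deriv (i # l) f x + (if i = j then iter_deriv l f x else 0)
      + (\<Sum>l'\<leftarrow>hits j l. iter_deriv (i # l') f x)" for x
    by (subst partial_deriv_add)
       (auto simp: partial_deriv_mult partial_deriv_coord coord_differentiable partial_deriv_sum_list
        smoothD[OF assms] iter_deriv_Cons intro!: differentiable_sum_list derivative_intros)
  then show ?case
    unfolding iter_deriv_Cons[of i l "\<lambda>x. of_real (x $ j) * f x"] Cons.IH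
    by (auto simp: fun_eq_iff o_def add.assoc)
qed simp

lemma smooth_coord: "smooth f \<Longrightarrow> smooth (\<lambda>x. of_real (x $ j) * f x)"
  by (subst smooth_def)
     (auto simp: iter_deriv_coord smoothD coord_differentiable intro!: differentiable_sum_list differentiable_add differentiable_mult)


subsection \<open>The seminorms\<close>

lemma schwartz_smooth: "f \<in> schwartz \<Longrightarrow> smooth f"
  by (auto simp: schwartz_def)

lemma schwartz_bound:
  "f \<in> schwartz \<Longrightarrow> (1 + norm x) ^ k * norm (iter_deriv l f x) \<le> schwartz_seminorm k l f"
  unfolding schwartz_seminorm_def schwartz_def by (intro cSUP_upper) auto

lemma schwartz_seminorm_nonneg: "f \<in> schwartz \<Longrightarrow> 0 \<le> schwartz_seminorm k l f"
  using schwartz_bound[of f 0 k l] by (auto intro: order_trans[rotated])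

lemma schwartz_seminorm_le:
  "(\<And>x. (1 + norm x) ^ k * norm (iter_deriv l f x) \<le> B) \<Longrightarrow> schwartz_seminorm k l f \<le> B"
  unfolding schwartz_seminorm_def by (intro cSUP_least) auto

lemma schwartzI:
  assumes "smooth f" "\<And>k l. \<exists>B. \<forall>x. (1 + norm x) ^ k * norm (iter_deriv l f x) \<le> B"
  shows "f \<in> schwartz"
  using assms unfolding schwartz_def bdd_above_def by fast

lemma
  assumes f: "f \<in> schwartz" and g: "g \<in> schwartz"
  shows schwartz_add: "(\<lambda>x. f x + g x) \<in> schwartz"
    and schwartz_seminorm_add: "schwartz_seminorm k l (\<lambda>x. f x + g x)
      \<le> schwartz_seminorm k l f + schwartz_seminorm k l g"
proof -
  have *: "(1 + norm x) ^ k * norm (iter_deriv l (\<lambda>x. f x + g x) x)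
    \<le> schwartz_seminorm k l f + schwartz_seminorm k l g" for k l x
  proof -
    have "(1 + norm x) ^ k * norm (iter_deriv l (\<lambda>x. f x + g x) x)
      \<le> (1 + norm x) ^ k * norm (iter_deriv l f x) + (1 + norm x) ^ k * norm (iter_deriv l g x)"
      by (auto simp: iter_deriv_add schwartz_smooth f g simp flip: distrib_left
          intro!: mult_left_mono norm_triangle_ineq)
    then show ?thesis using schwartz_bound[OF f, of x k l] schwartz_bound[OF g, of x k l] by linarith
  qed
  show "(\<lambda>x. f x + g x) \<in> schwartz"
    using f g * by (intro schwartzI) (auto intro: smooth_add schwartz_smooth)
  show "schwartz_seminorm k l (\<lambda>x. f x + g x) \<le> schwartz_seminorm k l f + schwartz_seminorm k l g"
    using * by (rule schwartz_seminorm_le)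
qed

lemma
  assumes f: "f \<in> schwartz"
  shows schwartz_cmul: "(\<lambda>x. c * f x) \<in> schwartz"
    and schwartz_seminorm_cmul: "schwartz_seminorm k l (\<lambda>x. c * f x) \<le> norm c * schwartz_seminorm k l f"
proof -
  have *: "(1 + norm x) ^ k * norm (iter_deriv l (\<lambda>x. c * f x) x) \<le> norm c * schwartz_seminorm k l f"
    for k l x
    using mult_left_mono[OF schwartz_bound[OF f, of x k l], of "norm c"]
    by (simp add: iter_deriv_cmul schwartz_smooth f norm_mult mult_ac)
  show "(\<lambda>x. c * f x) \<in> schwartz"
    using f * by (intro schwartzI) (auto intro: smooth_cmul schwartz_smooth)
  show "schwartz_seminorm k l (\<lambda>x. c * f x) \<le> norm c * schwartz_seminorm k l f"
    using * by (rule schwartz_seminorm_le)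
qed

lemma schwartz_diff: "f \<in> schwartz \<Longrightarrow> g \<in> schwartz \<Longrightarrow> (\<lambda>x. f x - g x) \<in> schwartz"
  using schwartz_add[of f "\<lambda>x. -1 * g x"] schwartz_cmul[of g "-1"] by simp

lemma iter_deriv_zero: "iter_deriv l (\<lambda>x. 0) = (\<lambda>x. 0)"
  by (induction l) (auto simp: iter_deriv_Cons)

lemma schwartz_zero: "(\<lambda>x. 0) \<in> schwartz"
  by (simp add: schwartz_def smooth_def iter_deriv_zero)

lemma schwartz_seminorm_zero: "schwartz_seminorm k l (\<lambda>x. 0) = 0"
  by (simp add: schwartz_seminorm_def iter_deriv_zero)

lemma
  assumes f: "f \<in> schwartz"
  shows schwartz_partial_deriv: "partial_deriv j f \<in> schwartz"
    and schwartz_seminorm_partial_deriv: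
      "schwartz_seminorm k l (partial_deriv j f) = schwartz_seminorm k (l @ [j]) f"
proof -
  have 1: "partial_deriv j f = iter_deriv [j] f" by (simp add: iter_deriv_Cons)
  show "partial_deriv j f \<in> schwartz"
    using f unfolding 1 schwartz_def by (auto simp flip: iter_deriv_append intro: smooth_iter_deriv)
  show "schwartz_seminorm k l (partial_deriv j f) = schwartz_seminorm k (l @ [j]) f"
    unfolding 1 schwartz_seminorm_def by (simp flip: iter_deriv_append)
qed

lemma
  assumes f: "f \<in> schwartz"
  shows schwartz_coord: "(\<lambda>x. of_real (x $ j) * f x) \<in> schwartz"
    and schwartz_seminorm_coord: "schwartz_seminorm k l (\<lambda>x. of_real (x $ j) * f x)
      \<le> schwartz_seminorm (Suc k) l f + (\<Sum>l'\<leftarrow>hits j l. schwartz_seminorm k l' f)"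
proof -
  have *: "(1 + norm x) ^ k * norm (iter_deriv l (\<lambda>x. of_real (x $ j) * f x) x)
    \<le> schwartz_seminorm (Suc k) l f + (\<Sum>l'\<leftarrow>hits j l. schwartz_seminorm k l' f)" for k l x
  proof -
    have "norm (\<Sum>l'\<leftarrow>L. iter_deriv l' f x) \<le> (\<Sum>l'\<leftarrow>L. norm (iter_deriv l' f x))" for L
      by (induction L) (auto intro: norm_triangle_le)
    from mult_left_mono[OF this, of "(1 + norm x) ^ k"]
    have "(1 + norm x) ^ k * norm (\<Sum>l'\<leftarrow>L. iter_deriv l' f x)
        \<le> (\<Sum>l'\<leftarrow>L. (1 + norm x) ^ k * norm (iter_deriv l' f x))" for L
      by (simp add: sum_list_const_mult)
    also have "(\<Sum>l'\<leftarrow>L. (1 + norm x) ^ k * norm (iter_deriv l' f x))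
        \<le> (\<Sum>l'\<leftarrow>L. schwartz_seminorm k l' f)" for L
      by (intro sum_list_mono schwartz_bound f)
    finally have 1: "(1 + norm x) ^ k * norm (\<Sum>l'\<leftarrow>hits j l. iter_deriv l' f x)
        \<le> (\<Sum>l'\<leftarrow>hits j l. schwartz_seminorm k l' f)" .
    have "\<bar>x $ j\<bar> \<le> 1 + norm x"
      using component_le_norm_cart[of x j] by simp
    then have "(1 + norm x) ^ k * norm (of_real (x $ j) * iter_deriv l f x)
        \<le> (1 + norm x) ^ Suc k * norm (iter_deriv l f x)"
      using mult_right_mono[of "\<bar>x $ j\<bar>" "1 + norm x" "norm (iter_deriv l f x) * (1 + norm x) ^ k"]
      by (simp add: norm_mult mult_ac)
    also have "\<dots> \<le> schwartz_seminorm (Suc k) l f" by (rule schwartz_bound[OF f])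
    finally have 2: "(1 + norm x) ^ k * norm (of_real (x $ j) * iter_deriv l f x)
        \<le> schwartz_seminorm (Suc k) l f" .
    have "(1 + norm x) ^ k * norm (iter_deriv l (\<lambda>x. of_real (x $ j) * f x) x)
      \<le> (1 + norm x) ^ k * norm (of_real (x $ j) * iter_deriv l f x)
        + (1 + norm x) ^ k * norm (\<Sum>l'\<leftarrow>hits j l. iter_deriv l' f x)"
      by (auto simp: iter_deriv_coord schwartz_smooth f simp flip: distrib_left
          intro!: mult_left_mono norm_triangle_ineq)
    with 1 2 show ?thesis by linarith
  qed
  show "(\<lambda>x. of_real (x $ j) * f x) \<in> schwartz"
    using f * by (intro schwartzI) (auto intro: smooth_coord schwartz_smooth)
  show "schwartz_seminorm k l (\<lambda>x. of_real (x $ j) * f x)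
      \<le> schwartz_seminorm (Suc k) l f + (\<Sum>l'\<leftarrow>hits j l. schwartz_seminorm k l' f)"
    using * by (rule schwartz_seminorm_le)
qed


subsection \<open>Integrals of Schwartz functions\<close>

lemma integrable_weight:
  "integrable lborel (\<lambda>x::real^'n::finite. 1 / (1 + norm x) ^ (2 * CARD('n)))"
proof -
  have 1: "integrable lborel (\<lambda>x::real. inverse (1 + x\<^sup>2))"
    using integrable_inverse_1_plus_square by (simp add: set_integrable_def)
  define g where "g x = (\<Prod>b\<in>Basis. inverse (1 + (x \<bullet> b)\<^sup>2))" for x :: "real^'n"
  have pos: "0 \<le> inverse (1 + x\<^sup>2)" "0 < 1 + x\<^sup>2" for x :: real
    by (auto simp: add_pos_nonneg)
  have "(\<integral>\<^sup>+x. ennreal (g x) \<partial>lborel) = (\<integral>\<^sup>+x. (\<Prod>b\<in>Basis. ennreal (inverse (1 + (x \<bullet> b)\<^sup>2))) \<partial>(lborel :: (real^'n) measure))"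
    using pos by (simp add: g_def prod_ennreal)
  also have "\<dots> = (\<Prod>b\<in>(Basis::(real^'n) set). \<integral>\<^sup>+x. ennreal (inverse (1 + x\<^sup>2)) \<partial>lborel)"
    by (rule nn_integral_lborel_prod) auto
  also have "\<dots> = ennreal (\<Prod>b\<in>(Basis::(real^'n) set). (\<integral>x. inverse (1 + x\<^sup>2) \<partial>lborel))"
    using pos by (subst nn_integral_eq_integral[OF 1]) (auto simp: ennreal_power integral_nonneg_AE)
  finally have *: "(\<integral>\<^sup>+x. ennreal (g x) \<partial>lborel)
    = ennreal (\<Prod>b\<in>(Basis::(real^'n) set). (\<integral>x. inverse (1 + x\<^sup>2) \<partial>lborel))" .
  have [measurable]: "g \<in> borel_measurable borel" unfolding g_def by measurable
  have "integrable lborel g"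
    using pos by (intro integrableI_nn_integral_finite[OF _ _ *]) (auto simp: g_def intro!: prod_nonneg)
  then show ?thesis
  proof (rule Bochner_Integration.integrable_bound)
    show "AE x in lborel. norm (1 / (1 + norm x) ^ (2 * CARD('n))) \<le> norm (g x)"
    proof (intro AE_I2)
      fix x :: "real^'n"
      have "1 + (x \<bullet> b)\<^sup>2 \<le> (1 + norm x)\<^sup>2" if "b \<in> Basis" for b
      proof -
        have "\<bar>x \<bullet> b\<bar>\<^sup>2 \<le> (norm x)\<^sup>2"
          using Basis_le_norm[OF that, of x] by (intro power_mono) auto
        then show ?thesis by (simp add: power2_sum add_increasing2)
      qed
      then have "(\<Prod>b\<in>(Basis::(real^'n) set). 1 + (x \<bullet> b)\<^sup>2) \<le> (\<Prod>b\<in>(Basis::(real^'n) set). (1 + norm x)\<^sup>2)"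
        using pos by (intro prod_mono) (auto intro: less_imp_le)
      also have "\<dots> = (1 + norm x) ^ (2 * CARD('n))"
        by (simp add: power_mult)
      finally have "inverse ((1 + norm x) ^ (2 * CARD('n))) \<le> inverse (\<Prod>b\<in>(Basis::(real^'n) set). 1 + (x \<bullet> b)\<^sup>2)"
        using pos by (intro le_imp_inverse_le prod_pos) auto
      also have "\<dots> = g x" by (simp add: g_def prod_inversef[symmetric] o_def)
      finally have "1 / (1 + norm x) ^ (2 * CARD('n)) \<le> g x" by (simp add: inverse_eq_divide)
      moreover have "0 \<le> 1 / (1 + norm x) ^ (2 * CARD('n))" by simp
      ultimately show "norm (1 / (1 + norm x) ^ (2 * CARD('n))) \<le> norm (g x)"
        unfolding real_norm_def by linarith
    qed
  qed measurable
qed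

lemma schwartz_borel: "f \<in> schwartz \<Longrightarrow> f \<in> borel_measurable borel"
  using smooth_continuous_on[OF schwartz_smooth, of f UNIV "[]"]
  by (intro borel_measurable_continuous_onI) auto

lemma schwartz_le_weight:
  assumes "f \<in> schwartz"
  shows "norm (f x) \<le> schwartz_seminorm k [] f * (1 / (1 + norm x) ^ k)"
  using schwartz_bound[OF assms, of x k "[]"] by (simp add: pos_le_divide_eq add_pos_nonneg mult.commute)

lemma
  fixes f g :: "real^'n::finite \<Rightarrow> complex"
  assumes f: "f \<in> schwartz" and g[measurable]: "g \<in> borel_measurable borel" and B: "\<And>x. norm (g x) \<le> B"
  shows schwartz_integrable_mult: "integrable lborel (\<lambda>x. g x * f x)"
    and schwartz_integral_mult: "norm (LINT x|lborel. g x * f x)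
      \<le> B * schwartz_seminorm (2 * CARD('n)) [] f * (LINT x|lborel. 1 / (1 + norm (x::real^'n)) ^ (2 * CARD('n)))"
proof -
  let ?w = "\<lambda>x::real^'n. B * schwartz_seminorm (2 * CARD('n)) [] f * (1 / (1 + norm x) ^ (2 * CARD('n)))"
  have [measurable]: "f \<in> borel_measurable borel" using f by (rule schwartz_borel)
  have w: "integrable lborel ?w" using integrable_weight by (rule integrable_mult_right)
  have le: "norm (g x * f x) \<le> ?w x" for x
    using mult_mono[OF B[of x] schwartz_le_weight[OF f, of x "2 * CARD('n)"]] B[of x] norm_ge_zero[of "g x"]
    by (auto simp: norm_mult mult.assoc)
  show 1: "integrable lborel (\<lambda>x. g x * f x)"
    using w by (rule Bochner_Integration.integrable_bound) (auto intro!: AE_I2 order_trans[OF le] divide_right_mono)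
  have "norm (LINT x|lborel. g x * f x) \<le> (LINT x|lborel. ?w x)"
    using 1 w le by (intro order_trans[OF integral_norm_bound] integral_mono) auto
  then show "norm (LINT x|lborel. g x * f x)
      \<le> B * schwartz_seminorm (2 * CARD('n)) [] f * (LINT x|lborel. 1 / (1 + norm (x::real^'n)) ^ (2 * CARD('n)))"
    by (simp only: integral_mult_right_zero)
qed

lemma borel_measurable_character [measurable]:
  "(\<lambda>\<xi>::real^'n::finite. exp (\<i> * complex_of_real (x \<bullet> \<xi>))) \<in> borel_measurable borel"
  by (intro borel_measurable_continuous_onI continuous_intros)

lemma integrable_inverse_fourier:
  "f \<in> schwartz \<Longrightarrow> integrable lborel (\<lambda>\<xi>. f \<xi> * exp (\<i> * complex_of_real (x \<bullet> \<xi>)))"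
  using schwartz_integrable_mult[of f "\<lambda>\<xi>. exp (\<i> * complex_of_real (x \<bullet> \<xi>))" 1]
  by (simp add: mult.commute)

lemma inverse_fourier_add:
  "f \<in> schwartz \<Longrightarrow> g \<in> schwartz \<Longrightarrow>
    inverse_fourier (\<lambda>x. f x + g x) = (\<lambda>x. inverse_fourier f x + inverse_fourier g x)"
  by (simp add: inverse_fourier_def fun_eq_iff distrib_right integrable_inverse_fourier scaleR_add_right)

lemma inverse_fourier_cmul:
  "inverse_fourier (\<lambda>x. c * f x) = (\<lambda>x. c * inverse_fourier f x)"
  by (simp add: inverse_fourier_def fun_eq_iff mult.assoc)

lemma inverse_fourier_cmul_right:
  "f \<in> schwartz \<Longrightarrow> inverse_fourier (\<lambda>x. f x * c) = (\<lambda>x. inverse_fourier f x * c)"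
  using inverse_fourier_cmul[of c f] by (simp add: mult.commute)

lemma inverse_fourier_has_derivative:
  fixes f :: "real^'n::finite \<Rightarrow> complex"
  assumes f: "f \<in> schwartz"
  shows "(inverse_fourier f has_derivative
    (\<lambda>h. \<Sum>j\<in>UNIV. of_real (h $ j) * inverse_fourier (\<lambda>\<xi>. \<i> * (of_real (\<xi> $ j) * f \<xi>)) x)) (at x)"
proof -
  define c :: real where "c = 1 / (2 * pi) ^ CARD('n)"
  let ?e = "\<lambda>x \<xi>::real^'n. exp (\<i> * complex_of_real (x \<bullet> \<xi>))"
  let ?D = "\<lambda>h. \<Sum>j\<in>UNIV. of_real (h $ j) * inverse_fourier (\<lambda>\<xi>. \<i> * (of_real (\<xi> $ j) * f \<xi>)) x"
  have c: "0 \<le> c" by (simp add: c_def)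
  have F: "inverse_fourier f y = c *\<^sub>R (LINT \<xi>|lborel. f \<xi> * ?e y \<xi>)" for y
    by (simp add: inverse_fourier_def c_def)
  define q where "q \<xi> = (norm \<xi>)\<^sup>2 * norm (f \<xi>)" for \<xi>
  have q: "integrable lborel q"
  proof -

    have "integrable lborel (\<lambda>\<xi>. \<Sum>j\<in>UNIV. norm ((1::complex) * (of_real (\<xi> $ j) * (of_real (\<xi> $ j) * f \<xi>))))"
      using f by (intro Bochner_Integration.integrable_sum integrable_norm schwartz_integrable_mult[where B = 1])
        (auto intro: schwartz_coord)
    moreover have "(\<Sum>j\<in>UNIV. norm ((1::complex) * (of_real (\<xi> $ j) * (of_real (\<xi> $ j) * f \<xi>)))) = q \<xi>" for \<xi>
      by (simp add: q_def norm_mult norm_power power2_norm_eq_inner inner_vec_def sum_distrib_right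
        mult.assoc[symmetric] flip: power2_eq_square)
    ultimately show ?thesis by simp
  qed
  have int: "integrable lborel (\<lambda>\<xi>. \<i> * (of_real (\<xi> $ j) * f \<xi>) * ?e x \<xi>)" for j x
    using f by (intro integrable_inverse_fourier schwartz_cmul schwartz_coord)
  have D: "?D h = c *\<^sub>R (LINT \<xi>|lborel. \<i> * of_real (h \<bullet> \<xi>) * f \<xi> * ?e x \<xi>)" for h
  proof -
    have "?D h = c *\<^sub>R (\<Sum>j\<in>UNIV. LINT \<xi>|lborel. of_real (h $ j) * (\<i> * (of_real (\<xi> $ j) * f \<xi>) * ?e x \<xi>))"
      by (simp add: inverse_fourier_def c_def scaleR_sum_right)
    also have "\<dots> = c *\<^sub>R (LINT \<xi>|lborel. (\<Sum>j\<in>UNIV. of_real (h $ j) * (\<i> * (of_real (\<xi> $ j) * f \<xi>) * ?e x \<xi>)))"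
      using int by (subst Bochner_Integration.integral_sum) auto
    also have "(\<lambda>\<xi>. \<Sum>j\<in>UNIV. of_real (h $ j) * (\<i> * (of_real (\<xi> $ j) * f \<xi>) * ?e x \<xi>))
        = (\<lambda>\<xi>. \<i> * of_real (h \<bullet> \<xi>) * f \<xi> * ?e x \<xi>)"
      by (simp add: fun_eq_iff inner_vec_def sum_distrib_left sum_distrib_right mult_ac)
    finally show ?thesis .
  qed
  have "norm (inverse_fourier f (x + h) - inverse_fourier f x - ?D h) \<le> (c * (LINT \<xi>|lborel. q \<xi>)) * (norm h)\<^sup>2" for h
  proof -
    have i3: "integrable lborel (\<lambda>\<xi>. \<i> * of_real (h \<bullet> \<xi>) * f \<xi> * ?e x \<xi>)"
    proof -
      have "integrable lborel (\<lambda>\<xi>. (\<Sum>j\<in>UNIV. of_real (h $ j) * (\<i> * (of_real (\<xi> $ j) * f \<xi>) * ?e x \<xi>)))"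
        using int by auto
      also have "(\<lambda>\<xi>. \<Sum>j\<in>UNIV. of_real (h $ j) * (\<i> * (of_real (\<xi> $ j) * f \<xi>) * ?e x \<xi>))
        = (\<lambda>\<xi>. \<i> * of_real (h \<bullet> \<xi>) * f \<xi> * ?e x \<xi>)"
        by (simp add: fun_eq_iff inner_vec_def sum_distrib_left sum_distrib_right mult_ac)
      finally show ?thesis .
    qed
    have "inverse_fourier f (x + h) - inverse_fourier f x - ?D h
      = c *\<^sub>R (LINT \<xi>|lborel. f \<xi> * ?e (x + h) \<xi> - f \<xi> * ?e x \<xi> - \<i> * of_real (h \<bullet> \<xi>) * f \<xi> * ?e x \<xi>)"
      unfolding D F using i3 f by (simp add: integrable_inverse_fourier scaleR_diff_right)
    also have "norm \<dots> \<le> c * (LINT \<xi>|lborel. q \<xi> * (norm h)\<^sup>2)"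
      unfolding norm_scaleR abs_of_nonneg[OF c]
    proof (intro mult_left_mono[OF _ c] order_trans[OF integral_norm_bound] integral_mono integrable_norm)
      fix \<xi> :: "real^'n"
      have "f \<xi> * ?e (x + h) \<xi> - f \<xi> * ?e x \<xi> - \<i> * of_real (h \<bullet> \<xi>) * f \<xi> * ?e x \<xi>
        = f \<xi> * ?e x \<xi> * (?e h \<xi> - 1 - \<i> * of_real (h \<bullet> \<xi>))"
        by (simp add: inner_add_left distrib_left exp_add algebra_simps)
      moreover have "norm (?e h \<xi> - 1 - \<i> * of_real (h \<bullet> \<xi>)) \<le> \<bar>h \<bullet> \<xi>\<bar>\<^sup>2"
      proof -
        have "norm (?e h \<xi> - 1 - \<i> * of_real (h \<bullet> \<xi>)) \<le> \<bar>h \<bullet> \<xi>\<bar>\<^sup>2 / 2"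
          using iexp_approx1[of "h \<bullet> \<xi>" 1] by (simp add: diff_diff_eq numeral_2_eq_2)
        then show ?thesis using zero_le_power2[of "\<bar>h \<bullet> \<xi>\<bar>"] by linarith
      qed
      moreover have "\<bar>h \<bullet> \<xi>\<bar>\<^sup>2 \<le> (norm h * norm \<xi>)\<^sup>2"
        by (intro power_mono Cauchy_Schwarz_ineq2) auto
      ultimately have "norm (f \<xi> * ?e (x + h) \<xi> - f \<xi> * ?e x \<xi> - \<i> * of_real (h \<bullet> \<xi>) * f \<xi> * ?e x \<xi>)
        \<le> norm (f \<xi>) * (norm h * norm \<xi>)\<^sup>2"
        by (auto simp: norm_mult intro!: mult_left_mono)
      then show "norm (f \<xi> * ?e (x + h) \<xi> - f \<xi> * ?e x \<xi> - \<i> * of_real (h \<bullet> \<xi>) * f \<xi> * ?e x \<xi>)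
        \<le> q \<xi> * (norm h)\<^sup>2" by (simp add: q_def power_mult_distrib mult_ac)
    qed (use q i3 f in \<open>auto intro!: Bochner_Integration.integrable_diff integrable_inverse_fourier\<close>)
    finally show ?thesis by (simp add: mult_ac)
  qed
  note bound = this
  show ?thesis
  proof (rule has_derivativeI_sandwich[where e = 1 and H = "\<lambda>y. c * (LINT \<xi>|lborel. q \<xi>) * norm (y - x)"])
    show "bounded_linear ?D"
      by (intro bounded_linear_sum bounded_linear_compose[OF bounded_linear_mult_left]
        bounded_linear_compose[OF bounded_linear_of_real] bounded_linear_vec_nth)
    show "norm (inverse_fourier f y - inverse_fourier f x - ?D (y - x)) / norm (y - x)
        \<le> c * (LINT \<xi>|lborel. q \<xi>) * norm (y - x)" if "y \<noteq> x" for y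
      using bound[of "y - x"] that by (simp add: divide_le_eq power2_eq_square mult.assoc)
    show "(\<lambda>y. c * (LINT \<xi>|lborel. q \<xi>) * norm (y - x)) \<midarrow>x\<rightarrow> 0"
      by (auto intro!: tendsto_eq_intros)
  qed auto
qed

lemma smooth_line_derivative:
  assumes "smooth f"
  shows "((\<lambda>h. f (x + h *\<^sub>R axis j 1)) has_vector_derivative partial_deriv j f (x + t *\<^sub>R axis j 1)) (at t within A)"
proof -
  obtain f' where f': "(f has_derivative f') (at (x + t *\<^sub>R axis j 1))"
    using smooth_has_derivative[OF assms] .
  have "((\<lambda>h. x + h *\<^sub>R axis j 1) has_derivative (\<lambda>h. h *\<^sub>R axis j 1)) (at t)"
    by (auto intro!: derivative_eq_intros)
  then have "((\<lambda>h. f (x + h *\<^sub>R axis j 1)) has_derivative (\<lambda>h. f' (h *\<^sub>R axis j 1))) (at t)"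
    using f' has_derivative_compose by blast
  moreover have "f' (h *\<^sub>R axis j 1) = h *\<^sub>R f' (axis j 1)" for h
    using has_derivative_linear[OF f'] by (simp add: linear_cmul)
  ultimately show ?thesis
    by - (rule has_vector_derivative_at_within,
        simp add: has_vector_derivative_def partial_deriv_eq[OF f'])
qed

lemma difference_quotient_tendsto:
  fixes g :: "real \<Rightarrow> 'a::real_normed_vector"
  assumes "(g has_vector_derivative D) (at 0)"
  shows "(\<lambda>n. real (Suc n) *\<^sub>R (g (inverse (real (Suc n))) - g 0)) \<longlonglongrightarrow> D"
proof -
  have "(\<lambda>h. norm (g (0 + h) - g 0 - h *\<^sub>R D) / norm h) \<midarrow>0\<rightarrow> 0"
    using assms unfolding has_vector_derivative_def has_derivative_at by blast
  moreover have "filterlim (\<lambda>n. inverse (real (Suc n))) (at 0) sequentially"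
    unfolding filterlim_at using LIMSEQ_inverse_real_of_nat by auto
  ultimately have "(\<lambda>n. norm (g (0 + inverse (real (Suc n))) - g 0 - inverse (real (Suc n)) *\<^sub>R D)
      / norm (inverse (real (Suc n)))) \<longlonglongrightarrow> 0"
    by (rule filterlim_compose)
  also have "(\<lambda>n. norm (g (0 + inverse (real (Suc n))) - g 0 - inverse (real (Suc n)) *\<^sub>R D)
      / norm (inverse (real (Suc n)))) =
      (\<lambda>n. norm (real (Suc n) *\<^sub>R (g (inverse (real (Suc n))) - g 0) - D))"
  proof
    fix n
    have "real (Suc n) *\<^sub>R (g (inverse (real (Suc n))) - g 0) - D
      = real (Suc n) *\<^sub>R (g (inverse (real (Suc n))) - g 0 - inverse (real (Suc n)) *\<^sub>R D)"
      by (simp add: scaleR_diff_right del: of_nat_Suc)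
    then show "norm (g (0 + inverse (real (Suc n))) - g 0 - inverse (real (Suc n)) *\<^sub>R D)
      / norm (inverse (real (Suc n))) = norm (real (Suc n) *\<^sub>R (g (inverse (real (Suc n))) - g 0) - D)"
      by (simp add: divide_inverse del: of_nat_Suc)
  qed
  finally show ?thesis by (simp add: LIM_zero_iff tendsto_norm_zero_iff)
qed

lemma integral_translate:
  fixes F :: "'a::euclidean_space \<Rightarrow> complex"
  assumes "F \<in> borel_measurable borel"
  shows "(LINT x|lborel. F (a + x)) = (LINT x|lborel. F x)"
    and "integrable lborel F \<Longrightarrow> integrable lborel (\<lambda>x. F (a + x))"
  using assms integral_distr[of "(+) a" lborel borel F] integrable_distr_eq[of "(+) a" lborel borel F]
  by (auto simp: lborel_distr_plus)

lemma inverse_fourier_partial_deriv: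
  fixes f :: "real^'n::finite \<Rightarrow> complex"
  assumes f: "f \<in> schwartz"
  shows "inverse_fourier (partial_deriv j f) x = - (\<i> * of_real (x $ j)) * inverse_fourier f x"
proof -
  let ?e = "\<lambda>\<xi>::real^'n. exp (\<i> * complex_of_real (x \<bullet> \<xi>))"
  let ?a = "axis j 1 :: real^'n"
  define h where "h n = inverse (real (Suc n))" for n
  have h: "0 \<le> h n" "h n \<le> 1" "real (Suc n) * h n = 1" for n
    by (simp_all add: h_def inverse_le_1_iff del: of_nat_Suc)
  have sm: "smooth f" by (rule schwartz_smooth[OF f])
  have [measurable]: "f \<in> borel_measurable borel" "partial_deriv j f \<in> borel_measurable borel"
    using f schwartz_partial_deriv[OF f] by (auto intro: schwartz_borel)
  define s where "s n \<xi> = real (Suc n) *\<^sub>R (f (\<xi> + h n *\<^sub>R ?a) - f \<xi>) * ?e \<xi>" for n \<xi>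
  define m where "m = 2 * CARD('n)"
  define M where "M = schwartz_seminorm m [] (partial_deriv j f) * 2 ^ m"
  have aux: "1 + N \<le> 2 * (1 + P)" if "N \<le> P + A" "A \<le> 1" "0 \<le> P" for N P A :: real
    using that by simp
  have bound: "norm (partial_deriv j f (\<xi> + t *\<^sub>R ?a)) \<le> M * (1 / (1 + norm \<xi>) ^ m)"
    if "t \<in> {0..1}" for \<xi> t
  proof -
    have "norm \<xi> \<le> norm (\<xi> + t *\<^sub>R ?a) + norm (t *\<^sub>R ?a)"
      using norm_triangle_ineq4[of "\<xi> + t *\<^sub>R ?a" "t *\<^sub>R ?a"] by simp
    moreover have "norm (t *\<^sub>R ?a) \<le> 1" using that by simp
    ultimately have "1 + norm \<xi> \<le> 2 * (1 + norm (\<xi> + t *\<^sub>R ?a))"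
      using norm_ge_zero[of "\<xi> + t *\<^sub>R ?a"] aux by blast
    then have "(1 + norm \<xi>) ^ m \<le> (2 * (1 + norm (\<xi> + t *\<^sub>R ?a))) ^ m"
      by (intro power_mono) auto
    then have "(1 + norm \<xi>) ^ m * norm (partial_deriv j f (\<xi> + t *\<^sub>R ?a))
      \<le> 2 ^ m * ((1 + norm (\<xi> + t *\<^sub>R ?a)) ^ m * norm (partial_deriv j f (\<xi> + t *\<^sub>R ?a)))"
      by (auto simp flip: mult.assoc power_mult_distrib intro!: mult_right_mono)
    also have "\<dots> \<le> 2 ^ m * schwartz_seminorm m [] (partial_deriv j f)"
      using schwartz_bound[OF schwartz_partial_deriv[OF f], of "\<xi> + t *\<^sub>R ?a" m "[]"] by (intro mult_left_mono) auto
    finally show ?thesis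
      by (simp add: M_def pos_le_divide_eq add_pos_nonneg mult.commute)
  qed
  have s_bound: "norm (s n \<xi>) \<le> M * (1 / (1 + norm \<xi>) ^ m)" for n \<xi>
  proof -
    have "norm (f (\<xi> + h n *\<^sub>R ?a) - f (\<xi> + 0 *\<^sub>R ?a)) \<le> (M * (1 / (1 + norm \<xi>) ^ m)) * norm (h n - 0)"
    proof (rule differentiable_bound[where S = "{0..1}" and f = "\<lambda>t. f (\<xi> + t *\<^sub>R ?a)"
          and f' = "\<lambda>t v. v *\<^sub>R partial_deriv j f (\<xi> + t *\<^sub>R ?a)"])
      show "((\<lambda>t. f (\<xi> + t *\<^sub>R ?a)) has_derivative (\<lambda>v. v *\<^sub>R partial_deriv j f (\<xi> + t *\<^sub>R ?a))) (at t within {0..1})" for t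
        using smooth_line_derivative[OF sm] unfolding has_vector_derivative_def .
      show "onorm (\<lambda>v. v *\<^sub>R partial_deriv j f (\<xi> + t *\<^sub>R ?a)) \<le> M * (1 / (1 + norm \<xi>) ^ m)"
        if "t \<in> {0..1}" for t
        using mult_left_mono[OF bound[OF that, of \<xi>], of "\<bar>v\<bar>" for v]
        by (intro onorm_le) (simp add: mult.commute)
    qed (use h in auto)
    from mult_left_mono[OF this, of "real (Suc n)"]
    have "real (Suc n) * norm (f (\<xi> + h n *\<^sub>R ?a) - f \<xi>) \<le> real (Suc n) * h n * (M * (1 / (1 + norm \<xi>) ^ m))"
      using h by (simp add: mult_ac del: of_nat_Suc)
    then show ?thesis
      unfolding h by (simp add: s_def norm_mult del: of_nat_Suc)
  qed
  have "(\<lambda>n. LINT \<xi>|lborel. s n \<xi>) \<longlonglongrightarrow> (LINT \<xi>|lborel. partial_deriv j f \<xi> * ?e \<xi>)"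
  proof (rule integral_dominated_convergence[where w = "\<lambda>\<xi>. M * (1 / (1 + norm \<xi>) ^ m)"])
    show "integrable lborel (\<lambda>\<xi>::real^'n. M * (1 / (1 + norm \<xi>) ^ m))"
      unfolding m_def using integrable_weight by (rule integrable_mult_right)
    have "(\<lambda>n. real (Suc n) *\<^sub>R (f (\<xi> + h n *\<^sub>R ?a) - f \<xi>)) \<longlonglongrightarrow> partial_deriv j f \<xi>" for \<xi>
      using difference_quotient_tendsto[OF smooth_line_derivative[OF sm, of \<xi> j 0 UNIV]]
      by (simp add: h_def)
    then have "(\<lambda>n. s n \<xi>) \<longlonglongrightarrow> partial_deriv j f \<xi> * ?e \<xi>" for \<xi>
      unfolding s_def by (rule tendsto_mult[OF _ tendsto_const])
    then show "AE \<xi> in lborel. (\<lambda>n. s n \<xi>) \<longlonglongrightarrow> partial_deriv j f \<xi> * ?e \<xi>"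
      by (rule AE_I2)
    show "(\<lambda>\<xi>. partial_deriv j f \<xi> * ?e \<xi>) \<in> borel_measurable lborel" "s n \<in> borel_measurable lborel" for n
      unfolding s_def by measurable
    show "AE \<xi> in lborel. norm (s n \<xi>) \<le> M * (1 / (1 + norm \<xi>) ^ m)" for n
      using s_bound by (rule AE_I2)
  qed
  moreover have "(LINT \<xi>|lborel. s n \<xi>)
    = real (Suc n) *\<^sub>R (exp (of_real (h n) * (- (\<i> * of_real (x $ j)))) - exp (of_real 0 * (- (\<i> * of_real (x $ j))))) * (LINT \<xi>|lborel. f \<xi> * ?e \<xi>)" for n
  proof -
    define F where "F \<eta> = f \<eta> * ?e \<eta> * exp (of_real (h n) * (- (\<i> * of_real (x $ j))))" for \<eta>
    have F: "f (\<xi> + h n *\<^sub>R ?a) * ?e \<xi> = F (h n *\<^sub>R ?a + \<xi>)" for \<xi>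
    proof -
      have "?e \<xi> = ?e (h n *\<^sub>R ?a + \<xi>) * exp (of_real (h n) * (- (\<i> * of_real (x $ j))))"
        unfolding exp_add[symmetric]
        by (rule arg_cong[of _ _ exp]) (simp add: inner_add_right inner_axis algebra_simps)
      then show ?thesis by (simp add: F_def add.commute mult.assoc)
    qed
    have iF: "integrable lborel F"
      unfolding F_def using integrable_inverse_fourier[OF f] by auto
    have [measurable]: "F \<in> borel_measurable borel" unfolding F_def by measurable
    have "s n \<xi> = real (Suc n) *\<^sub>R (F (h n *\<^sub>R ?a + \<xi>) - f \<xi> * ?e \<xi>)" for \<xi>
      by (simp add: s_def F[symmetric] left_diff_distrib del: of_nat_Suc)
    then have "(LINT \<xi>|lborel. s n \<xi>) = real (Suc n) *\<^sub>R ((LINT \<xi>|lborel. F \<xi>) - (LINT \<xi>|lborel. f \<xi> * ?e \<xi>))"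
      using iF integrable_inverse_fourier[OF f]
      by (simp add: integral_translate Bochner_Integration.integral_diff del: of_nat_Suc)
    then show ?thesis
      by (simp add: F_def left_diff_distrib right_diff_distrib mult.commute del: of_nat_Suc)
  qed
  moreover have "(\<lambda>n. real (Suc n) *\<^sub>R (exp (of_real (h n) * (- (\<i> * of_real (x $ j)))) - exp (of_real 0 * (- (\<i> * of_real (x $ j)))))
      * (LINT \<xi>|lborel. f \<xi> * ?e \<xi>)) \<longlonglongrightarrow> - (\<i> * of_real (x $ j)) * (LINT \<xi>|lborel. f \<xi> * ?e \<xi>)"
    unfolding h_def
  proof (rule tendsto_mult[OF difference_quotient_tendsto[where
        g = "\<lambda>t. exp (of_real t * (- (\<i> * of_real (x $ j))))"] tendsto_const])
    have "((\<lambda>z. exp (z * (- (\<i> * of_real (x $ j))))) has_field_derivative - (\<i> * of_real (x $ j))) (at (of_real 0))"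
      by (auto intro!: derivative_eq_intros)
    from has_vector_derivative_real_field[OF this]
    show "((\<lambda>t. exp (of_real t * (- (\<i> * of_real (x $ j))))) has_vector_derivative - (\<i> * of_real (x $ j))) (at 0)" .
  qed
  ultimately have "(LINT \<xi>|lborel. partial_deriv j f \<xi> * ?e \<xi>) = - (\<i> * of_real (x $ j)) * (LINT \<xi>|lborel. f \<xi> * ?e \<xi>)"
    by (simp add: LIMSEQ_unique)
  then show ?thesis by (simp add: inverse_fourier_def)
qed


subsection \<open>Domination by seminorms\<close>

text \<open>A quantity \<open>q f y\<close> depending on a Schwartz function \<open>f\<close> and a further parameter is dominated if
  it is bounded, uniformly in \<open>y\<close>, by a multiple of a finite sum of seminorms of \<open>f\<close>.\<close>

definition dominated :: "((real^'n::finite \<Rightarrow> complex) \<Rightarrow> 'b \<Rightarrow> real) \<Rightarrow> bool" where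
  "dominated q \<longleftrightarrow> (\<exists>C J. 0 \<le> C \<and> (\<forall>f\<in>schwartz. \<forall>y. q f y \<le> C * (\<Sum>(k, l)\<leftarrow>J. schwartz_seminorm k l f)))"

lemma dominatedI:
  "0 \<le> C \<Longrightarrow> (\<And>f y. f \<in> schwartz \<Longrightarrow> q f y \<le> C * (\<Sum>(k, l)\<leftarrow>J. schwartz_seminorm k l f)) \<Longrightarrow> dominated q"
  unfolding dominated_def by blast

lemma sum_list_seminorm_nonneg:
  "f \<in> schwartz \<Longrightarrow> 0 \<le> (\<Sum>(k, l)\<leftarrow>J. schwartz_seminorm k l f)"
  by (auto intro!: sum_list_nonneg simp: schwartz_seminorm_nonneg)

lemma dominated_seminorm: "dominated (\<lambda>f _. schwartz_seminorm k l f)"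
  by (rule dominatedI[of 1 _ "[(k, l)]"]) auto

lemma dominated_mono:
  fixes p :: "(real^'n::finite \<Rightarrow> complex) \<Rightarrow> 'b \<Rightarrow> real" and q :: "(real^'n \<Rightarrow> complex) \<Rightarrow> 'c \<Rightarrow> real"
  assumes "dominated q" "\<And>f y. f \<in> schwartz \<Longrightarrow> \<exists>z. p f y \<le> q f z"
  shows "dominated p"
proof -
  obtain C J where *: "0 \<le> C" "\<And>f y. f \<in> schwartz \<Longrightarrow> q f y \<le> C * (\<Sum>(k, l)\<leftarrow>J. schwartz_seminorm k l f)"
    using assms(1) unfolding dominated_def by blast
  show ?thesis
  proof (rule dominatedI[OF *(1)])
    fix f :: "real^'n \<Rightarrow> complex" and y assume f: "f \<in> schwartz"
    then obtain z where "p f y \<le> q f z" using assms(2) by blast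
    then show "p f y \<le> C * (\<Sum>(k, l)\<leftarrow>J. schwartz_seminorm k l f)" using *(2)[OF f] order_trans by blast
  qed
qed

lemma dominated_bound:
  assumes "dominated q" "\<And>f B. f \<in> schwartz \<Longrightarrow> (\<And>y. q f y \<le> B) \<Longrightarrow> p f \<le> B"
  shows "dominated (\<lambda>f _. p f)"
proof -
  obtain C J where *: "0 \<le> C" "\<And>f y. f \<in> schwartz \<Longrightarrow> q f y \<le> C * (\<Sum>(k, l)\<leftarrow>J. schwartz_seminorm k l f)"
    using assms(1) unfolding dominated_def by blast
  show ?thesis using * assms(2) by (intro dominatedI[OF *(1), of _ J]) blast
qed

lemma dominated_add:
  assumes "dominated p" "dominated q"
  shows "dominated (\<lambda>f y. p f y + q f y)"
proof -
  obtain C J where 1: "0 \<le> C" "\<And>f y. f \<in> schwartz \<Longrightarrow> p f y \<le> C * (\<Sum>(k, l)\<leftarrow>J. schwartz_seminorm k l f)"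
    using assms(1) unfolding dominated_def by blast
  obtain D K where 2: "0 \<le> D" "\<And>f y. f \<in> schwartz \<Longrightarrow> q f y \<le> D * (\<Sum>(k, l)\<leftarrow>K. schwartz_seminorm k l f)"
    using assms(2) unfolding dominated_def by blast
  show ?thesis
  proof (rule dominatedI[where C = "C + D" and J = "J @ K"])
    fix f :: "real^'a \<Rightarrow> complex" and y :: 'b assume f: "f \<in> schwartz"
    have "p f y + q f y \<le> C * (\<Sum>(k, l)\<leftarrow>J. schwartz_seminorm k l f) + D * (\<Sum>(k, l)\<leftarrow>K. schwartz_seminorm k l f)"
      by (intro add_mono 1 2 f)
    also have "\<dots> \<le> (C + D) * (\<Sum>(k, l)\<leftarrow>J @ K. schwartz_seminorm k l f)"
      using mult_nonneg_nonneg[OF 1(1) sum_list_seminorm_nonneg[OF f, of K]]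
        mult_nonneg_nonneg[OF 2(1) sum_list_seminorm_nonneg[OF f, of J]]
      by (simp add: algebra_simps)
    finally show "p f y + q f y \<le> (C + D) * (\<Sum>(k, l)\<leftarrow>J @ K. schwartz_seminorm k l f)" .
  qed (use 1 2 in auto)
qed

lemma dominated_zero: "dominated (\<lambda>f y. 0)"
  by (rule dominatedI[of 0]) auto

lemma dominated_sum:
  "finite I \<Longrightarrow> (\<And>i. i \<in> I \<Longrightarrow> dominated (q i)) \<Longrightarrow> dominated (\<lambda>f y. \<Sum>i\<in>I. q i f y)"
  by (induction I rule: finite_induct) (auto intro: dominated_zero dominated_add)

lemma dominated_sum_list:
  "(\<And>i. i \<in> set I \<Longrightarrow> dominated (q i)) \<Longrightarrow> dominated (\<lambda>f y. \<Sum>i\<leftarrow>I. q i f y)"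
  by (induction I) (auto intro: dominated_zero dominated_add)

lemma dominated_cmult:
  assumes "0 \<le> c" "dominated q" shows "dominated (\<lambda>f y. c * q f y)"
proof -
  obtain C J where *: "0 \<le> C" "\<And>f y. f \<in> schwartz \<Longrightarrow> q f y \<le> C * (\<Sum>(k, l)\<leftarrow>J. schwartz_seminorm k l f)"
    using assms(2) unfolding dominated_def by blast
  show ?thesis
    by (rule dominatedI[where C = "c * C" and J = J])
       (use assms(1) * in \<open>auto simp: mult.assoc intro: mult_left_mono\<close>)
qed

lemma dominated_compose:
  assumes q: "dominated q" and T: "\<And>f. f \<in> schwartz \<Longrightarrow> T f \<in> schwartz"
    and dom: "\<And>k l. dominated (\<lambda>f (_::unit). schwartz_seminorm k l (T f))"
  shows "dominated (\<lambda>f. q (T f))"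
proof -
  obtain C J where *: "0 \<le> C" "\<And>f y. f \<in> schwartz \<Longrightarrow> q f y \<le> C * (\<Sum>(k, l)\<leftarrow>J. schwartz_seminorm k l f)"
    using q unfolding dominated_def by blast
  have "dominated (\<lambda>f (_::unit). C * (\<Sum>(k, l)\<leftarrow>J. schwartz_seminorm k l (T f)))"
    using dominated_cmult[OF *(1) dominated_sum_list[of J "\<lambda>(k, l) f (_::unit). schwartz_seminorm k l (T f)"]] dom
    by (auto simp: split_def)
  then show ?thesis
    by (rule dominated_mono) (blast intro: *(2) T)
qed

lemma dominated_coord:
  assumes "dominated q" shows "dominated (\<lambda>f. q (\<lambda>x. of_real (x $ j) * f x))"
proof (rule dominated_compose[OF assms schwartz_coord])
  fix k l
  have "dominated (\<lambda>f (_::unit). schwartz_seminorm (Suc k) l f + (\<Sum>l'\<leftarrow>hits j l. schwartz_seminorm k l' f))"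
    by (intro dominated_add dominated_sum_list dominated_seminorm)
  then show "dominated (\<lambda>f (_::unit). schwartz_seminorm k l (\<lambda>x. of_real (x $ j) * f x))"
    by (rule dominated_mono) (use schwartz_seminorm_coord in blast)
qed

lemma dominated_cmul:
  assumes "dominated q" shows "dominated (\<lambda>f. q (\<lambda>x. c * f x))"
proof (rule dominated_compose[OF assms schwartz_cmul])
  fix k l
  have "dominated (\<lambda>f (_::unit). norm c * schwartz_seminorm k l f)"
    by (intro dominated_cmult dominated_seminorm) auto
  then show "dominated (\<lambda>f (_::unit). schwartz_seminorm k l (\<lambda>x. c * f x))"
    by (rule dominated_mono) (use schwartz_seminorm_cmul in blast)
qed

lemma dominated_partial_deriv:
  assumes "dominated q" shows "dominated (\<lambda>f. q (partial_deriv j f))"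
proof (rule dominated_compose[OF assms schwartz_partial_deriv])
  show "dominated (\<lambda>f (_::unit). schwartz_seminorm k l (partial_deriv j f))" for k l
    using dominated_seminorm[of k "l @ [j]"]
    by (rule dominated_mono) (auto simp: schwartz_seminorm_partial_deriv)
qed


subsection \<open>The inverse Fourier transform preserves the Schwartz space\<close>

lemma dominated_norm_inverse_fourier:
  "dominated (\<lambda>f x::real^'n::finite. norm (inverse_fourier f x))"
proof (rule dominatedI)
  let ?c = "(1 / (2 * pi) ^ CARD('n)) * (LINT x|lborel. 1 / (1 + norm (x::real^'n)) ^ (2 * CARD('n)))"
  show "0 \<le> ?c" by (intro mult_nonneg_nonneg integral_nonneg_AE) auto
  fix f :: "real^'n \<Rightarrow> complex" and x :: "real^'n" assume f: "f \<in> schwartz"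
  have "norm (inverse_fourier f x) = (1 / (2 * pi) ^ CARD('n)) *
      norm (LINT \<xi>|lborel. exp (\<i> * complex_of_real (x \<bullet> \<xi>)) * f \<xi>)"
    by (simp add: inverse_fourier_def norm_mult mult.commute)
  also have "\<dots> \<le> (1 / (2 * pi) ^ CARD('n)) * (1 * schwartz_seminorm (2 * CARD('n)) [] f *
      (LINT x|lborel. 1 / (1 + norm (x::real^'n)) ^ (2 * CARD('n))))"
    by (intro mult_left_mono schwartz_integral_mult f) auto
  finally show "norm (inverse_fourier f x) \<le> ?c * (\<Sum>(k, l)\<leftarrow>[(2 * CARD('n), [])]. schwartz_seminorm k l f)"
    by (simp add: mult_ac)
qed

lemma dominated_power_inverse_fourier:
  "dominated (\<lambda>f x::real^'n::finite. (1 + norm x) ^ k * norm (inverse_fourier f x))"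
proof (induction k)
  case 0
  then show ?case using dominated_norm_inverse_fourier by simp
next
  case (Suc k)
  let ?q = "\<lambda>f x::real^'n. (1 + norm x) ^ k * norm (inverse_fourier f x)"
  have "dominated (\<lambda>f x. ?q f x + (\<Sum>j\<in>UNIV. ?q (partial_deriv j f) x))"
    by (intro dominated_add dominated_sum Suc.IH dominated_partial_deriv[OF Suc.IH]) auto
  then show ?case
  proof (rule dominated_mono, intro exI)
    fix f :: "real^'n \<Rightarrow> complex" and x :: "real^'n" assume f: "f \<in> schwartz"
    have "(1 + norm x) ^ Suc k * norm (inverse_fourier f x) = ?q f x + norm x * ?q f x"
      by (simp add: algebra_simps)
    also have "norm x * ?q f x \<le> (\<Sum>j\<in>UNIV. \<bar>x $ j\<bar>) * ?q f x"
      by (intro mult_right_mono norm_le_l1_cart) auto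
    also have "\<dots> = (\<Sum>j\<in>UNIV. ?q (partial_deriv j f) x)"
      using f by (simp add: inverse_fourier_partial_deriv norm_mult sum_distrib_left mult_ac)
    finally show "(1 + norm x) ^ Suc k * norm (inverse_fourier f x)
      \<le> ?q f x + (\<Sum>j\<in>UNIV. ?q (partial_deriv j f) x)" by simp
  qed
qed

lemma partial_deriv_inverse_fourier:
  assumes "f \<in> schwartz"
  shows "partial_deriv j (inverse_fourier f) = inverse_fourier (\<lambda>\<xi>. \<i> * (of_real (\<xi> $ j) * f \<xi>))"
  by (simp add: fun_eq_iff partial_deriv_eq[OF inverse_fourier_has_derivative[OF assms]] axis_def
      if_distrib[of complex_of_real] mult_delta_left cong: if_cong)

fun mult_coords :: "'n::finite list \<Rightarrow> (real^'n \<Rightarrow> complex) \<Rightarrow> real^'n \<Rightarrow> complex" where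
  "mult_coords [] f = f"
| "mult_coords (j # l) f = (\<lambda>\<xi>. \<i> * (of_real (\<xi> $ j) * mult_coords l f \<xi>))"

lemma schwartz_mult_coords: "f \<in> schwartz \<Longrightarrow> mult_coords l f \<in> schwartz"
  by (induction l) (auto intro!: schwartz_cmul schwartz_coord)

lemma iter_deriv_inverse_fourier:
  "f \<in> schwartz \<Longrightarrow> iter_deriv l (inverse_fourier f) = inverse_fourier (mult_coords l f)"
  by (induction l) (auto simp: iter_deriv_Cons partial_deriv_inverse_fourier schwartz_mult_coords)

lemma dominated_mult_coords: "dominated q \<Longrightarrow> dominated (\<lambda>f. q (mult_coords l f))"
proof (induction l arbitrary: q)
  case (Cons j l)
  show ?case
    using Cons.IH[OF dominated_coord[OF dominated_cmul[OF Cons.prems]]] by simp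
qed simp

lemma dominated_iter_deriv_inverse_fourier:
  "dominated (\<lambda>f x. (1 + norm x) ^ k * norm (iter_deriv l (inverse_fourier f) x))"
  using dominated_mult_coords[OF dominated_power_inverse_fourier[of k], of l]
  by (rule dominated_mono) (auto simp: iter_deriv_inverse_fourier)

lemma schwartz_inverse_fourier:
  assumes f: "f \<in> schwartz" shows "inverse_fourier f \<in> schwartz"
proof (rule schwartzI)
  show "smooth (inverse_fourier f)"
    using inverse_fourier_has_derivative[OF schwartz_mult_coords[OF f]]
    by (auto simp: smooth_def iter_deriv_inverse_fourier[OF f] differentiable_def)
  show "\<exists>B. \<forall>x. (1 + norm x) ^ k * norm (iter_deriv l (inverse_fourier f) x) \<le> B" for k l
    using dominated_iter_deriv_inverse_fourier[of k l] f unfolding dominated_def by blast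
qed

lemma dominated_seminorm_inverse_fourier:
  "dominated (\<lambda>f _. schwartz_seminorm k l (inverse_fourier f))"
  using dominated_iter_deriv_inverse_fourier[of k l] by (rule dominated_bound) (rule schwartz_seminorm_le)


subsection \<open>Continuity\<close>

lemma openin_seminorm_ball:
  "f \<in> schwartz \<Longrightarrow> 0 < e \<Longrightarrow> openin schwartz_topology {g \<in> schwartz. schwartz_seminorm k l (\<lambda>x. g x - f x) < e}"
  unfolding schwartz_topology_def by (rule topology_generated_by_Basis) blast

lemma topspace_schwartz [simp]: "topspace schwartz_topology = (schwartz :: (real^'n::finite \<Rightarrow> complex) set)"
proof
  show "topspace schwartz_topology \<subseteq> (schwartz :: (real^'n \<Rightarrow> complex) set)"
    unfolding schwartz_topology_def topology_generated_by_topspace by auto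
  show "(schwartz :: (real^'n \<Rightarrow> complex) set) \<subseteq> topspace schwartz_topology"
  proof
    fix f :: "real^'n \<Rightarrow> complex" assume f: "f \<in> schwartz"
    then have "f \<in> {g \<in> schwartz. schwartz_seminorm 0 [] (\<lambda>x. g x - f x) < 1}"
      by (simp add: schwartz_seminorm_zero)
    then show "f \<in> topspace schwartz_topology"
      using openin_subset[OF openin_seminorm_ball[OF f zero_less_one, of 0 "[]"]] by blast
  qed
qed

lemma schwartz_nbhd:
  assumes f: "f \<in> schwartz"
  shows "0 < e \<Longrightarrow> \<exists>V. openin schwartz_topology V \<and> f \<in> V \<and>
    (\<forall>g\<in>V. (\<Sum>(k, l)\<leftarrow>J. schwartz_seminorm k l (\<lambda>x. g x - f x)) < e)"
proof (induction J arbitrary: e)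
  case Nil
  then show ?case using f by (intro exI[of _ schwartz]) (simp flip: topspace_schwartz)
next
  case (Cons p J)
  obtain k l where p: "p = (k, l)" by (cases p)
  obtain V where V: "openin schwartz_topology V" "f \<in> V"
      "\<And>g. g \<in> V \<Longrightarrow> (\<Sum>(k, l)\<leftarrow>J. schwartz_seminorm k l (\<lambda>x. g x - f x)) < e / 2"
    using Cons.IH[of "e / 2"] Cons.prems by auto
  let ?B = "{g \<in> schwartz. schwartz_seminorm k l (\<lambda>x. g x - f x) < e / 2}"
  have "openin schwartz_topology (?B \<inter> V)"
    using openin_seminorm_ball[OF f, of "e / 2"] V(1) Cons.prems by (intro openin_Int) auto
  moreover have "f \<in> ?B \<inter> V" using f V(2) Cons.prems by (simp add: schwartz_seminorm_zero)
  moreover have "(\<Sum>(k, l)\<leftarrow>p # J. schwartz_seminorm k l (\<lambda>x. g x - f x)) < e" if "g \<in> ?B \<inter> V" for g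
    using V(3)[of g] that by (simp add: p)
  ultimately show ?case by blast
qed

lemma dominated_nbhd:
  assumes "dominated (\<lambda>f (_::unit). p f)" "f \<in> schwartz" "0 < e"
  shows "\<exists>V. openin schwartz_topology V \<and> f \<in> V \<and> (\<forall>g\<in>V. p (\<lambda>x. g x - f x) < e)"
proof -
  obtain C J where *: "0 \<le> C" "\<And>f. f \<in> schwartz \<Longrightarrow> p f \<le> C * (\<Sum>(k, l)\<leftarrow>J. schwartz_seminorm k l f)"
    using assms(1) unfolding dominated_def by blast
  obtain V where V: "openin schwartz_topology V" "f \<in> V"
      "\<And>g. g \<in> V \<Longrightarrow> (\<Sum>(k, l)\<leftarrow>J. schwartz_seminorm k l (\<lambda>x. g x - f x)) < e / (C + 1)"
    using schwartz_nbhd[OF assms(2), of "e / (C + 1)" J] assms(3) *(1) by auto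
  have "p (\<lambda>x. g x - f x) < e" if g: "g \<in> V" for g
  proof -
    have gf: "(\<lambda>x. g x - f x) \<in> schwartz"
      using g openin_subset[OF V(1)] assms(2) by (auto intro: schwartz_diff)
    have "p (\<lambda>x. g x - f x) \<le> C * (\<Sum>(k, l)\<leftarrow>J. schwartz_seminorm k l (\<lambda>x. g x - f x))"
      by (rule *(2)[OF gf])
    also have "\<dots> \<le> C * (e / (C + 1))"
      using V(3)[OF g] *(1) by (intro mult_left_mono) auto
    also have "\<dots> < e" using *(1) assms(3) by (simp add: field_simps)
    finally show ?thesis .
  qed
  with V show ?thesis by blast
qed

lemma schwartz_continuous_operator:
  assumes T: "\<And>f. f \<in> schwartz \<Longrightarrow> T f \<in> schwartz"
    and add: "\<And>f g. f \<in> schwartz \<Longrightarrow> g \<in> schwartz \<Longrightarrow> T (\<lambda>x. f x + g x) = (\<lambda>x. T f x + T g x)"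
    and dom: "\<And>k l. dominated (\<lambda>f (_::unit). schwartz_seminorm k l (T f))"
  shows "continuous_map schwartz_topology schwartz_topology T"
  unfolding schwartz_topology_def[where 'n = 'b]
proof (rule continuous_on_generated_topo)
  show "T ` topspace schwartz_topology \<subseteq> \<Union> {{g \<in> schwartz. schwartz_seminorm k l (\<lambda>x. g x - f x) < e} |f k l e. f \<in> schwartz \<and> 0 < e}"
    using T topspace_schwartz[where 'n = 'b] unfolding schwartz_topology_def topology_generated_by_topspace by auto
  fix U :: "(real^'b \<Rightarrow> complex) set"
  assume "U \<in> {{g \<in> schwartz. schwartz_seminorm k l (\<lambda>x. g x - f x) < e} |f k l e. f \<in> schwartz \<and> 0 < e}"
  then obtain f0 k l e where U: "U = {g \<in> schwartz. schwartz_seminorm k l (\<lambda>x. g x - f0 x) < e}" and f0: "f0 \<in> schwartz"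
    by blast
  show "openin schwartz_topology (T -` U \<inter> topspace schwartz_topology)"
  proof (subst openin_subopen, intro ballI)
    fix f assume "f \<in> T -` U \<inter> topspace schwartz_topology"
    then have f: "f \<in> schwartz" and less: "schwartz_seminorm k l (\<lambda>x. T f x - f0 x) < e" by (auto simp: U)
    obtain V where V: "openin schwartz_topology V" "f \<in> V"
        "\<And>g. g \<in> V \<Longrightarrow> schwartz_seminorm k l (T (\<lambda>x. g x - f x)) < e - schwartz_seminorm k l (\<lambda>x. T f x - f0 x)"
      using dominated_nbhd[OF dom[of k l] f diff_gt_0_iff_gt[THEN iffD2, OF less]] by blast
    have "V \<subseteq> T -` U \<inter> topspace schwartz_topology"
    proof
      fix g assume gV: "g \<in> V"
      then have g: "g \<in> schwartz" using openin_subset[OF V(1)] by auto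
      have gf: "(\<lambda>x. g x - f x) \<in> schwartz" using g f by (rule schwartz_diff)
      have "T g = (\<lambda>x. T (\<lambda>x. g x - f x) x + T f x)"
        using add[OF gf f] by simp
      then have "schwartz_seminorm k l (\<lambda>x. T g x - f0 x)
        = schwartz_seminorm k l (\<lambda>x. T (\<lambda>x. g x - f x) x + (T f x - f0 x))" by (simp add: add_diff_eq)
      also have "\<dots> \<le> schwartz_seminorm k l (T (\<lambda>x. g x - f x)) + schwartz_seminorm k l (\<lambda>x. T f x - f0 x)"
        by (intro schwartz_seminorm_add schwartz_diff T gf f f0)
      also have "\<dots> < e" using V(3)[OF gV] by linarith
      finally show "g \<in> T -` U \<inter> topspace schwartz_topology" using T[OF g] g by (simp add: U)
    qed
    with V show "\<exists>V. openin schwartz_topology V \<and> f \<in> V \<and> V \<subseteq> T -` U \<inter> topspace schwartz_topology" by blast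
  qed
qed

lemma schwartz_continuous_functional:
  fixes u :: "(real^'n::finite \<Rightarrow> complex) \<Rightarrow> complex"
  assumes add: "\<And>f g. f \<in> schwartz \<Longrightarrow> g \<in> schwartz \<Longrightarrow> u (\<lambda>x. f x + g x) = u f + u g"
    and dom: "dominated (\<lambda>f (_::unit). norm (u f))"
  shows "continuous_map schwartz_topology euclidean u"
  unfolding continuous_map_def
proof (intro conjI allI impI)
  fix U :: "complex set" assume "openin euclidean U"
  then have U: "open U" by simp
  show "openin schwartz_topology {f \<in> topspace schwartz_topology. u f \<in> U}"
  proof (subst openin_subopen, intro ballI)
    fix f assume "f \<in> {f \<in> topspace schwartz_topology. u f \<in> U}"
    then have f: "f \<in> schwartz" and uf: "u f \<in> U" by auto
    obtain e where e: "0 < e" "ball (u f) e \<subseteq> U" using U uf open_contains_ball by blast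
    obtain V where V: "openin schwartz_topology V" "f \<in> V" "\<And>g. g \<in> V \<Longrightarrow> norm (u (\<lambda>x. g x - f x)) < e"
      using dominated_nbhd[OF dom f e(1)] by blast
    have "V \<subseteq> {f \<in> topspace schwartz_topology. u f \<in> U}"
    proof
      fix g assume gV: "g \<in> V"
      then have g: "g \<in> schwartz" using openin_subset[OF V(1)] by auto
      have "u g - u f = u (\<lambda>x. g x - f x)" using add[OF schwartz_diff[OF g f] f] by simp
      then have "u g \<in> ball (u f) e" using V(3)[OF gV] by (simp add: dist_norm norm_minus_commute[of "u f"])
      then show "g \<in> {f \<in> topspace schwartz_topology. u f \<in> U}" using e(2) g by auto
    qed
    with V show "\<exists>V. openin schwartz_topology V \<and> f \<in> V \<and> V \<subseteq> {f \<in> topspace schwartz_topology. u f \<in> U}" by blast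
  qed
qed auto

lemma continuous_inverse_fourier: "continuous_map schwartz_topology schwartz_topology inverse_fourier"
  by (intro schwartz_continuous_operator schwartz_inverse_fourier inverse_fourier_add
      dominated_seminorm_inverse_fourier)


section \<open>Tempered distributions\<close>

definition tempered_functional :: "((real^'n::finite \<Rightarrow> complex) \<Rightarrow> complex) \<Rightarrow> bool" where
  "tempered_functional u \<longleftrightarrow>
     (\<forall>f\<in>schwartz. \<forall>g\<in>schwartz. u (\<lambda>x. f x + g x) = u f + u g) \<and>
     (\<forall>c. \<forall>f\<in>schwartz. u (\<lambda>x. c * f x) = c * u f) \<and>
     continuous_map schwartz_topology euclidean u"

lemma tempered_functional_restrict [simp]:
  "tempered_functional (restrict u schwartz) \<longleftrightarrow> tempered_functional u"
proof -
  have "continuous_map schwartz_topology euclidean (restrict u schwartz)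
    \<longleftrightarrow> continuous_map schwartz_topology euclidean u"
    by (rule iffI; erule continuous_map_eq) simp_all
  then show ?thesis
    by (auto simp: tempered_functional_def schwartz_add schwartz_cmul)
qed

text \<open>Functionals are extensional, so that equality of distributions is equality on the Schwartz
  space.\<close>

typedef (overloaded) ('n::finite) tempered =
  "{u :: (real^'n \<Rightarrow> complex) \<Rightarrow> complex. u \<in> extensional schwartz \<and> tempered_functional u}"
  morphisms pairing Abs_tempered
proof
  show "restrict (\<lambda>_. 0) schwartz \<in>
      {u :: (real^'n \<Rightarrow> complex) \<Rightarrow> complex. u \<in> extensional schwartz \<and> tempered_functional u}"
    by simp (simp add: tempered_functional_def)
qed

text \<open>The distribution \<open>f \<mapsto> \<integral> h f\<close>; it is tempered at least for bounded measurable \<open>h\<close>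
  (see \<open>pairing_regular_distribution\<close>).\<close>

definition regular_distribution :: "(real^'n::finite \<Rightarrow> complex) \<Rightarrow> 'n tempered" where
  "regular_distribution h = Abs_tempered (restrict (\<lambda>f. LINT x|lborel. h x * f x) schwartz)"

definition tempered_inverse_fourier :: "'n::finite tempered \<Rightarrow> 'n tempered" where
  "tempered_inverse_fourier u = Abs_tempered (restrict (\<lambda>f. pairing u (inverse_fourier f)) schwartz)"

definition tempered_support :: "'n::finite tempered \<Rightarrow> (real^'n) set" where
  "tempered_support u = - \<Union>{U. open U \<and> (\<forall>f. test_function U f \<longrightarrow> pairing u f = 0)}"

lemma tempered_functional_pairing: "tempered_functional (pairing u)"
  using pairing[of u] by simp

lemma pairing_Abs_tempered:
  "tempered_functional u \<Longrightarrow> f \<in> schwartz \<Longrightarrow> pairing (Abs_tempered (restrict u schwartz)) f = u f"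
  by (subst Abs_tempered_inverse) auto

lemma pairing_tempered_inverse_fourier:
  assumes "f \<in> schwartz"
  shows "pairing (tempered_inverse_fourier u) f = pairing u (inverse_fourier f)"
  unfolding tempered_inverse_fourier_def
proof (rule pairing_Abs_tempered[OF _ assms])
  have "continuous_map schwartz_topology euclidean (pairing u \<circ> inverse_fourier)"
    using continuous_inverse_fourier tempered_functional_pairing[of u]
    unfolding tempered_functional_def by (blast intro: continuous_map_compose)
  then show "tempered_functional (\<lambda>f. pairing u (inverse_fourier f))"
    using tempered_functional_pairing[of u]
    by (simp add: tempered_functional_def inverse_fourier_add inverse_fourier_cmul
        schwartz_inverse_fourier o_def)
qed

lemma pairing_regular_distribution:
  fixes h :: "real^'n::finite \<Rightarrow> complex"
  assumes h: "h \<in> borel_measurable borel" "\<And>x. norm (h x) \<le> B" and f: "f \<in> schwartz"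
  shows "pairing (regular_distribution h) f = (LINT x|lborel. h x * f x)"
  unfolding regular_distribution_def
proof (rule pairing_Abs_tempered[OF _ f])
  note int = schwartz_integrable_mult[OF _ h]
  let ?w = "LINT x|lborel. 1 / (1 + norm (x::real^'n)) ^ (2 * CARD('n))"
  have B: "0 \<le> B" using h(2)[of 0] norm_ge_zero[of "h 0"] by linarith
  have add: "(LINT x|lborel. h x * (f x + g x)) = (LINT x|lborel. h x * f x) + (LINT x|lborel. h x * g x)"
    if "f \<in> schwartz" "g \<in> schwartz" for f g
    using int[OF that(1)] int[OF that(2)] by (simp add: distrib_left)
  have "dominated (\<lambda>f (_::unit). norm (LINT x|lborel. h x * f x))"
  proof (rule dominatedI[where C = "B * ?w" and J = "[(2 * CARD('n), [])]"])
    show "0 \<le> B * ?w" using B by (intro mult_nonneg_nonneg integral_nonneg_AE) auto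
    show "norm (LINT x|lborel. h x * f x) \<le> B * ?w * (\<Sum>(k, l)\<leftarrow>[(2 * CARD('n), [])]. schwartz_seminorm k l f)"
      if "f \<in> schwartz" for f
      using schwartz_integral_mult[OF that h] by (simp add: mult_ac)
  qed
  with add have "continuous_map schwartz_topology euclidean (\<lambda>f. LINT x|lborel. h x * f x)"
    by (rule schwartz_continuous_functional)
  moreover have "(LINT x|lborel. h x * (c * f x)) = c * (LINT x|lborel. h x * f x)" for c f
    by (simp add: mult.left_commute[of _ c])
  ultimately show "tempered_functional (\<lambda>f. LINT x|lborel. h x * f x)"
    by (simp add: tempered_functional_def add)
qed

lemma iter_deriv_eq_zero:
  assumes "x \<notin> closure {x. f x \<noteq> 0}" shows "iter_deriv l f x = 0"
  using assms
proof (induction l arbitrary: x)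
  case Nil
  then show ?case using closure_subset[of "{x. f x \<noteq> 0}"] by auto
next
  case (Cons j l)
  have "((\<lambda>x. 0) has_derivative (\<lambda>h. 0)) (at x)" by simp
  then have "(iter_deriv l f has_derivative (\<lambda>h. 0)) (at x)"
    by (rule has_derivative_transform_within_open[of _ _ _ _ "- closure {x. f x \<noteq> 0}"])
       (use Cons in \<open>auto simp: open_Compl\<close>)
  then show ?case by (simp add: iter_deriv_Cons partial_deriv_eq)
qed

lemma test_function_schwartz:
  assumes "test_function U f" shows "f \<in> schwartz"
proof (rule schwartzI)
  show sm: "smooth f" using assms by (simp add: test_function_def)
  fix k l
  let ?K = "closure {x. f x \<noteq> 0}" and ?q = "\<lambda>x. (1 + norm x) ^ k * norm (iter_deriv l f x)"
  have "compact ?K" using assms by (simp add: test_function_def)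
  moreover have "continuous_on ?K ?q"
    by (intro continuous_intros smooth_continuous_on[OF sm])
  ultimately have "bounded (?q ` ?K)" by (intro compact_imp_bounded compact_continuous_image)
  then obtain B where B: "\<And>x. x \<in> ?K \<Longrightarrow> norm (?q x) \<le> B" by (auto simp: bounded_iff)
  have "?q x \<le> max B 0" for x
  proof (cases "x \<in> ?K")
    case True
    then show ?thesis using B[of x] by simp
  next
    case False
    then show ?thesis by (simp add: iter_deriv_eq_zero)
  qed
  then show "\<exists>B. \<forall>x. ?q x \<le> B" by blast
qed


section \<open>Multi-indices\<close>

lemma finite_multi_indices: "finite {\<alpha> :: 'n::finite \<Rightarrow> nat. (\<Sum>i\<in>UNIV. \<alpha> i) \<le> N}"
proof (rule finite_subset)
  show "{\<alpha> :: 'n \<Rightarrow> nat. (\<Sum>i\<in>UNIV. \<alpha> i) \<le> N} \<subseteq> Pi\<^sub>E UNIV (\<lambda>_. {..N})"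
  proof
    fix \<alpha> :: "'n \<Rightarrow> nat" assume "\<alpha> \<in> {\<alpha>. (\<Sum>i\<in>UNIV. \<alpha> i) \<le> N}"
    moreover have "\<alpha> i \<le> (\<Sum>i\<in>UNIV. \<alpha> i)" for i by (rule member_le_sum) auto
    ultimately show "\<alpha> \<in> Pi\<^sub>E UNIV (\<lambda>_. {..N})" using order_trans by fastforce
  qed
qed (auto intro: finite_PiE)

end

theory Submission
  imports Defs "HOL-Complex_Analysis.Complex_Analysis"
begin

text \<open>If \<open>K\<^sub>t\<close> has compact support then \<open>m = e\<^sup>-\<^sup>i\<^sup>t\<^sup>\<omega>\<close> is reproduced by convolution with a Schwartz function.
  Moving derivatives onto that kernel gives Bernstein bounds \<open>A\<^sup>k\<close> for the \<open>k\<close>-th directional derivatives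
  of \<open>m\<close>, so on every line \<open>m\<close> extends to an entire function \<open>H\<close> of exponential type. Since \<open>\<bar>m\<bar> = 1\<close> on
  the line, \<open>H\<close> times its reflection is \<open>1\<close>; hence \<open>H = e\<^sup>G\<close> where the real part of \<open>G\<close> grows at most
  linearly, and \<open>G\<close> is affine. So \<open>\<omega>\<close> is affine on every line, hence affine. Conversely, for affine
  \<open>\<omega>\<close> Fourier inversion shows that \<open>K\<^sub>1\<close> is a multiple of a point mass.\<close>

section \<open>Smooth bump functions\<close>

text \<open>A cutoff b equal to 1 near the support satisfies b K = K; on the Fourier side this says
  that m equals a multiple of its convolution with \<Psi>, the transform of b. Convolution of
  distributions is bypassed by testing K against modulated, dilated cutoffs. The constants of
  Fourier inversion are never computed: all that is asked is that the integral of \<Psi> be nonzero.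
  Since the derivatives of m are reproduced by the same \<Psi>, one constant A serves for every
  order; this yields exponential type, not mere analyticity, and the growth bound on the real part
  of G rests on it. One time t suffices, because on a line -t \<omega> is a continuous phase of m,
  hence determined by m up to a constant multiple of 2 pi.\<close>

lemma smooth_coinduct:
  fixes P :: "(real^'n::finite \<Rightarrow> complex) set"
  assumes "f \<in> P"
    and diff: "\<And>f x. f \<in> P \<Longrightarrow> f differentiable (at x)"
    and deriv: "\<And>f j. f \<in> P \<Longrightarrow> \<exists>M. set M \<subseteq> P \<and> partial_deriv j f = (\<lambda>x. \<Sum>g\<leftarrow>M. g x)"
  shows "smooth f"
proof -
  define M where "M j f = (SOME M. set M \<subseteq> P \<and> partial_deriv j f = (\<lambda>x. \<Sum>g\<leftarrow>M. g x))" for j f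
  have M: "set (M j f) \<subseteq> P" "partial_deriv j f = (\<lambda>x. \<Sum>g\<leftarrow>M j f. g x)" if "f \<in> P" for f j
    using someI_ex[OF deriv[OF that, of j]] by (simp_all add: M_def)
  \<comment> \<open>By the product and chain rules a derivative rarely stays a single member of
    \<open>P\<close>, but it is a finite sum of members. Iterated derivatives inherit this form,
    which spares closed formulas for derivatives of products and compositions.\<close>
  have "\<exists>L. set L \<subseteq> P \<and> iter_deriv l f = (\<lambda>x. \<Sum>g\<leftarrow>L. g x)" for l
  proof (induction l)
    case Nil
    show ?case using assms(1) by (intro exI[of _ "[f]"]) simp
  next
    case (Cons j l)
    then obtain L where L: "set L \<subseteq> P" "iter_deriv l f = (\<lambda>x. \<Sum>g\<leftarrow>L. g x)" by blast
    have "partial_deriv j (\<lambda>x. \<Sum>g\<leftarrow>L. g x) x = (\<Sum>g\<leftarrow>L. partial_deriv j g x)" for x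
      using L(1) diff by (intro partial_deriv_sum_list) auto
    also have "\<dots> x = (\<Sum>g\<leftarrow>concat (map (M j) L). g x)" for x
      using L(1) by (induction L) (auto simp: M(2))
    finally show ?case
      using L M(1) by (intro exI[of _ "concat (map (M j) L)"]) (auto simp: iter_deriv_Cons L(2) subset_iff)
  qed
  moreover have "(\<lambda>x. \<Sum>g\<leftarrow>L. g x) differentiable (at x)" if "set L \<subseteq> P" for L x
    using that diff by (intro differentiable_sum_list) auto
  ultimately show ?thesis unfolding smooth_def by metis
qed

lemma smooth_differentiable: "smooth f \<Longrightarrow> f differentiable (at x)"
  using smoothD[of f "[]"] by simp

lemma smooth_partial_deriv: "smooth f \<Longrightarrow> smooth (partial_deriv j f)"
  using smooth_iter_deriv[of f "[j]"] by (simp add: iter_deriv_Cons)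

lemma smooth_mult:
  assumes "smooth f" "smooth g"
  shows "smooth (\<lambda>x. f x * g x)"
proof (rule smooth_coinduct[where P = "{\<lambda>x. f x * g x | f g. smooth f \<and> smooth g}"])
  fix h :: "real^'a \<Rightarrow> complex" and j
  assume "h \<in> {\<lambda>x. f x * g x | f g. smooth f \<and> smooth g}"
  then obtain f g where h: "h = (\<lambda>x. f x * g x)" and fg: "smooth f" "smooth g" by blast
  then show "h differentiable (at x)" for x
    by (simp add: smooth_differentiable)
  show "\<exists>M. set M \<subseteq> {\<lambda>x. f x * g x | f g. smooth f \<and> smooth g} \<and> partial_deriv j h = (\<lambda>x. \<Sum>g\<leftarrow>M. g x)"
    using fg by (intro exI[of _ "[\<lambda>x. f x * partial_deriv j g x, \<lambda>x. partial_deriv j f x * g x]"])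
      (auto simp: fun_eq_iff h partial_deriv_mult smooth_differentiable intro: smooth_partial_deriv)
qed (use assms in blast)

lemma smooth_const: "smooth (\<lambda>x. c)"
  by (rule smooth_coinduct[where P = "range (\<lambda>c x. c)", OF rangeI])
    (auto simp: fun_eq_iff intro!: exI[of _ "[\<lambda>x. 0]"])

lemma smooth_diff: "smooth f \<Longrightarrow> smooth g \<Longrightarrow> smooth (\<lambda>x. f x - g x)"
  using smooth_add[of f "\<lambda>x. -1 * g x"] smooth_cmul[of g "-1"] by simp

lemma smooth_sum:
  "finite I \<Longrightarrow> (\<And>i. i \<in> I \<Longrightarrow> smooth (f i)) \<Longrightarrow> smooth (\<lambda>x. \<Sum>i\<in>I. f i x)"
  by (induction I rule: finite_induct) (auto intro: smooth_const smooth_add)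

lemma smooth_compose_affine:
  fixes f :: "real^'n::finite \<Rightarrow> complex"
  assumes "smooth f"
  shows "smooth (\<lambda>x. f (c *\<^sub>R x + b))"
proof (rule smooth_coinduct[where P = "{\<lambda>x. k * f (c *\<^sub>R x + b) | k f. smooth f}"])
  show "(\<lambda>x. f (c *\<^sub>R x + b)) \<in> {\<lambda>x. k * f (c *\<^sub>R x + b) | k f. smooth f}"
    using assms by (intro CollectI exI[of _ "1::complex"] exI[of _ f]) simp
  fix h j
  assume "h \<in> {\<lambda>x. k * f (c *\<^sub>R x + b) | k f. smooth f}"
  then obtain k f where h: "h = (\<lambda>x. k * f (c *\<^sub>R x + b))" "smooth f" by blast
  obtain f' where f': "\<And>y. (f has_derivative f' y) (at y)"
    using smooth_differentiable[OF h(2)] unfolding differentiable_def by metis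
  have d: "(h has_derivative (\<lambda>v. k * f' (c *\<^sub>R x + b) (c *\<^sub>R v))) (at x)" for x
  proof -
    have "((\<lambda>x. c *\<^sub>R x + b) has_derivative (\<lambda>v. c *\<^sub>R v)) (at x)"
      by (auto intro!: derivative_eq_intros)
    from has_derivative_compose[OF this f'] show ?thesis
      unfolding h by (rule has_derivative_mult_right)
  qed
  then show "h differentiable (at x)" for x by (auto simp: differentiable_def)
  have "f' y (c *\<^sub>R v) = c *\<^sub>R f' y v" for v y
    using has_derivative_linear[OF f'] by (simp add: linear_cmul)
  then have "partial_deriv j h x = k * of_real c * partial_deriv j f (c *\<^sub>R x + b)" for x
    unfolding partial_deriv_eq[OF d] partial_deriv_eq[OF f'] by (simp add: scaleR_conv_of_real)
  then show "\<exists>M. set M \<subseteq> {\<lambda>x. k * f (c *\<^sub>R x + b) | k f. smooth f} \<and> partial_deriv j h = (\<lambda>x. \<Sum>g\<leftarrow>M. g x)"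
    using h(2) by (intro exI[of _ "[\<lambda>x. k * of_real c * partial_deriv j f (c *\<^sub>R x + b)]"])
      (auto intro: smooth_partial_deriv)
qed

lemma smooth_character:
  fixes \<eta> :: "real^'n::finite"
  shows "smooth (\<lambda>x. exp (- (\<i> * of_real (x \<bullet> \<eta>))))"
proof (rule smooth_coinduct[where P = "range (\<lambda>k x. k * exp (- (\<i> * complex_of_real (x \<bullet> \<eta>))))"])
  show "(\<lambda>x. exp (- (\<i> * of_real (x \<bullet> \<eta>)))) \<in> range (\<lambda>k x. k * exp (- (\<i> * complex_of_real (x \<bullet> \<eta>))))"
    by (intro image_eqI[of _ _ 1]) auto
  fix h j
  assume "h \<in> range (\<lambda>k x. k * exp (- (\<i> * complex_of_real (x \<bullet> \<eta>))))"
  then obtain k where h: "h = (\<lambda>x. k * exp (- (\<i> * complex_of_real (x \<bullet> \<eta>))))" by blast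
  have d: "(h has_derivative (\<lambda>v. k * (- (\<i> * of_real (v \<bullet> \<eta>)) * exp (- (\<i> * of_real (x \<bullet> \<eta>)))))) (at x)" for x
  proof -
    have "((\<lambda>x. - (\<i> * complex_of_real (x \<bullet> \<eta>))) has_derivative (\<lambda>v. - (\<i> * of_real (v \<bullet> \<eta>)))) (at x)"
      by (auto intro!: derivative_eq_intros)
    from has_derivative_compose[OF this, of exp "(*) (exp (- (\<i> * of_real (x \<bullet> \<eta>))))"] show ?thesis
      unfolding h by (intro has_derivative_mult_right) (simp add: mult_ac DERIV_exp[unfolded has_field_derivative_def])
  qed
  then show "h differentiable (at x)" for x by (auto simp: differentiable_def)
  have "partial_deriv j h = (\<lambda>x. k * - (\<i> * of_real (\<eta> $ j)) * exp (- (\<i> * complex_of_real (x \<bullet> \<eta>))))"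
    by (simp add: fun_eq_iff partial_deriv_eq[OF d] inner_axis')
  then show "\<exists>M. set M \<subseteq> range (\<lambda>k x. k * exp (- (\<i> * complex_of_real (x \<bullet> \<eta>)))) \<and> partial_deriv j h = (\<lambda>x. \<Sum>g\<leftarrow>M. g x)"
    using rangeI[of "\<lambda>k x. k * exp (- (\<i> * complex_of_real (x \<bullet> \<eta>)))" "k * - (\<i> * of_real (\<eta> $ j))"]
    by (intro exI[of _ "[partial_deriv j h]"]) simp
qed

text \<open>Differentiating \<open>D k (q x) * g x\<close> gives one term with \<open>D k\<close>
  and a derivative of g, and one with \<open>D (Suc k)\<close> and a new smooth factor containing a
  derivative of q. The products over all k and all smooth g are thus closed under differentiation up
  to sums.\<close>

lemma smooth_compose_real:
  fixes D :: "nat \<Rightarrow> real \<Rightarrow> real" and q :: "real^'n::finite \<Rightarrow> real"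
  assumes D: "\<And>k y. (D k has_real_derivative D (Suc k) y) (at y)"
    and q: "smooth (\<lambda>x. complex_of_real (q x))"
  shows "smooth (\<lambda>x. complex_of_real (D k (q x)))"
proof (rule smooth_coinduct[where P = "{\<lambda>x. of_real (D k (q x)) * g x | k g. smooth g}"])
  show "(\<lambda>x. of_real (D k (q x))) \<in> {\<lambda>x. of_real (D k (q x)) * g x | k g. smooth g}"
    by (intro CollectI exI[of _ k] exI[of _ "\<lambda>x. 1"]) (simp add: smooth_const)
  fix h j
  assume "h \<in> {\<lambda>x. of_real (D k (q x)) * g x | k g. smooth g}"
  then obtain k g where h: "h = (\<lambda>x. of_real (D k (q x)) * g x)" "smooth g" by blast
  have d: "((\<lambda>x. complex_of_real (D k (q x))) has_derivative
      (\<lambda>v. of_real (D (Suc k) (q x)) * frechet_derivative (\<lambda>x. complex_of_real (q x)) (at x) v)) (at x)" for x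
  proof -
    let ?q' = "frechet_derivative (\<lambda>x. complex_of_real (q x)) (at x)"
    have q': "((\<lambda>x. complex_of_real (q x)) has_derivative ?q') (at x)"
      using smooth_differentiable[OF q] by (simp add: frechet_derivative_works)
    have "((\<lambda>x. Re (complex_of_real (q x))) has_derivative (\<lambda>v. Re (?q' v))) (at x)"
      using q' by (rule has_derivative_Re)
    then have rq: "(q has_derivative (\<lambda>v. Re (?q' v))) (at x)" by simp
    have "((\<lambda>x. complex_of_real (q x)) has_derivative (\<lambda>v. of_real (Re (?q' v)))) (at x)"
      using rq by (rule has_derivative_of_real)
    then have "?q' = (\<lambda>v. of_real (Re (?q' v)))"
      using q' has_derivative_unique by blast
    then have *: "complex_of_real (Re (?q' v)) = ?q' v" for v by metis
    have "((\<lambda>x. D k (q x)) has_derivative (\<lambda>v. D (Suc k) (q x) * Re (?q' v))) (at x)"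
      using has_derivative_compose[OF rq D[unfolded has_field_derivative_def]] .
    from has_derivative_of_real[OF this, where 'a = complex] show ?thesis by (simp add: *)
  qed
  then have diff: "(\<lambda>x. complex_of_real (D k (q x))) differentiable (at x)" for x
    by (auto simp: differentiable_def)
  then show "h differentiable (at x)" for x
    unfolding h(1) using smooth_differentiable[OF h(2)] by (intro differentiable_mult)
  have q': "((\<lambda>x. complex_of_real (q x)) has_derivative frechet_derivative (\<lambda>x. complex_of_real (q x)) (at x)) (at x)" for x
    using smooth_differentiable[OF q] by (simp add: frechet_derivative_works)
  have "partial_deriv j (\<lambda>x. complex_of_real (D k (q x))) x
      = of_real (D (Suc k) (q x)) * partial_deriv j (\<lambda>x. complex_of_real (q x)) x" for x
    by (simp add: partial_deriv_eq[OF d] partial_deriv_eq[OF q'])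
  then show "\<exists>M. set M \<subseteq> {\<lambda>x. of_real (D k (q x)) * g x | k g. smooth g} \<and> partial_deriv j h = (\<lambda>x. \<Sum>g\<leftarrow>M. g x)"
    using h(2) diff smooth_partial_deriv[OF h(2), of j]
      smooth_mult[OF smooth_partial_deriv[OF q, of j] h(2)]
    by (intro exI[of _ "[\<lambda>x. of_real (D k (q x)) * partial_deriv j g x,
        \<lambda>x. of_real (D (Suc k) (q x)) * (partial_deriv j (\<lambda>x. complex_of_real (q x)) x * g x)]"])
      (auto simp: fun_eq_iff h(1) partial_deriv_mult smooth_differentiable mult.assoc)
qed

section \<open>A flat function and the bump built from it\<close>

definition exp_flat :: "real poly \<Rightarrow> real \<Rightarrow> real" where
  "exp_flat p y = (if 0 < y then poly p (1 / y) * exp (- (1 / y)) else 0)"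

lemma poly_times_exp_tendsto_0:
  "((\<lambda>y. poly p y * exp (- y)) \<longlongrightarrow> (0::real)) at_top"
proof -
  have "((\<lambda>y. \<Sum>i\<le>degree p. coeff p i * (y ^ i / exp y)) \<longlongrightarrow> (\<Sum>i\<le>degree p. coeff p i * 0)) at_top"
    by (intro tendsto_sum tendsto_mult tendsto_const tendsto_power_div_exp_0)
  then show ?thesis
    by (simp add: poly_altdef exp_minus divide_inverse sum_distrib_right mult.assoc)
qed

text \<open>For y > 0 the derivative of p (1/y) exp (-1/y) is (1/y)^2 (p - p') (1/y) exp (-1/y), and
  \<open>[:0, 0, 1:]\<close> is the square of the variable. The family is closed under
  differentiation, so iterating on the polynomial supplies the tower that
  \<open>smooth_compose_real\<close> asks for.\<close>

lemma exp_flat_has_derivative: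
  "(exp_flat p has_real_derivative exp_flat ([:0, 0, 1:] * (p - pderiv p)) y) (at y)"
proof -
  consider "y < 0" | "y = 0" | "0 < y" by linarith
  then show ?thesis
  proof cases
    case 1
    have "((\<lambda>y. 0) has_real_derivative exp_flat ([:0, 0, 1:] * (p - pderiv p)) y) (at y)"
      using 1 by (simp add: exp_flat_def)
    moreover have "\<forall>\<^sub>F z in nhds y. exp_flat p z = 0"
      using eventually_nhds_in_open[of "{..<0}" y] 1 by (auto simp: exp_flat_def elim!: eventually_mono)
    ultimately show ?thesis using DERIV_cong_ev[OF refl _ refl] by (rule_tac iffD2)
  next
    case 3
    have "((\<lambda>y. poly p (1 / y) * exp (- (1 / y))) has_real_derivative
        exp_flat ([:0, 0, 1:] * (p - pderiv p)) y) (at y)"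
      using 3 by (auto intro!: derivative_eq_intros DERIV_chain2[OF poly_DERIV] simp: exp_flat_def power2_eq_square field_simps)
    moreover have "\<forall>\<^sub>F z in nhds y. exp_flat p z = poly p (1 / z) * exp (- (1 / z))"
      using eventually_nhds_in_open[of "{0<..}" y] 3 by (auto simp: exp_flat_def elim!: eventually_mono)
    ultimately show ?thesis using DERIV_cong_ev[OF refl _ refl] by (rule_tac iffD2)
  next
    case 2
    \<comment> \<open>With 1/h as variable, dividing by h multiplies the polynomial by its variable,
      hence \<open>pCons 0 p\<close>; exponential decay at infinity beats any polynomial.\<close>
    have "((\<lambda>h. poly (pCons 0 p) (inverse h) * exp (- inverse h)) \<longlongrightarrow> 0) (at_right 0)"
      by (rule filterlim_compose[OF poly_times_exp_tendsto_0 filterlim_inverse_at_top_right])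
    then have "((\<lambda>h. exp_flat p h / h) \<longlongrightarrow> 0) (at_right 0)"
      by (rule Lim_transform_eventually)
        (auto simp: exp_flat_def eventually_at_right_field field_simps intro!: exI[of _ 1])
    moreover have "((\<lambda>h. exp_flat p h / h) \<longlongrightarrow> 0) (at_left 0)"
      by (rule Lim_transform_eventually[OF tendsto_const])
        (auto simp: exp_flat_def eventually_at_left_field intro!: exI[of _ "-1"])
    ultimately have "((\<lambda>h. exp_flat p h / h) \<longlongrightarrow> 0) (at 0)"
      by (simp add: filterlim_split_at)
    then show ?thesis by (simp add: 2 DERIV_def exp_flat_def)
  qed
qed

lemma smooth_compose_exp_flat:
  assumes "smooth (\<lambda>x. complex_of_real (q x))"
  shows "smooth (\<lambda>x. complex_of_real (exp_flat p (q x)))"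
  using smooth_compose_real[where D = "\<lambda>k. exp_flat (((\<lambda>p. [:0, 0, 1:] * (p - pderiv p)) ^^ k) p)" and k = 0 and q = q]
    assms exp_flat_has_derivative by simp

lemma exp_flat_1: "exp_flat 1 y = (if 0 < y then exp (- (1 / y)) else 0)"
  by (simp add: exp_flat_def)

text \<open>The inner \<open>exp_flat\<close> reaches the value \<open>exp (-1)\<close> at \<open>1\<close>, which makes the outer one vanish
  from there on.\<close>

definition bump :: "real^'n::finite \<Rightarrow> complex" where
  "bump x = of_real (exp_flat 1 (exp (-1) - exp_flat 1 ((norm x)\<^sup>2 - 1)) / exp_flat 1 (exp (-1)))"

lemma smooth_bump: "smooth (bump :: real^'n::finite \<Rightarrow> complex)"
proof -
  have "smooth (\<lambda>x::real^'n. \<Sum>j\<in>UNIV. complex_of_real (x $ j) * (of_real (x $ j) * 1))"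
    by (intro smooth_sum smooth_coord smooth_const) auto
  then have "smooth (\<lambda>x::real^'n. complex_of_real ((norm x)\<^sup>2))"
    by (simp add: power2_norm_eq_inner inner_vec_def)
  then have "smooth (\<lambda>x::real^'n. complex_of_real ((norm x)\<^sup>2 - 1))"
    using smooth_diff[OF _ smooth_const[of 1]] by fastforce
  then have "smooth (\<lambda>x::real^'n. complex_of_real (exp (-1) - exp_flat 1 ((norm x)\<^sup>2 - 1)))"
    using smooth_diff[OF smooth_const[of "of_real (exp (-1))"] smooth_compose_exp_flat] by fastforce
  from smooth_cmul[OF smooth_compose_exp_flat[OF this, of 1], of "of_real (1 / exp_flat 1 (exp (-1)))"]
  show ?thesis by (simp add: bump_def[abs_def])
qed

lemma bump_eq_1: "norm x \<le> 1 \<Longrightarrow> bump x = 1"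
proof -
  assume "norm x \<le> 1"
  then have "(norm x)\<^sup>2 - 1 \<le> 0" by (simp add: power_le_one_iff)
  then have "exp_flat 1 ((norm x)\<^sup>2 - 1) = 0" by (simp add: exp_flat_1)
  then show ?thesis by (simp add: bump_def exp_flat_1)
qed

lemma bump_eq_0: "2 \<le> norm x \<Longrightarrow> bump x = 0"
proof -
  assume "2 \<le> norm x"
  then have "1 \<le> (norm x)\<^sup>2 - 1" using power_mono[of 2 "norm x" 2] by simp
  then have "exp (-1) \<le> exp_flat 1 ((norm x)\<^sup>2 - 1)" by (simp add: exp_flat_1)
  then show ?thesis by (simp add: bump_def exp_flat_1)
qed

lemma bump_real: "bump x = of_real (Re (bump x))" and bump_nonneg: "0 \<le> Re (bump x)"
  and bump_uminus: "bump (- x) = bump x"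
  by (simp_all add: bump_def exp_flat_1)

section \<open>Vanishing off the support\<close>

lemma test_functionI:
  assumes "smooth f" "compact C" "{x. f x \<noteq> 0} \<subseteq> C" "C \<subseteq> U"
  shows "test_function U f"
proof -
  have "closure {x. f x \<noteq> 0} \<subseteq> C" using assms(2,3) by (simp add: closure_minimal compact_imp_closed)
  moreover have "compact (closure {x. f x \<noteq> 0})"
    using assms(2,3) bounded_subset compact_imp_bounded by (auto simp: compact_closure)
  ultimately show ?thesis using assms(1,4) by (auto simp: test_function_def)
qed

lemma test_function_bump: "0 < r \<Longrightarrow> test_function UNIV (\<lambda>x. bump (x /\<^sub>R r))"
proof (rule test_functionI)
  show "smooth (\<lambda>x. bump (x /\<^sub>R r))" using smooth_compose_affine[OF smooth_bump, of "inverse r" 0] by simp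
  assume "0 < r"
  then show "{x. bump (x /\<^sub>R r) \<noteq> 0} \<subseteq> cball 0 (2 * r)"
    using bump_eq_0[of "x /\<^sub>R r" for x] by (force simp: field_simps)
qed auto

section \<open>Localising a pairing by a partition of unity\<close>

lemma pairing_add:
  "f \<in> schwartz \<Longrightarrow> g \<in> schwartz \<Longrightarrow> pairing u (\<lambda>x. f x + g x) = pairing u f + pairing u g"
  and pairing_cmul: "f \<in> schwartz \<Longrightarrow> pairing u (\<lambda>x. c * f x) = c * pairing u f"
  using tempered_functional_pairing[of u] by (auto simp: tempered_functional_def)

lemma pairing_zero: "pairing u (\<lambda>x. 0) = 0"
  using pairing_cmul[OF schwartz_zero, of u 0] by simp

text \<open>A partition of unity peeled off one ball at a time: with a bump \<psi> that is 1 on the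
  ball, f \<psi> lives in the doubled ball, where the hypothesis applies, and f (1 - \<psi>)
  vanishes on the ball, so the remaining balls cover it. The doubling matches the radii 1 and 2 of
  \<open>bump\<close>.\<close>

lemma pairing_eq_0_finite_cover:
  fixes u :: "'n::finite tempered"
  assumes "finite I"
    and "\<And>x r. (x, r) \<in> I \<Longrightarrow> 0 < r"
    and "\<And>x r f. (x, r) \<in> I \<Longrightarrow> smooth f \<Longrightarrow> {y. f y \<noteq> 0} \<subseteq> cball x (2 * r) \<Longrightarrow> pairing u f = 0"
    and "smooth f" "compact C" "{y. f y \<noteq> 0} \<subseteq> C" "C \<subseteq> (\<Union>(x, r)\<in>I. ball x r)"
  shows "pairing u f = 0"
proof -
  \<comment> \<open>The induction asks only that the nonzero set of f be covered, not all of
    \<open>C\<close>: the set \<open>C\<close> stays fixed and keeps every piece compactly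
    supported, while the nonzero set shrinks.\<close>
  have "{y. f y \<noteq> 0} \<subseteq> C \<inter> (\<Union>(x, r)\<in>I. ball x r)" using assms(6,7) by blast
  with assms(1-4) show ?thesis
  proof (induction I arbitrary: f rule: finite_induct)
    case empty
    then have "f = (\<lambda>x. 0)" by auto
    then show ?case by (simp add: pairing_zero)
  next
    case (insert p I)
    obtain x r where p: "p = (x, r)" by fastforce
    have r: "0 < r" using insert.prems(1) p by blast
    let ?\<psi> = "\<lambda>y. bump (inverse r *\<^sub>R y + - (inverse r *\<^sub>R x))"
    have eq: "inverse r *\<^sub>R y + - (inverse r *\<^sub>R x) = (y - x) /\<^sub>R r" for y
      by (simp add: scaleR_diff_right)
    have psi: "smooth ?\<psi>" by (rule smooth_compose_affine[OF smooth_bump])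
    have s1: "smooth (\<lambda>y. f y * ?\<psi> y)" and s2: "smooth (\<lambda>y. f y * (1 - ?\<psi> y))"
      using psi insert.prems(3) by (auto intro!: smooth_mult smooth_diff smooth_const)
    have supp1: "{y. f y * ?\<psi> y \<noteq> 0} \<subseteq> cball x (2 * r)"
    proof
      fix y assume "y \<in> {y. f y * ?\<psi> y \<noteq> 0}"
      then have "norm ((y - x) /\<^sub>R r) < 2" using bump_eq_0[of "(y - x) /\<^sub>R r"] unfolding eq by force
      then show "y \<in> cball x (2 * r)"
        using r by (simp add: dist_norm norm_minus_commute divide_inverse_commute[symmetric] divide_less_eq)
    qed
    have supp2: "{y. f y * (1 - ?\<psi> y) \<noteq> 0} \<subseteq> C \<inter> (\<Union>(x, r)\<in>I. ball x r)"
    proof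
      fix y assume y: "y \<in> {y. f y * (1 - ?\<psi> y) \<noteq> 0}"
      then have "\<not> norm ((y - x) /\<^sub>R r) \<le> 1" using bump_eq_1[of "(y - x) /\<^sub>R r"] unfolding eq by force
      then have "y \<notin> ball x r"
        using r by (simp add: dist_norm norm_minus_commute divide_inverse_commute[symmetric] divide_le_eq)
      then show "y \<in> C \<inter> (\<Union>(x, r)\<in>I. ball x r)" using y insert.prems(4) p by fastforce
    qed
    have *: "f \<in> schwartz" if "smooth f" "{y. f y \<noteq> 0} \<subseteq> C" for f :: "real^'n \<Rightarrow> complex"
      using that assms(5) by (intro test_function_schwartz[of UNIV] test_functionI[of f C]) auto
    have "{y. f y * ?\<psi> y \<noteq> 0} \<subseteq> C" "{y. f y * (1 - ?\<psi> y) \<noteq> 0} \<subseteq> C"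
      using insert.prems(4) by auto
    from pairing_add[OF *[OF s1 this(1)] *[OF s2 this(2)]] have "pairing u (\<lambda>y. f y * ?\<psi> y + f y * (1 - ?\<psi> y))
        = pairing u (\<lambda>y. f y * ?\<psi> y) + pairing u (\<lambda>y. f y * (1 - ?\<psi> y))" .
    also have "pairing u (\<lambda>y. f y * ?\<psi> y) = 0"
      using insert.prems(2)[of x r] p s1 supp1 by blast
    also have "pairing u (\<lambda>y. f y * (1 - ?\<psi> y)) = 0"
      by (rule insert.IH[OF _ _ s2 supp2]) (rule insert.prems(1,2), auto)+
    finally show ?case by (simp add: algebra_simps)
  qed
qed

text \<open>The complement of the support is a union of open sets on which u vanishes; that u
  vanishes on the union as a whole is the gluing property of distributions, obtained from a finite
  subcover of \<open>C\<close>.\<close>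

lemma pairing_eq_0_outside_support:
  fixes u :: "'n::finite tempered"
  assumes "smooth f" "compact C" "{y. f y \<noteq> 0} \<subseteq> C" "C \<inter> tempered_support u = {}"
  shows "pairing u f = 0"
proof -
  have "\<exists>r>0. \<forall>f. smooth f \<longrightarrow> {y. f y \<noteq> 0} \<subseteq> cball x (2 * r) \<longrightarrow> pairing u f = 0" if "x \<in> C" for x
  proof -
    have "x \<in> \<Union>{U. open U \<and> (\<forall>f. test_function U f \<longrightarrow> pairing u f = 0)}"
      using assms(4) that by (auto simp: tempered_support_def)
    then obtain U where U: "open U" "x \<in> U" "\<And>f. test_function U f \<Longrightarrow> pairing u f = 0"
      by blast
    then obtain e where e: "0 < e" "cball x e \<subseteq> U" using open_contains_cball by blast
    then show ?thesis
      using U(3) test_functionI[of _ "cball x e" U] by (intro exI[of _ "e / 2"]) auto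
  qed
  then obtain r where r: "\<And>x. x \<in> C \<Longrightarrow> 0 < r x"
      "\<And>x f. x \<in> C \<Longrightarrow> smooth f \<Longrightarrow> {y. f y \<noteq> 0} \<subseteq> cball x (2 * r x) \<Longrightarrow> pairing u f = 0"
    by metis
  obtain X where X: "X \<subseteq> C" "finite X" "C \<subseteq> (\<Union>x\<in>X. ball x (r x))"
  proof (rule compactE_image[OF assms(2), of C "\<lambda>x. ball x (r x)"])
    show "C \<subseteq> (\<Union>x\<in>C. ball x (r x))" using r(1) by auto
  qed auto
  show ?thesis
    by (rule pairing_eq_0_finite_cover[OF _ _ _ assms(1-3), where I = "(\<lambda>x. (x, r x)) ` X"])
      (use X r in auto)
qed

section \<open>Fourier inversion\<close>

lemma integral_lborel_affine:
  fixes F :: "'a::euclidean_space \<Rightarrow> complex"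
  assumes [measurable]: "F \<in> borel_measurable borel" and c: "0 < c"
  shows "(LINT x|lborel. F x) = c ^ DIM('a) *\<^sub>R (LINT x|lborel. F (a + c *\<^sub>R x))"
  using c by (subst lborel_affine[of c a]) (simp_all add: integral_density integral_distr)

lemma integral_uminus:
  fixes F :: "'a::euclidean_space \<Rightarrow> complex"
  assumes [measurable]: "F \<in> borel_measurable borel"
  shows "(LINT x|lborel. F (- x)) = (LINT x|lborel. F x)"
  by (subst (2) lborel_affine[of "-1" 0]) (simp_all add: integral_density integral_distr density_1)

lemma schwartz_integrable: "f \<in> schwartz \<Longrightarrow> integrable lborel f"
  using schwartz_integrable_mult[of f "\<lambda>x. 1" 1] by simp

lemma inverse_fourier_modulate:
  "inverse_fourier (\<lambda>x. f x * exp (- (\<i> * of_real (x \<bullet> \<eta>)))) \<xi> = inverse_fourier f (\<xi> - \<eta>)"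
proof -
  have "exp (- (\<i> * of_real (x \<bullet> \<eta>))) * exp (\<i> * complex_of_real (\<xi> \<bullet> x)) = exp (\<i> * of_real ((\<xi> - \<eta>) \<bullet> x))" for x
    unfolding exp_add[symmetric] by (simp add: inner_diff_left inner_commute algebra_simps)
  then show ?thesis by (simp add: inverse_fourier_def mult.assoc)
qed

lemma inverse_fourier_dilate:
  fixes f :: "real^'n::finite \<Rightarrow> complex"
  assumes [measurable]: "f \<in> borel_measurable borel" and \<rho>: "0 < \<rho>"
  shows "inverse_fourier (\<lambda>x. f (x /\<^sub>R \<rho>)) \<xi> = \<rho> ^ CARD('n) *\<^sub>R inverse_fourier f (\<rho> *\<^sub>R \<xi>)"
  unfolding inverse_fourier_def
  by (subst integral_lborel_affine[OF _ \<rho>, of _ 0]) (use \<rho> in \<open>simp_all add: mult_ac\<close>)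

text \<open>The substitution \<xi> = \<eta> + \<zeta> / (n + 1) turns modulation and dilation of g
  into a rescaled argument of M, the Jacobian cancelling the dilation factor. The transform of g
  then no longer depends on n, and dominated convergence applies since M is bounded and continuous
  at \<eta>.\<close>

lemma inverse_fourier_approximate_identity:
  fixes M :: "real^'n::finite \<Rightarrow> complex"
  assumes M [measurable]: "M \<in> borel_measurable borel" and bound: "\<And>x. norm (M x) \<le> B"
    and cont: "isCont M \<eta>" and g: "g \<in> schwartz"
  shows "(\<lambda>n. LINT \<xi>|lborel. M \<xi> * inverse_fourier (\<lambda>x. g (x /\<^sub>R real (Suc n)) * exp (- (\<i> * of_real (x \<bullet> \<eta>)))) \<xi>)
    \<longlonglongrightarrow> M \<eta> * (LINT \<zeta>|lborel. inverse_fourier g \<zeta>)"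
proof -
  have [measurable]: "inverse_fourier g \<in> borel_measurable borel" "g \<in> borel_measurable borel"
    using g by (auto intro: schwartz_borel schwartz_inverse_fourier)
  have eq: "(LINT \<xi>|lborel. M \<xi> * inverse_fourier (\<lambda>x. g (x /\<^sub>R real (Suc n)) * exp (- (\<i> * of_real (x \<bullet> \<eta>)))) \<xi>)
      = (LINT \<zeta>|lborel. M (\<eta> + inverse (real (Suc n)) *\<^sub>R \<zeta>) * inverse_fourier g \<zeta>)" for n
    by (subst integral_lborel_affine[of _ "inverse (real (Suc n))" \<eta>])
      (simp_all add: inverse_fourier_modulate inverse_fourier_dilate power_inverse del: of_nat_Suc)
  have "(\<lambda>n. LINT \<zeta>|lborel. M (\<eta> + inverse (real (Suc n)) *\<^sub>R \<zeta>) * inverse_fourier g \<zeta>)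
      \<longlonglongrightarrow> (LINT \<zeta>|lborel. M \<eta> * inverse_fourier g \<zeta>)"
  proof (rule integral_dominated_convergence[where w = "\<lambda>\<zeta>. B * norm (inverse_fourier g \<zeta>)"])
    show "integrable lborel (\<lambda>\<zeta>. B * norm (inverse_fourier g \<zeta>))"
      using g by (intro integrable_mult_right integrable_norm schwartz_integrable schwartz_inverse_fourier)
    have "(\<lambda>n. \<eta> + inverse (real (Suc n)) *\<^sub>R \<zeta>) \<longlonglongrightarrow> \<eta> + 0 *\<^sub>R \<zeta>" for \<zeta>
      by (intro tendsto_intros LIMSEQ_inverse_real_of_nat)
    then have "(\<lambda>n. M (\<eta> + inverse (real (Suc n)) *\<^sub>R \<zeta>)) \<longlonglongrightarrow> M \<eta>" for \<zeta>
      using isCont_tendsto_compose[OF cont] by fastforce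
    then show "AE \<zeta> in lborel. (\<lambda>n. M (\<eta> + inverse (real (Suc n)) *\<^sub>R \<zeta>) * inverse_fourier g \<zeta>) \<longlonglongrightarrow> M \<eta> * inverse_fourier g \<zeta>"
      by (intro AE_I2 tendsto_mult tendsto_const)
    show "AE \<zeta> in lborel. norm (M (\<eta> + inverse (real (Suc n)) *\<^sub>R \<zeta>) * inverse_fourier g \<zeta>) \<le> B * norm (inverse_fourier g \<zeta>)" for n
      by (auto simp: norm_mult intro!: AE_I2 mult_right_mono bound)
  qed measurable
  then show ?thesis unfolding eq by simp
qed

text \<open>Fubini: the character is unimodular and symmetric in x and \<xi>, so the absolute value
  of the integrand is the product of those of f and g, and the roles of the two functions can be
  exchanged.\<close>

lemma inverse_fourier_mult_formula:
  fixes f g :: "real^'n::finite \<Rightarrow> complex"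
  assumes f: "integrable lborel f" and g: "integrable lborel g"
  shows "(LINT \<xi>|lborel. inverse_fourier f \<xi> * g \<xi>) = (LINT x|lborel. f x * inverse_fourier g x)"
proof -
  define F where "F x \<xi> = f x * exp (\<i> * complex_of_real (\<xi> \<bullet> x)) * g \<xi>" for x \<xi>
  have [measurable]: "f \<in> borel_measurable borel" "g \<in> borel_measurable borel"
    using f g by auto
  have nF: "norm (F x \<xi>) = norm (f x) * norm (g \<xi>)" for x \<xi> by (simp add: F_def norm_mult)
  have "(\<lambda>(x, \<xi>). exp (\<i> * complex_of_real (\<xi> \<bullet> x))) \<in> borel_measurable (borel :: ((real^'n) \<times> (real^'n)) measure)"
    unfolding split_def by (intro borel_measurable_continuous_onI continuous_intros)
  then have [measurable]: "(\<lambda>(x, \<xi>). exp (\<i> * complex_of_real (\<xi> \<bullet> x))) \<in> borel_measurable (lborel \<Otimes>\<^sub>M lborel :: ((real^'n) \<times> (real^'n)) measure)"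
    by (simp add: lborel_prod)
  have "integrable (lborel \<Otimes>\<^sub>M lborel) (\<lambda>(x, \<xi>). F x \<xi>)"
  proof (rule lborel_pair.Fubini_integrable)
    show "(\<lambda>(x, \<xi>). F x \<xi>) \<in> borel_measurable (lborel \<Otimes>\<^sub>M lborel)"
      unfolding F_def by measurable
    show "integrable lborel (\<lambda>x. LINT \<xi>|lborel. norm (case (x, \<xi>) of (x, \<xi>) \<Rightarrow> F x \<xi>))"
      using f by (simp add: nF)
    have "(\<lambda>\<xi>. exp (\<i> * complex_of_real (\<xi> \<bullet> x))) \<in> borel_measurable borel" for x
      by (intro borel_measurable_continuous_onI continuous_intros)
    then have "(\<lambda>\<xi>. f x * exp (\<i> * complex_of_real (\<xi> \<bullet> x)) * g \<xi>) \<in> borel_measurable lborel" for x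
      by simp
    then have "F x \<in> borel_measurable lborel" for x by (simp add: F_def[abs_def])
    then have "integrable lborel (F x)" for x
      by (rule Bochner_Integration.integrable_bound[of lborel "\<lambda>\<xi>. f x * g \<xi>", rotated])
        (use g in \<open>auto simp: nF norm_mult\<close>)
    then show "AE x in lborel. integrable lborel (\<lambda>\<xi>. case (x, \<xi>) of (x, \<xi>) \<Rightarrow> F x \<xi>)" by simp
  qed
  from lborel_pair.Fubini_integral[OF this]
  have "(LINT \<xi>|lborel. (LINT x|lborel. F x \<xi>)) = (LINT x|lborel. (LINT \<xi>|lborel. F x \<xi>))" .
  moreover have "(LINT x|lborel. F x \<xi>) = (LINT x|lborel. f x * exp (\<i> * complex_of_real (\<xi> \<bullet> x))) * g \<xi>" for \<xi>
    by (simp add: F_def)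
  moreover have "(LINT \<xi>|lborel. F x \<xi>) = f x * (LINT \<xi>|lborel. g \<xi> * exp (\<i> * complex_of_real (x \<bullet> \<xi>)))" for x
    by (simp add: F_def inner_commute mult_ac)
  ultimately show ?thesis by (simp add: inverse_fourier_def)
qed

lemma schwartz_bounded: "f \<in> schwartz \<Longrightarrow> norm (f x) \<le> schwartz_seminorm 0 [] f"
  using schwartz_bound[of f x 0 "[]"] by simp

lemma schwartz_isCont: "f \<in> schwartz \<Longrightarrow> isCont f x"
  using smooth_continuous_on[OF schwartz_smooth, of f UNIV "[]"] by (simp add: continuous_on_eq_continuous_at)

text \<open>Fourier inversion up to the value of the constant, which is never needed.\<close>

lemma inverse_fourier_inversion:
  fixes f g :: "real^'n::finite \<Rightarrow> complex"
  assumes f: "f \<in> schwartz" and g: "g \<in> schwartz"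
  shows "g 0 * (LINT \<xi>|lborel. inverse_fourier f \<xi> * exp (- (\<i> * of_real (\<xi> \<bullet> \<eta>))))
    = f \<eta> * (LINT \<zeta>|lborel. inverse_fourier g \<zeta>)"
\<comment> \<open>One sequence is computed in two ways. The multiplication formula moves the
  transform onto the dilated g, an approximate identity, and gives a multiple of f \<eta>; pointwise
  convergence of the dilated g to g 0 gives the inversion integral.\<close>
proof (rule LIMSEQ_unique)
  let ?e = "\<lambda>\<xi>. exp (- (\<i> * complex_of_real (\<xi> \<bullet> \<eta>)))"
  let ?g = "\<lambda>n \<xi>. g (\<xi> /\<^sub>R real (Suc n))"
  let ?B = "schwartz_seminorm 0 [] g"
  have [measurable]: "g \<in> borel_measurable borel" "inverse_fourier f \<in> borel_measurable borel"
      "f \<in> borel_measurable borel"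
    using f g by (auto intro: schwartz_borel schwartz_inverse_fourier)
  have e [measurable]: "?e \<in> borel_measurable borel"
    by (intro borel_measurable_continuous_onI continuous_intros)
  have int: "integrable lborel (inverse_fourier f)"
    using f by (intro schwartz_integrable schwartz_inverse_fourier)
  have "integrable lborel (\<lambda>\<xi>. ?g n \<xi> * ?e \<xi>)" for n
  proof -
    have "integrable lborel (?g n)"
    proof -
      have "integrable (density (distr lborel borel (\<lambda>x::real^'n. real (Suc n) *\<^sub>R x)) (\<lambda>_. \<bar>real (Suc n)\<bar> ^ DIM(real^'n))) (?g n)"
        using schwartz_integrable[OF g] by (simp add: integrable_density integrable_distr_eq del: of_nat_Suc)
      then show ?thesis using lborel_affine[of "real (Suc n)" "0 :: real^'n"] by simp
    qed
    then show ?thesis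
      by (rule Bochner_Integration.integrable_bound) (auto simp: norm_mult)
  qed
  then have "(LINT \<xi>|lborel. inverse_fourier f \<xi> * (?g n \<xi> * ?e \<xi>))
      = (LINT x|lborel. f x * inverse_fourier (\<lambda>\<xi>. ?g n \<xi> * ?e \<xi>) x)" for n
    by (rule inverse_fourier_mult_formula[OF schwartz_integrable[OF f]])
  then show "(\<lambda>n. LINT \<xi>|lborel. inverse_fourier f \<xi> * (?g n \<xi> * ?e \<xi>)) \<longlonglongrightarrow> f \<eta> * (LINT \<zeta>|lborel. inverse_fourier g \<zeta>)"
    using inverse_fourier_approximate_identity[of f, OF _ schwartz_bounded[OF f] schwartz_isCont[OF f] g] by simp
  have "(\<lambda>n. LINT \<xi>|lborel. inverse_fourier f \<xi> * (?g n \<xi> * ?e \<xi>)) \<longlonglongrightarrow> (LINT \<xi>|lborel. inverse_fourier f \<xi> * (g 0 * ?e \<xi>))"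
  proof (rule integral_dominated_convergence[where w = "\<lambda>\<xi>. ?B * norm (inverse_fourier f \<xi>)"])
    show "integrable lborel (\<lambda>\<xi>. ?B * norm (inverse_fourier f \<xi>))"
      using int by (intro integrable_mult_right integrable_norm)
    have "(\<lambda>n. inverse (real (Suc n)) *\<^sub>R \<xi>) \<longlonglongrightarrow> 0 *\<^sub>R \<xi>" for \<xi> :: "real^'n"
      by (intro tendsto_intros LIMSEQ_inverse_real_of_nat)
    then have "(\<lambda>n. ?g n \<xi>) \<longlonglongrightarrow> g 0" for \<xi>
      using isCont_tendsto_compose[OF schwartz_isCont[OF g]] by fastforce
    then show "AE \<xi> in lborel. (\<lambda>n. inverse_fourier f \<xi> * (?g n \<xi> * ?e \<xi>)) \<longlonglongrightarrow> inverse_fourier f \<xi> * (g 0 * ?e \<xi>)"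
      by (intro AE_I2 tendsto_mult tendsto_const)
    show "AE \<xi> in lborel. norm (inverse_fourier f \<xi> * (?g n \<xi> * ?e \<xi>)) \<le> ?B * norm (inverse_fourier f \<xi>)" for n
      using mult_right_mono[OF schwartz_bounded[OF g] norm_ge_zero]
      by (auto simp: norm_mult mult.commute[of "norm (inverse_fourier f _)"] simp del: of_nat_Suc)
  qed measurable
  then show "(\<lambda>n. LINT \<xi>|lborel. inverse_fourier f \<xi> * (?g n \<xi> * ?e \<xi>))
      \<longlonglongrightarrow> g 0 * (LINT \<xi>|lborel. inverse_fourier f \<xi> * ?e \<xi>)"
    by (simp add: mult.left_commute)
qed

text \<open>The zero set is closed and of full measure, hence everything.\<close>

lemma continuous_integral_eq_0:
  fixes f :: "real^'n::finite \<Rightarrow> real"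
  assumes "continuous_on UNIV f" "integrable lborel f" "\<And>x. 0 \<le> f x" "(LINT x|lborel. f x) = 0"
  shows "f x = 0"
proof -
  have "AE x in lborel. f x = 0" using assms by (simp add: integral_nonneg_eq_0_iff_AE)
  moreover have "closed {x. f x = 0}"
    using continuous_closed_preimage_constant[OF assms(1), of 0] by simp
  ultimately show ?thesis
    using mem_closed_if_AE_lebesgue[of "{x. f x = 0}" x] by (simp add: AE_completion)
qed

lemma bump_dilate_schwartz: "0 < r \<Longrightarrow> (\<lambda>x. bump (x /\<^sub>R r)) \<in> schwartz"
  using test_function_bump test_function_schwartz by blast

text \<open>Otherwise, by inversion, the transform of the bump would itself have zero transform; as it is real,
  the multiplication formula would make the integral of its square vanish.\<close>

lemma integral_inverse_fourier_bump_nonzero: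
  fixes b :: "real^'n::finite \<Rightarrow> complex"
  assumes r: "0 < r" and b_def: "b = (\<lambda>x. bump (x /\<^sub>R r))"
  shows "(LINT \<zeta>|lborel. inverse_fourier b \<zeta>) \<noteq> 0"
proof
  assume 0: "(LINT \<zeta>|lborel. inverse_fourier b \<zeta>) = 0"
  have b: "b \<in> schwartz" using bump_dilate_schwartz[OF r] by (simp add: b_def)
  define F where "F = inverse_fourier b"
  have F: "F \<in> schwartz" unfolding F_def by (rule schwartz_inverse_fourier[OF b])
  have [measurable]: "b \<in> borel_measurable borel" by (rule schwartz_borel[OF b])
  have b_real: "b x = of_real (Re (b x))" and b_nonneg: "0 \<le> Re (b x)" and b_even: "b (- x) = b x"
    and b0: "b 0 = 1" for x
    using bump_real bump_nonneg bump_uminus[of "x /\<^sub>R r"] by (auto simp: b_def bump_eq_1)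
  have "b 0 * (LINT \<xi>|lborel. F \<xi> * exp (- (\<i> * of_real (\<xi> \<bullet> \<eta>)))) = 0" for \<eta>
    unfolding F_def inverse_fourier_inversion[OF b b] 0 by simp
  from this[of "- \<eta>" for \<eta>] have "inverse_fourier F = (\<lambda>x. 0)"
    by (simp add: inverse_fourier_def fun_eq_iff b0 inner_commute)
  then have FF: "(LINT \<xi>|lborel. F \<xi> * F \<xi>) = 0"
    using inverse_fourier_mult_formula[OF schwartz_integrable[OF b] schwartz_integrable[OF F]]
    by (simp add: F_def)
  \<comment> \<open>As b is real and even, conjugation amounts to substituting -x for x, which
    leaves the integral unchanged. Reality of F makes its square a nonnegative function, so that a
    vanishing integral is informative.\<close>
  have "cnj (F \<xi>) = F \<xi>" for \<xi>
  proof -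
    have "cnj (b x * exp (\<i> * of_real (\<xi> \<bullet> x))) = b (- x) * exp (\<i> * of_real (\<xi> \<bullet> (- x)))" for x
    proof -
      have "cnj (b x) = b x" by (subst (1 2) b_real) simp
      then show ?thesis by (simp add: b_even exp_cnj)
    qed
    then have "cnj (LINT x|lborel. b x * exp (\<i> * of_real (\<xi> \<bullet> x))) = (LINT x|lborel. b (- x) * exp (\<i> * of_real (\<xi> \<bullet> (- x))))"
      unfolding Bochner_Integration.integral_cnj[symmetric] by (intro Bochner_Integration.integral_cong refl)
    also have "\<dots> = (LINT x|lborel. b x * exp (\<i> * of_real (\<xi> \<bullet> x)))"
      by (rule integral_uminus) measurable
    finally show ?thesis by (simp add: F_def inverse_fourier_def)
  qed
  then have F_real: "F \<xi> = of_real (Re (F \<xi>))" for \<xi> by (metis Reals_cnj_iff of_real_Re)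
  have "(Re (F 0))\<^sup>2 = 0"
  proof (rule continuous_integral_eq_0)
    have "continuous_on UNIV F" using schwartz_isCont[OF F] by (simp add: continuous_on_eq_continuous_at)
    then show "continuous_on UNIV (\<lambda>x. (Re (F x))\<^sup>2)" by (intro continuous_intros)
    have sq: "complex_of_real ((Re (F x))\<^sup>2) = F x * F x" for x
      using F_real[of x] by (metis of_real_power power2_eq_square)
    have "integrable lborel (\<lambda>x. F x * F x)"
      using schwartz_integrable_mult[OF F schwartz_borel[OF F] schwartz_bounded[OF F]] .
    from integrable_Re[OF this] show "integrable lborel (\<lambda>x. (Re (F x))\<^sup>2)"
      unfolding sq[symmetric] Re_complex_of_real .
    show "(LINT x|lborel. (Re (F x))\<^sup>2) = 0" using FF unfolding sq[symmetric] integral_complex_of_real of_real_eq_0_iff .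
  qed simp
  \<comment> \<open>F 0 is a multiple of the integral of b, so vanishing at the origin alone
    contradicts b being nonnegative with \<open>b 0 = 1\<close>.\<close>
  then have "(LINT x|lborel. b x) = 0"
    using F_real[of 0] by (simp add: F_def inverse_fourier_def)
  then have "(LINT x|lborel. complex_of_real (Re (b x))) = 0" using b_real by simp
  then have "Re (b 0) = 0"
    using schwartz_isCont[OF b] schwartz_integrable[OF b] b_nonneg
    by (intro continuous_integral_eq_0[of "\<lambda>x. Re (b x)"])
      (auto simp: continuous_on_eq_continuous_at intro!: continuous_intros continuous_at_imp_continuous_on)
  then show False by (simp add: b0)
qed

section \<open>Bernstein's inequality\<close>

text \<open>Dominated convergence of difference quotients along arbitrary null sequences. The
  derivative is taken at 0 only; elsewhere it follows by translating the base point.\<close>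

lemma has_vector_derivative_integral:
  fixes f :: "real \<Rightarrow> 'a \<Rightarrow> complex"
  assumes int: "\<And>h. integrable M (f h)" and D: "D \<in> borel_measurable M"
    and w: "integrable M w"
    and der: "\<And>x. ((\<lambda>h. f h x) has_vector_derivative D x) (at 0)"
    and bound: "\<And>h x. \<bar>h\<bar> < 1 \<Longrightarrow> norm (f h x - f 0 x) \<le> \<bar>h\<bar> * w x"
  shows "((\<lambda>h. LINT x|M. f h x) has_vector_derivative (LINT x|M. D x)) (at 0)"
proof -
  \<comment> \<open>Working within the interval from -1 to 1 confines every test sequence to the
    range where \<open>bound\<close> holds.\<close>
  have iff: "(g has_vector_derivative d) (at 0) \<longleftrightarrow> ((\<lambda>h. (g h - g 0) /\<^sub>R h) \<longlongrightarrow> d) (at 0 within {-1<..<1})"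
    for g :: "real \<Rightarrow> complex" and d
  proof -
    have eq: "norm (g (0 + h) - g 0 - h *\<^sub>R d) / norm h = norm ((g h - g 0) /\<^sub>R h - d)" if "h \<noteq> 0" for h
    proof -
      have "(g h - g 0) /\<^sub>R h - d = (g (0 + h) - g 0 - h *\<^sub>R d) /\<^sub>R h"
        using that by (simp add: scaleR_diff_right)
      then show ?thesis by (simp add: divide_inverse_commute)
    qed
    have "(g has_vector_derivative d) (at 0) \<longleftrightarrow> ((\<lambda>h. norm (g (0 + h) - g 0 - h *\<^sub>R d) / norm h) \<longlongrightarrow> 0) (at 0)"
      unfolding has_vector_derivative_def has_derivative_at by (simp add: bounded_linear_scaleR_left)
    also have "\<dots> \<longleftrightarrow> ((\<lambda>h. norm ((g h - g 0) /\<^sub>R h - d)) \<longlongrightarrow> 0) (at 0)"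
      by (rule Lim_cong_within) (use eq in simp_all)
    also have "\<dots> \<longleftrightarrow> ((\<lambda>h. (g h - g 0) /\<^sub>R h) \<longlongrightarrow> d) (at 0)"
      by (simp add: tendsto_norm_zero_iff LIM_zero_iff)
    finally show ?thesis by (subst at_within_open) auto
  qed
  show ?thesis
    unfolding iff tendsto_at_iff_sequentially
  proof (intro allI impI)
    fix X :: "nat \<Rightarrow> real"
    assume X: "\<forall>i. X i \<in> {-1<..<1} - {0}" "X \<longlonglongrightarrow> 0"
    have "(\<lambda>i. LINT x|M. (f (X i) x - f 0 x) /\<^sub>R X i) \<longlonglongrightarrow> (LINT x|M. D x)"
    proof (rule integral_dominated_convergence[where w = w])
      show "AE x in M. (\<lambda>i. (f (X i) x - f 0 x) /\<^sub>R X i) \<longlonglongrightarrow> D x"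
        using der X unfolding iff tendsto_at_iff_sequentially o_def by (intro AE_I2) auto
      show "AE x in M. norm ((f (X i) x - f 0 x) /\<^sub>R X i) \<le> w x" for i
      proof (rule AE_I2)
        fix x
        have "X i \<noteq> 0" "\<bar>X i\<bar> < 1" using X(1)[rule_format, of i] by (auto simp: abs_less_iff)
        then show "norm ((f (X i) x - f 0 x) /\<^sub>R X i) \<le> w x"
          using bound[of "X i" x] unfolding norm_scaleR by (simp add: field_simps)
      qed
      show "(\<lambda>x. (f (X i) x - f 0 x) /\<^sub>R X i) \<in> borel_measurable M" for i
        using int by (intro borel_measurable_scaleR borel_measurable_diff) auto
    qed (use D w in auto)
    then show "((\<lambda>h. ((LINT x|M. f h x) - (LINT x|M. f 0 x)) /\<^sub>R h) \<circ> X) \<longlonglongrightarrow> (LINT x|M. D x)"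
      using int by (simp add: o_def)
  qed
qed

section \<open>Directional derivatives and decay along segments\<close>

definition dir_deriv :: "real^'n::finite \<Rightarrow> (real^'n \<Rightarrow> complex) \<Rightarrow> real^'n \<Rightarrow> complex" where
  "dir_deriv v f x = (\<Sum>j\<in>UNIV. of_real (v $ j) * partial_deriv j f x)"

lemma schwartz_dir_deriv:
  assumes "f \<in> schwartz" shows "dir_deriv v f \<in> schwartz"
proof -
  have "(\<lambda>x. \<Sum>j\<in>J. of_real (v $ j) * partial_deriv j f x) \<in> schwartz" if "finite J" for J
    using that assms
    by (induction J rule: finite_induct)
      (auto intro!: schwartz_zero schwartz_add schwartz_cmul schwartz_partial_deriv)
  then show ?thesis unfolding dir_deriv_def[abs_def] by simp
qed

lemma has_vector_derivative_dir_deriv: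
  assumes "smooth f"
  shows "((\<lambda>h. f (x + h *\<^sub>R v)) has_vector_derivative dir_deriv v f (x + t *\<^sub>R v)) (at t within S)"
proof -
  obtain f' where f': "(f has_derivative f') (at (x + t *\<^sub>R v))"
    using smooth_has_derivative[OF assms] .
  have lin: "linear f'" using f' by (rule has_derivative_linear)
  have "f' v = f' (\<Sum>j\<in>UNIV. v $ j *\<^sub>R axis j 1)"
    by (simp add: basis_expansion scalar_mult_eq_scaleR[symmetric])
  also have "\<dots> = dir_deriv v f (x + t *\<^sub>R v)"
    using lin by (simp add: linear_sum linear_cmul dir_deriv_def partial_deriv_eq[OF f'])
       (simp add: scaleR_conv_of_real)
  finally have v: "f' v = dir_deriv v f (x + t *\<^sub>R v)" .
  have "((\<lambda>h. x + h *\<^sub>R v) has_derivative (\<lambda>h. h *\<^sub>R v)) (at t)"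
    by (auto intro!: derivative_eq_intros)
  from has_derivative_compose[OF this f']
  have "((\<lambda>h. f (x + h *\<^sub>R v)) has_derivative (\<lambda>h. f' (h *\<^sub>R v))) (at t)" .
  then have "((\<lambda>h. f (x + h *\<^sub>R v)) has_vector_derivative dir_deriv v f (x + t *\<^sub>R v)) (at t)"
    unfolding has_vector_derivative_def linear_cmul[OF lin] v .
  then show ?thesis by (rule has_vector_derivative_at_within)
qed

lemma norm_diff_line_le:
  fixes g g' :: "real \<Rightarrow> complex"
  assumes "\<And>t. (g has_vector_derivative g' t) (at t)" "\<And>t. \<bar>t\<bar> \<le> \<bar>h\<bar> \<Longrightarrow> norm (g' t) \<le> C"
  shows "norm (g h - g 0) \<le> \<bar>h\<bar> * C"
proof -
  have "norm (g h - g 0) \<le> C * norm (h - 0)"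
  proof (rule differentiable_bound[where S = "{-\<bar>h\<bar>..\<bar>h\<bar>}" and f' = "\<lambda>t v. v *\<^sub>R g' t"])
    show "(g has_derivative (\<lambda>v. v *\<^sub>R g' t)) (at t within {-\<bar>h\<bar>..\<bar>h\<bar>})" for t
      using assms(1)[of t] by (auto simp: has_vector_derivative_def intro: has_derivative_at_withinI)
    show "onorm (\<lambda>v. v *\<^sub>R g' t) \<le> C" if "t \<in> {-\<bar>h\<bar>..\<bar>h\<bar>}" for t
      using assms(2)[of t] that by (intro onorm_le) (auto simp: mult.commute[of C] intro!: mult_left_mono)
  qed auto
  then show ?thesis by (simp add: mult.commute)
qed

text \<open>Peetre's inequality: 1 + |x| is at most (1 + |v|) times 1 + |x + t v|, so the decay of f
  is uniform over the segment and gives one integrable majorant for all small shifts.\<close>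

lemma schwartz_translate_le_weight:
  assumes "f \<in> schwartz" "\<bar>t\<bar> \<le> 1"
  shows "norm (f (x + t *\<^sub>R v)) \<le> schwartz_seminorm m [] f * (1 + norm v) ^ m * (1 / (1 + norm x) ^ m)"
proof -
  have "norm x \<le> norm (x + t *\<^sub>R v) + norm (t *\<^sub>R v)"
    using norm_triangle_ineq4[of "x + t *\<^sub>R v" "t *\<^sub>R v"] by simp
  also have "norm (t *\<^sub>R v) \<le> norm v" using assms(2) by (simp add: mult_left_le_one_le)
  finally have "1 + norm x \<le> (1 + norm v) * (1 + norm (x + t *\<^sub>R v))"
    using mult_nonneg_nonneg[OF norm_ge_zero[of v] norm_ge_zero[of "x + t *\<^sub>R v"]]
    by (simp only: distrib_right distrib_left mult_1_left mult_1_right) linarith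
  then have "(1 + norm x) ^ m \<le> ((1 + norm v) * (1 + norm (x + t *\<^sub>R v))) ^ m"
    by (intro power_mono) auto
  then have "(1 + norm x) ^ m * norm (f (x + t *\<^sub>R v))
      \<le> (1 + norm v) ^ m * ((1 + norm (x + t *\<^sub>R v)) ^ m * norm (f (x + t *\<^sub>R v)))"
    by (auto simp flip: mult.assoc power_mult_distrib intro!: mult_right_mono)
  also have "\<dots> \<le> (1 + norm v) ^ m * schwartz_seminorm m [] f"
    using schwartz_bound[OF assms(1), of "x + t *\<^sub>R v" m "[]"] by (intro mult_left_mono) auto
  finally show ?thesis by (simp add: pos_le_divide_eq add_pos_nonneg mult_ac)
qed

text \<open>The derivative is computed by moving it onto the kernel, which gives the bound, and is
  reproduced by the same kernel, so that the step can be iterated.\<close>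

lemma reproducing_kernel_derivative:
  fixes \<Psi> g :: "real^'n::finite \<Rightarrow> complex" and v :: "real^'n"
  assumes \<Psi>: "\<Psi> \<in> schwartz" and g [measurable]: "g \<in> borel_measurable borel"
    and bound: "\<And>x. norm (g x) \<le> B"
    and rep: "\<And>x. g x = c * (LINT \<zeta>|lborel. g (x + \<zeta>) * \<Psi> \<zeta>)"
  defines "g' \<equiv> \<lambda>x. c * (LINT \<zeta>|lborel. g (x + \<zeta>) * dir_deriv (- v) \<Psi> \<zeta>)"
  shows "g' \<in> borel_measurable borel"
    and "norm (g' x) \<le> B * (norm c * (LINT \<zeta>|lborel. norm (dir_deriv (- v) \<Psi> \<zeta>)))"
    and "((\<lambda>h. g (x + h *\<^sub>R v)) has_vector_derivative g' (x + t *\<^sub>R v)) (at t)"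
    and "g' x = c * (LINT \<zeta>|lborel. g' (x + \<zeta>) * \<Psi> \<zeta>)"
proof -
  let ?D = "dir_deriv (- v) \<Psi>"
  let ?B' = "B * (norm c * (LINT \<zeta>|lborel. norm (?D \<zeta>)))"
  have D: "?D \<in> schwartz" by (rule schwartz_dir_deriv[OF \<Psi>])
  have [measurable]: "\<Psi> \<in> borel_measurable borel" "?D \<in> borel_measurable borel"
    using \<Psi> D by (auto intro: schwartz_borel)
  have sm: "smooth \<Psi>" by (rule schwartz_smooth[OF \<Psi>])
  show g' [measurable]: "g' \<in> borel_measurable borel"
    unfolding g'_def by measurable
  have int: "integrable lborel (\<lambda>\<zeta>. g (x + \<zeta>) * f \<zeta>)" if "f \<in> schwartz" for x f
    by (rule schwartz_integrable_mult[OF that _ bound]) measurable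
  show bound': "norm (g' x) \<le> ?B'" for x
  proof -
    have "norm (LINT \<zeta>|lborel. g (x + \<zeta>) * ?D \<zeta>) \<le> (LINT \<zeta>|lborel. norm (g (x + \<zeta>) * ?D \<zeta>))"
      by (rule integral_norm_bound)
    also have "\<dots> \<le> (LINT \<zeta>|lborel. B * norm (?D \<zeta>))"
      using int[OF D] schwartz_integrable[OF D] bound
      by (intro integral_mono integrable_norm integrable_mult_right) (auto simp: norm_mult intro!: mult_right_mono)
    finally have "norm (LINT \<zeta>|lborel. g (x + \<zeta>) * ?D \<zeta>) \<le> (LINT \<zeta>|lborel. B * norm (?D \<zeta>))" .
    then show ?thesis
      using mult_left_mono[of _ _ "norm c"] by (fastforce simp: g'_def norm_mult mult_ac)
  qed
  have d0: "((\<lambda>h. g (x + h *\<^sub>R v)) has_vector_derivative g' x) (at 0)" for x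
  proof -
    let ?m = "2 * CARD('n)"
    let ?C = "B * (schwartz_seminorm ?m [] ?D * (1 + norm v) ^ ?m)"
    \<comment> \<open>Translation invariance shifts the increment \<open>h *\<^sub>R v\<close> from
      g, which is not yet known to be differentiable, onto the kernel; this is where the sign in
      \<open>dir_deriv (- v)\<close> comes from.\<close>
    have eq: "g (x + h *\<^sub>R v) = c * (LINT \<zeta>|lborel. g (x + \<zeta>) * \<Psi> (\<zeta> + h *\<^sub>R - v))" for h
    proof -
      have "(LINT \<zeta>|lborel. g (x + (h *\<^sub>R v + \<zeta>)) * \<Psi> ((h *\<^sub>R v + \<zeta>) + h *\<^sub>R - v))
          = (LINT \<zeta>|lborel. g (x + \<zeta>) * \<Psi> (\<zeta> + h *\<^sub>R - v))"
        by (rule integral_translate(1)) measurable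
      then show ?thesis by (subst rep) (simp add: add.assoc)
    qed
    have "((\<lambda>h. LINT \<zeta>|lborel. g (x + \<zeta>) * \<Psi> (\<zeta> + h *\<^sub>R - v))
        has_vector_derivative (LINT \<zeta>|lborel. g (x + \<zeta>) * ?D \<zeta>)) (at 0)"
    proof (rule has_vector_derivative_integral[where w = "\<lambda>\<zeta>. ?C * (1 / (1 + norm \<zeta>) ^ ?m)"])
      show "integrable lborel (\<lambda>\<zeta>. g (x + \<zeta>) * \<Psi> (\<zeta> + h *\<^sub>R - v))" for h
      proof -
        have "integrable lborel (\<lambda>\<zeta>. g ((x + h *\<^sub>R v) + (h *\<^sub>R - v + \<zeta>)) * \<Psi> (h *\<^sub>R - v + \<zeta>))"
          by (rule integral_translate(2)[OF _ int[OF \<Psi>]]) measurable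
        then show ?thesis by (simp add: add_ac)
      qed
      show "integrable lborel (\<lambda>\<zeta>::real^'n. ?C * (1 / (1 + norm \<zeta>) ^ ?m))"
        using integrable_weight by (rule integrable_mult_right)
      fix \<zeta> h
      have der: "((\<lambda>h. \<Psi> (\<zeta> + h *\<^sub>R - v)) has_vector_derivative ?D (\<zeta> + t *\<^sub>R - v)) (at t)" for t
        by (rule has_vector_derivative_dir_deriv[OF sm])
      show "((\<lambda>h. g (x + \<zeta>) * \<Psi> (\<zeta> + h *\<^sub>R - v)) has_vector_derivative g (x + \<zeta>) * ?D \<zeta>) (at 0)"
        using has_vector_derivative_mult_right[OF der[of 0]] by simp
      assume h: "\<bar>h\<bar> < (1::real)"
      have "norm (\<Psi> (\<zeta> + h *\<^sub>R - v) - \<Psi> (\<zeta> + 0 *\<^sub>R - v))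
          \<le> \<bar>h\<bar> * (schwartz_seminorm ?m [] ?D * (1 + norm v) ^ ?m * (1 / (1 + norm \<zeta>) ^ ?m))"
        using schwartz_translate_le_weight[OF D, of _ \<zeta> "- v" ?m] h
        by (intro norm_diff_line_le[OF der]) auto
      then have "norm (g (x + \<zeta>)) * norm (\<Psi> (\<zeta> + h *\<^sub>R - v) - \<Psi> (\<zeta> + 0 *\<^sub>R - v))
          \<le> B * (\<bar>h\<bar> * (schwartz_seminorm ?m [] ?D * (1 + norm v) ^ ?m * (1 / (1 + norm \<zeta>) ^ ?m)))"
        by (rule mult_mono[OF bound]) (auto intro: order_trans[OF norm_ge_zero bound])
      then show "norm (g (x + \<zeta>) * \<Psi> (\<zeta> + h *\<^sub>R - v) - g (x + \<zeta>) * \<Psi> (\<zeta> + 0 *\<^sub>R - v))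
          \<le> \<bar>h\<bar> * (?C * (1 / (1 + norm \<zeta>) ^ ?m))"
        unfolding right_diff_distrib[symmetric] norm_mult by (simp only: mult_ac)
    qed measurable
    then show ?thesis unfolding eq g'_def by (rule has_vector_derivative_mult_right)
  qed
  show der: "((\<lambda>h. g (x + h *\<^sub>R v)) has_vector_derivative g' (x + t *\<^sub>R v)) (at t)" for x t
  proof -
    have 1: "((\<lambda>h. h - t) has_vector_derivative 1) (at t)"
      by (auto intro!: derivative_eq_intros)
    have "((\<lambda>h. g (x + t *\<^sub>R v + h *\<^sub>R v)) has_vector_derivative g' (x + t *\<^sub>R v)) (at (t - t))"
      using d0 by simp
    from vector_diff_chain_at[OF 1 this] show ?thesis by (simp add: o_def algebra_simps)
  qed
  \<comment> \<open>The reproducing formula is differentiated once more, now with the derivative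
    falling on g. Uniqueness of derivatives equates the result with the g' found from the kernel, so
    g' satisfies the same formula.\<close>
  have "((\<lambda>h. LINT \<zeta>|lborel. g (x + \<zeta> + h *\<^sub>R v) * \<Psi> \<zeta>)
      has_vector_derivative (LINT \<zeta>|lborel. g' (x + \<zeta>) * \<Psi> \<zeta>)) (at 0)"
  proof (rule has_vector_derivative_integral[where w = "\<lambda>\<zeta>. ?B' * norm (\<Psi> \<zeta>)"])
    show "integrable lborel (\<lambda>\<zeta>. g (x + \<zeta> + h *\<^sub>R v) * \<Psi> \<zeta>)" for h
      using int[OF \<Psi>, of "x + h *\<^sub>R v"] by (simp add: add_ac)
    show "integrable lborel (\<lambda>\<zeta>. ?B' * norm (\<Psi> \<zeta>))"
      using schwartz_integrable[OF \<Psi>] by (intro integrable_mult_right integrable_norm)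
    fix \<zeta> h
    show "((\<lambda>h. g (x + \<zeta> + h *\<^sub>R v) * \<Psi> \<zeta>) has_vector_derivative g' (x + \<zeta>) * \<Psi> \<zeta>) (at 0)"
      by (rule has_vector_derivative_mult_left[OF d0])
    have "norm (g (x + \<zeta> + h *\<^sub>R v) - g (x + \<zeta> + 0 *\<^sub>R v)) \<le> \<bar>h\<bar> * ?B'"
      by (intro norm_diff_line_le[OF der] bound')
    from mult_right_mono[OF this norm_ge_zero[of "\<Psi> \<zeta>"]]
    show "norm (g (x + \<zeta> + h *\<^sub>R v) * \<Psi> \<zeta> - g (x + \<zeta> + 0 *\<^sub>R v) * \<Psi> \<zeta>) \<le> \<bar>h\<bar> * (?B' * norm (\<Psi> \<zeta>))"
      unfolding left_diff_distrib[symmetric] norm_mult by (simp only: mult.assoc)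
  qed measurable
  then have "((\<lambda>h. c * (LINT \<zeta>|lborel. g (x + h *\<^sub>R v + \<zeta>) * \<Psi> \<zeta>))
      has_vector_derivative c * (LINT \<zeta>|lborel. g' (x + \<zeta>) * \<Psi> \<zeta>)) (at 0)"
    by (intro has_vector_derivative_mult_right) (simp add: add_ac)
  then have "((\<lambda>h. g (x + h *\<^sub>R v)) has_vector_derivative c * (LINT \<zeta>|lborel. g' (x + \<zeta>) * \<Psi> \<zeta>)) (at 0)"
    by (simp flip: rep)
  then show "g' x = c * (LINT \<zeta>|lborel. g' (x + \<zeta>) * \<Psi> \<zeta>)"
    by (rule vector_derivative_unique_at[OF d0])
qed

text \<open>The derivative step is applied k times. As c and \<Psi> never change, each step costs
  the same factor A, namely |c| times the L1 norm of the directional derivative of \<Psi>; this is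
  Bernstein's inequality along the line through x in direction v.\<close>

lemma reproducing_kernel_exponential_type:
  fixes \<Psi> g :: "real^'n::finite \<Rightarrow> complex"
  assumes \<Psi>: "\<Psi> \<in> schwartz" and g: "g \<in> borel_measurable borel"
    and bound: "\<And>x. norm (g x) \<le> 1"
    and rep: "\<And>x. g x = c * (LINT \<zeta>|lborel. g (x + \<zeta>) * \<Psi> \<zeta>)"
  obtains A d where "d 0 = (\<lambda>s. g (x + s *\<^sub>R v))"
    "\<forall>k s. (d k has_vector_derivative d (Suc k) s) (at s)" "\<forall>k s. norm (d k s) \<le> A ^ k"
proof
  define G where "G k = ((\<lambda>g x. c * (LINT \<zeta>|lborel. g (x + \<zeta>) * dir_deriv (- v) \<Psi> \<zeta>)) ^^ k) g" for k
  define A where "A = norm c * (LINT \<zeta>|lborel. norm (dir_deriv (- v) \<Psi> \<zeta>))"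
  have G_Suc: "G (Suc k) = (\<lambda>x. c * (LINT \<zeta>|lborel. G k (x + \<zeta>) * dir_deriv (- v) \<Psi> \<zeta>))" for k
    by (simp add: G_def)
  have *: "G k \<in> borel_measurable borel \<and> (\<forall>x. norm (G k x) \<le> A ^ k) \<and>
      (\<forall>x. G k x = c * (LINT \<zeta>|lborel. G k (x + \<zeta>) * \<Psi> \<zeta>))" for k
  proof (induction k)
    case 0
    show ?case unfolding G_def funpow_0 power_0 using g bound rep by blast
  next
    case (Suc k)
    then have "G k \<in> borel_measurable borel" "\<And>x. norm (G k x) \<le> A ^ k"
      "\<And>x. G k x = c * (LINT \<zeta>|lborel. G k (x + \<zeta>) * \<Psi> \<zeta>)" by blast+
    note step = reproducing_kernel_derivative[OF \<Psi> this, where v = v, folded A_def]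
    show ?case
      unfolding G_Suc
    proof (intro conjI allI)
      show "norm (c * (LINT \<zeta>|lborel. G k (x + \<zeta>) * dir_deriv (- v) \<Psi> \<zeta>)) \<le> A ^ Suc k" for x
        using step(2)[of x] by (simp add: mult.commute)
    qed (rule step(1,4))+
  qed
  show "(\<lambda>s. G 0 (x + s *\<^sub>R v)) = (\<lambda>s. g (x + s *\<^sub>R v))" by (simp add: G_def)
  show "\<forall>k s. ((\<lambda>s. G k (x + s *\<^sub>R v)) has_vector_derivative G (Suc k) (x + s *\<^sub>R v)) (at s)"
  proof (intro allI)
    fix k s
    have "G k \<in> borel_measurable borel" "\<And>x. norm (G k x) \<le> A ^ k"
      "\<And>x. G k x = c * (LINT \<zeta>|lborel. G k (x + \<zeta>) * \<Psi> \<zeta>)" using *[of k] by blast+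
    from reproducing_kernel_derivative(3)[OF \<Psi> this, where v = v] show "((\<lambda>s. G k (x + s *\<^sub>R v)) has_vector_derivative G (Suc k) (x + s *\<^sub>R v)) (at s)"
      unfolding G_Suc .
  qed
  show "\<forall>k s. norm (G k (x + s *\<^sub>R v)) \<le> A ^ k" using * by blast
qed

section \<open>Unimodular functions of exponential type\<close>

text \<open>The Lagrange remainder of order n is at most (A |x|)^n / n!. That form of the remainder
  is tied to real values, so complex functions are treated through their real and imaginary
  parts.\<close>

lemma Maclaurin_sums_exponential_type:
  fixes d :: "nat \<Rightarrow> real \<Rightarrow> real"
  assumes d: "\<And>k s. (d k has_real_derivative d (Suc k) s) (at s)"
    and bound: "\<And>k s. \<bar>d k s\<bar> \<le> A ^ k"
  shows "(\<lambda>k. d k 0 / fact k * x ^ k) sums d 0 x"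
  unfolding sums_def
proof (rule LIM_zero_cancel, rule Lim_null_comparison)
  show "(\<lambda>n. inverse (fact n) * (A * \<bar>x\<bar>) ^ n) \<longlonglongrightarrow> 0"
    by (rule summable_LIMSEQ_zero[OF summable_exp])
  show "\<forall>\<^sub>F n in sequentially. norm ((\<Sum>k<n. d k 0 / fact k * x ^ k) - d 0 x) \<le> inverse (fact n) * (A * \<bar>x\<bar>) ^ n"
  proof (rule always_eventually, rule allI)
    fix n
    obtain t where t: "d 0 x = (\<Sum>k<n. d k 0 / fact k * x ^ k) + d n t / fact n * x ^ n"
      using Maclaurin_all_le[of d "d 0" x n] d by blast
    have "norm ((\<Sum>k<n. d k 0 / fact k * x ^ k) - d 0 x) = inverse (fact n) * (\<bar>d n t\<bar> * \<bar>x\<bar> ^ n)"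
      unfolding t by (simp add: abs_mult power_abs field_simps)
    also have "\<dots> \<le> inverse (fact n) * (A ^ n * \<bar>x\<bar> ^ n)"
      by (intro mult_left_mono mult_right_mono bound) auto
    finally show "norm ((\<Sum>k<n. d k 0 / fact k * x ^ k) - d 0 x) \<le> inverse (fact n) * (A * \<bar>x\<bar>) ^ n"
      by (simp add: power_mult_distrib)
  qed
qed

text \<open>H is the Taylor series at 0; its terms are dominated by those of exp (A |z|), which
  gives convergence and the growth bound at once.\<close>

lemma entire_extension_exponential_type:
  fixes d :: "nat \<Rightarrow> real \<Rightarrow> complex"
  assumes d: "\<And>k s. (d k has_vector_derivative d (Suc k) s) (at s)"
    and bound: "\<And>k s. norm (d k s) \<le> A ^ k"
  obtains H where "H holomorphic_on UNIV" "\<And>s. H (of_real s) = d 0 s"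
    "\<And>z. norm (H z) \<le> exp (A * norm z)"
proof
  define H where "H z = (\<Sum>k. d k 0 / fact k * z ^ k)" for z :: complex
  have le: "norm (d k 0 / fact k * z ^ k) \<le> (A * norm z) ^ k /\<^sub>R fact k" for k z
    using mult_right_mono[OF bound[of k 0], of "norm z ^ k / fact k"]
    by (simp add: norm_mult norm_divide norm_power power_mult_distrib field_simps)
  have sm: "summable (\<lambda>k. (A * norm z) ^ k /\<^sub>R fact k)" for z :: complex
    by (rule summable_exp_generic)
  have sums: "(\<lambda>k. d k 0 / fact k * z ^ k) sums H z" for z
    unfolding H_def by (rule summable_sums[OF summable_comparison_test'[OF sm le]])
  have "H holomorphic_on ball 0 (norm z + 1)" for z :: complex
    by (rule power_series_holomorphic[where a = "\<lambda>k. d k 0 / fact k"]) (use sums in simp)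
  then have "H field_differentiable (at z)" for z
    by (rule holomorphic_on_imp_differentiable_at[where s = "ball 0 (norm z + 1)"]) auto
  then show "H holomorphic_on UNIV" by (simp add: holomorphic_on_def)
  show "norm (H z) \<le> exp (A * norm z)" for z
    unfolding H_def exp_def by (rule norm_suminf_le[OF le sm])
  show "H (of_real s) = d 0 s" for s
  proof -
    have "(\<lambda>k. Re (d k 0) / fact k * s ^ k) sums Re (d 0 s)"
    proof (rule Maclaurin_sums_exponential_type[of "\<lambda>k s. Re (d k s)"])
      show "((\<lambda>s. Re (d k s)) has_real_derivative Re (d (Suc k) s)) (at s)" for k s
        using d[of k s] unfolding has_vector_derivative_complex_iff by blast
      show "\<bar>Re (d k s)\<bar> \<le> A ^ k" for k s using abs_Re_le_cmod bound order_trans by blast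
    qed
    moreover have "(\<lambda>k. Im (d k 0) / fact k * s ^ k) sums Im (d 0 s)"
    proof (rule Maclaurin_sums_exponential_type[of "\<lambda>k s. Im (d k s)"])
      show "((\<lambda>s. Im (d k s)) has_real_derivative Im (d (Suc k) s)) (at s)" for k s
        using d[of k s] unfolding has_vector_derivative_complex_iff by blast
      show "\<bar>Im (d k s)\<bar> \<le> A ^ k" for k s using abs_Im_le_cmod bound order_trans by blast
    qed
    moreover have "d k 0 / fact k * of_real s ^ k = d k 0 * of_real (s ^ k / fact k)" for k
      by simp
    then have "Re (d k 0 / fact k * of_real s ^ k) = Re (d k 0) / fact k * s ^ k"
      "Im (d k 0 / fact k * of_real s ^ k) = Im (d k 0) / fact k * s ^ k" for k
      by (simp_all only: times_complex.sel Re_complex_of_real Im_complex_of_real, simp_all)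
    ultimately have "(\<lambda>k. d k 0 / fact k * of_real s ^ k) sums d 0 s"
      by (simp only: sums_complex_iff)
    then show ?thesis by (rule sums_unique2[OF sums])
  qed
qed

text \<open>Dividing by \<open>2 M - f\<close> maps the half-plane \<open>Re < M\<close> into the unit disc, so that the Schwarz
  lemma applies.\<close>

lemma entire_bounded_real_part_linear:
  assumes hol: "f holomorphic_on UNIV" and f0: "f 0 = 0" and A: "0 < A"
    and Re: "\<And>z. Re (f z) \<le> A * norm z"
  obtains c where "\<And>z. f z = c * z"
proof -
  have "norm (f w) \<le> 4 * A * norm w" for w
  proof (cases "w = 0")
    case False
    \<comment> \<open>With r = 2 |w| the point w / r has modulus 1/2, and M bounds the real part of
      f on the disc of radius r.\<close>
    define r where "r = 2 * norm w"
    define M where "M = A * r"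
    have r: "0 < r" and M: "0 < M" using False A by (simp_all add: r_def M_def)
    have lt: "Re (f (of_real r * z)) < M" if "norm z < 1" for z
    proof -
      have "Re (f (of_real r * z)) \<le> M * norm z"
        using Re[of "of_real r * z"] r by (simp add: norm_mult M_def)
      also have "\<dots> < M" using M that by simp
      finally show ?thesis .
    qed
    have ne: "2 * of_real M - f (of_real r * z) \<noteq> 0" if "norm z < 1" for z
    proof
      assume "2 * of_real M - f (of_real r * z) = 0"
      then have "Re (2 * of_real M - f (of_real r * z)) = 0" by simp
      then show False using lt[OF that] M by simp
    qed
    define \<phi> where "\<phi> z = f (of_real r * z) / (2 * of_real M - f (of_real r * z))" for z
    have "(\<lambda>z. f (of_real r * z)) holomorphic_on ball 0 1"
      by (rule holomorphic_on_compose_gen[OF _ hol, unfolded o_def]) (auto intro!: holomorphic_intros)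
    then have "\<phi> holomorphic_on ball 0 1"
      unfolding \<phi>_def using ne by (auto intro!: holomorphic_intros)
    moreover have "\<phi> 0 = 0" by (simp add: \<phi>_def f0)
    moreover have "norm (\<phi> z) < 1" if "norm z < 1" for z
    proof -
      \<comment> \<open>Points with Re u < M are nearer to 0 than to 2 M.\<close>
      have "(2 * M - Re u)\<^sup>2 > (Re u)\<^sup>2" if "Re u < M" for u
        using that M by (auto simp: power2_eq_square algebra_simps)
      then have "(norm (f (of_real r * z)))\<^sup>2 < (norm (2 * of_real M - f (of_real r * z)))\<^sup>2"
        using lt[OF that] by (simp add: cmod_power2)
      then have "norm (f (of_real r * z)) < norm (2 * of_real M - f (of_real r * z))"
        by (rule power2_less_imp_less) simp
      then show ?thesis by (simp add: \<phi>_def norm_divide divide_less_eq ne[OF that])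
    qed
    moreover have half: "norm (w / of_real r) = 1 / 2"
      using False by (simp add: norm_divide r_def)
    ultimately have "norm (\<phi> (w / of_real r)) \<le> 1 / 2"
      using Schwarz_Lemma(1)[of \<phi> "w / of_real r"] by simp
    \<comment> \<open>Solving |f w| \<le> (2 M + |f w|) / 2 for |f w| gives the bound 2 M = 4 A |w|,
      the source of the 4.\<close>
    then have "norm (f w) \<le> norm (2 * of_real M - f w) / 2"
      using r ne[of "w / of_real r"] half by (simp add: \<phi>_def norm_divide field_simps)
    also have "\<dots> \<le> (2 * M + norm (f w)) / 2"
      using norm_triangle_ineq4[of "2 * of_real M" "f w"] M by (simp add: norm_mult)
    finally show ?thesis by (simp add: M_def r_def)
  qed (simp add: f0)
  \<comment> \<open>Linear growth limits the Taylor expansion to degree one; the exponent 1 is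
    written out to fit the polynomial form of Liouville's theorem.\<close>
  then have "norm (f z) \<le> (4 * A) * norm z ^ 1" for z by simp
  then have "f z = (\<Sum>k\<le>1. (deriv ^^ k) f 0 / fact k * z ^ k)" for z
    by (intro Liouville_polynomial[OF hol, of 0]) simp
  then show thesis by (intro that[of "deriv f 0"]) (simp add: f0)
qed

lemma unimodular_exponential_type:
  fixes d :: "nat \<Rightarrow> real \<Rightarrow> complex"
  assumes d: "\<And>k s. (d k has_vector_derivative d (Suc k) s) (at s)"
    and bound: "\<And>k s. norm (d k s) \<le> A ^ k" and norm_1: "\<And>s. norm (d 0 s) = 1"
  obtains a b :: real where "\<And>s. d 0 s = cis (a * s + b)"
proof -
  obtain H where H: "H holomorphic_on UNIV" "\<And>s. H (of_real s) = d 0 s"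
    "\<And>z. norm (H z) \<le> exp (A * norm z)"
    using entire_extension_exponential_type[OF d bound] by blast
  have A: "0 \<le> A" using bound[of 1 0] norm_ge_zero[of "d 1 0"] by (metis order_trans power_one_right)
  have cnj: "(cnj \<circ> H \<circ> cnj) holomorphic_on UNIV"
    using H(1) by (intro holomorphic_on_compose_cnj_cnj) (auto intro: holomorphic_on_subset)
  \<comment> \<open>On the real axis cnj z = z, and the product is |d 0|^2 = 1; the identity theorem
    spreads this to the plane. Its purpose is that H has no zeros, so that a holomorphic logarithm
    exists.\<close>
  have "H z * cnj (H (cnj z)) - 1 = 0" for z
  proof (rule analytic_continuation[where S = UNIV and U = \<real> and \<xi> = 0
        and f = "\<lambda>z. H z * cnj (H (cnj z)) - 1" and w = z])
    show "(\<lambda>z. H z * cnj (H (cnj z)) - 1) holomorphic_on UNIV"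
      using H(1) cnj by (auto intro!: holomorphic_intros simp: o_def)
    show "(0::complex) islimpt \<real>"
      unfolding islimpt_approachable
    proof (intro allI impI)
      fix e :: real assume "0 < e"
      then show "\<exists>x'\<in>\<real>. x' \<noteq> 0 \<and> dist x' (0::complex) < e"
        by (intro bexI[of _ "of_real (e / 2)"]) (auto simp: norm_divide)
    qed
    show "H z * cnj (H (cnj z)) - 1 = 0" if "z \<in> \<real>" for z
      using that norm_1 by (auto simp: Reals_def H(2) simp flip: complex_norm_square)
  qed auto
  then have inverse: "H z * cnj (H (cnj z)) = 1" for z by simp
  have nz: "H z \<noteq> 0" for z using inverse[of z] by auto
  have "\<exists>G. G holomorphic_on UNIV \<and> (\<forall>z. H z = exp (G z))"
    by (rule contractible_imp_holomorphic_log[OF H(1) contractible_UNIV nz]) (intro exI conjI allI, assumption, simp only: UNIV_I)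
  then obtain G where G: "G holomorphic_on UNIV" "\<And>z. H z = exp (G z)" by blast
  have ReG: "Re (G z) \<le> A * norm z" for z
    using H(3)[of z] by (simp add: G(2))
  have G_real: "Re (G (of_real s)) = 0" for s
    using norm_1[of s] by (simp flip: H(2) add: G(2))
  obtain c where c: "\<And>z. G z - G 0 = c * z"
  \<comment> \<open>A may be 0, while the lemma asks for a positive slope, hence
    \<open>A + 1\<close>. Subtracting G 0 does not alter the real part, since G is purely imaginary
    on the real axis.\<close>
  proof (rule entire_bounded_real_part_linear[of "\<lambda>z. G z - G 0" "A + 1"])
    show "Re (G z - G 0) \<le> (A + 1) * norm z" for z
      using add_mono[OF ReG[of z] norm_ge_zero[of z]] G_real[of 0] by (simp add: distrib_right)
  qed (use A G(1) in \<open>auto intro!: holomorphic_intros\<close>)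
  have "Re c = 0" using c[of 1] G_real[of 0] G_real[of 1] by (metis minus_complex.simps(1) diff_zero mult.right_neutral of_real_0 of_real_1)
  have "d 0 s = cis (Im c * s + Im (G 0))" for s
  proof -
    have "G (of_real s) = G 0 + c * of_real s" using c[of "of_real s"] by (simp add: algebra_simps)
    also have "\<dots> = \<i> * of_real (Im c * s + Im (G 0))"
      using \<open>Re c = 0\<close> G_real[of 0] by (simp add: complex_eq_iff)
    finally show ?thesis by (simp flip: H(2) add: G(2) cis_conv_exp)
  qed
  then show thesis by (rule that)
qed

section \<open>Affine dispersion relations\<close>

lemma pairing_fourier_multiplier:
  fixes m :: "real^'n::finite \<Rightarrow> complex"
  assumes "m \<in> borel_measurable borel" "\<And>x. norm (m x) \<le> B" "f \<in> schwartz"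
  shows "pairing (tempered_inverse_fourier (regular_distribution m)) f = (LINT \<xi>|lborel. m \<xi> * inverse_fourier f \<xi>)"
  using assms by (simp add: pairing_tempered_inverse_fourier schwartz_inverse_fourier pairing_regular_distribution[of m B])

text \<open>Testing the distribution against \<open>e\<^sup>-\<^sup>i\<^sup>x\<^sup>\<eta>\<close> times a cutoff gives the same value for all cutoffs that
  equal \<open>1\<close> near the support, and the value tends to a multiple of \<open>m \<eta>\<close> as the cutoff widens.\<close>

lemma compact_support_imp_reproducing:
  fixes m :: "real^'n::finite \<Rightarrow> complex"
  assumes cont: "continuous_on UNIV m" and bound: "\<And>x. norm (m x) \<le> B"
    and supp: "compact (tempered_support (tempered_inverse_fourier (regular_distribution m)))"
  obtains c \<Psi> where "\<Psi> \<in> schwartz" "\<forall>x. m x = c * (LINT \<zeta>|lborel. m (x + \<zeta>) * \<Psi> \<zeta>)"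
proof -
  let ?u = "tempered_inverse_fourier (regular_distribution m)"
  have m [measurable]: "m \<in> borel_measurable borel"
    using cont by (rule borel_measurable_continuous_onI)
  \<comment> \<open>The cutoff \<open>b\<close> is 1 on \<open>ball 0 r\<close>, so on the whole
    support, and so are all its dilates.\<close>
  obtain r where r: "0 < r" "tempered_support ?u \<subseteq> ball 0 r"
    using compact_imp_bounded[OF supp] bounded_subset_ballD by blast
  define b where "b x = bump (x /\<^sub>R r)" for x :: "real^'n"
  define \<Psi> where "\<Psi> = inverse_fourier b"
  let ?c = "LINT \<zeta>|lborel. \<Psi> \<zeta>"
  have b: "b \<in> schwartz" unfolding b_def by (rule bump_dilate_schwartz[OF r(1)])
  have \<Psi>: "\<Psi> \<in> schwartz" unfolding \<Psi>_def by (rule schwartz_inverse_fourier[OF b])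
  have [measurable]: "\<Psi> \<in> borel_measurable borel" by (rule schwartz_borel[OF \<Psi>])
  have c: "?c \<noteq> 0"
    unfolding \<Psi>_def by (rule integral_inverse_fourier_bump_nonzero[OF r(1)]) (simp add: b_def[abs_def])
  have "(LINT \<zeta>|lborel. m (\<eta> + \<zeta>) * \<Psi> \<zeta>) = m \<eta> * ?c" for \<eta>
  proof -
    let ?e = "\<lambda>x. exp (- (\<i> * complex_of_real (x \<bullet> \<eta>)))"
    define g where "g n x = b (x /\<^sub>R real (Suc n)) * ?e x" for n x
    have sm: "smooth (g n)" for n
      unfolding g_def using smooth_compose_affine[OF schwartz_smooth[OF b], of "inverse (real (Suc n))" 0]
      by (intro smooth_mult smooth_character) simp
    have supp_g: "{x. g n x \<noteq> 0} \<subseteq> cball 0 (2 * (r * real (Suc n)))" for n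
    proof
      fix x assume "x \<in> {x. g n x \<noteq> 0}"
      then have "norm (x /\<^sub>R real (Suc n) /\<^sub>R r) < 2"
        using bump_eq_0[of "x /\<^sub>R real (Suc n) /\<^sub>R r"] unfolding g_def b_def by force
      then show "x \<in> cball 0 (2 * (r * real (Suc n)))"
        using r(1) by (simp add: divide_inverse_commute[symmetric] field_simps del: of_nat_Suc)
    qed
    have g: "g n \<in> schwartz" for n
      by (rule test_function_schwartz[OF test_functionI[OF sm compact_cball supp_g subset_UNIV]])
    have "pairing ?u (g n) = pairing ?u (g 0)" for n
    proof -
      \<comment> \<open>All cutoffs agree on \<open>ball 0 r\<close>, so their differences live in
        this compact annulus, away from the support.\<close>
      let ?C = "cball (0 :: real^'n) (2 * (r * real (Suc n))) \<inter> - ball 0 r"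
      have d: "(\<lambda>x. g n x - g 0 x) \<in> schwartz" by (rule schwartz_diff[OF g g])
      have "pairing ?u (\<lambda>x. g n x - g 0 x) = 0"
      proof (rule pairing_eq_0_outside_support[where C = ?C])
        show "smooth (\<lambda>x. g n x - g 0 x)" by (rule schwartz_smooth[OF d])
        show "compact ?C" by (intro compact_Int_closed closed_Compl compact_cball open_ball)
        show "?C \<inter> tempered_support ?u = {}" using r(2) by blast
        have "2 * (r * real (Suc 0)) \<le> 2 * (r * real (Suc n))" using r(1) by simp
        then have "cball 0 (2 * (r * real (Suc 0))) \<subseteq> cball (0 :: real^'n) (2 * (r * real (Suc n)))"
          by (rule subset_cball)
        then have "{x. g n x \<noteq> 0} \<union> {x. g 0 x \<noteq> 0} \<subseteq> cball 0 (2 * (r * real (Suc n)))"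
          using supp_g[of n] supp_g[of 0] by blast
        then have "x \<in> cball 0 (2 * (r * real (Suc n)))" if "g n x - g 0 x \<noteq> 0" for x
          by (rule subsetD) (use that in auto)
        moreover have "x \<notin> ball 0 r" if "g n x - g 0 x \<noteq> 0" for x
        proof
          assume x: "x \<in> ball 0 r"
          have "norm (x /\<^sub>R real (Suc k) /\<^sub>R r) \<le> 1" for k
          proof -
            have "norm x * 1 \<le> r * real (Suc k)" using x r(1) by (intro mult_mono) auto
            then show ?thesis using r(1) by (simp add: divide_inverse_commute[symmetric] field_simps del: of_nat_Suc)
          qed
          then have "b (x /\<^sub>R real (Suc k)) = 1" for k unfolding b_def by (rule bump_eq_1)
          then show False using that by (simp add: g_def del: of_nat_Suc)
        qed
        ultimately show "{x. g n x - g 0 x \<noteq> 0} \<subseteq> ?C" by blast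
      qed
      then show ?thesis using pairing_add[OF g[of 0] d] by simp
    qed
    then have "(\<lambda>n. pairing ?u (g n)) = (\<lambda>_. pairing ?u (g 0))" by (rule ext)
    then have "(\<lambda>n. pairing ?u (g n)) \<longlonglongrightarrow> pairing ?u (g 0)" by (simp only: tendsto_const)
    moreover have "(\<lambda>n. pairing ?u (g n)) \<longlonglongrightarrow> m \<eta> * ?c"
      using inverse_fourier_approximate_identity[OF m bound _ b, of \<eta>] cont
      unfolding pairing_fourier_multiplier[OF m bound g] \<Psi>_def g_def
      by (simp add: continuous_on_eq_continuous_at)
    ultimately have "pairing ?u (g 0) = m \<eta> * ?c" by (rule LIMSEQ_unique)
    \<comment> \<open>For n = 0 the dilation is trivial, and only the translate of \<Psi> by \<eta>
      remains.\<close>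
    moreover have "pairing ?u (g 0) = (LINT \<xi>|lborel. m \<xi> * \<Psi> (\<xi> - \<eta>))"
      unfolding pairing_fourier_multiplier[OF m bound g] g_def by (simp add: inverse_fourier_modulate \<Psi>_def)
    moreover have "(LINT \<zeta>|lborel. m (\<eta> + \<zeta>) * \<Psi> ((\<eta> + \<zeta>) - \<eta>)) = (LINT \<xi>|lborel. m \<xi> * \<Psi> (\<xi> - \<eta>))"
      by (rule integral_translate(1)) measurable
    ultimately show ?thesis by simp
  qed
  then have "\<forall>x. m x = inverse ?c * (LINT \<zeta>|lborel. m (x + \<zeta>) * \<Psi> \<zeta>)"
    using c by simp
  with \<Psi> show thesis by (rule that)
qed

text \<open>(f - g) / (2 pi) is continuous with integer values; distinct integers are at distance at
  least 1, so it is constant on the connected line.\<close>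

lemma cis_eq_imp_continuous_eq:
  fixes f g :: "real \<Rightarrow> real"
  assumes cont: "continuous_on UNIV f" "continuous_on UNIV g" and eq: "\<And>s. cis (f s) = cis (g s)"
  shows "f s - g s = f 0 - g 0"
proof -
  define k where "k s = (f s - g s) / (2 * pi)" for s
  have k_int: "k s \<in> \<int>" for s
  proof -
    obtain n :: int where "\<i> * complex_of_real (f s) = \<i> * of_real (g s) + of_real (of_int (2 * n) * pi) * \<i>"
      using eq[of s] unfolding cis_conv_exp exp_eq by auto
    then have "f s = g s + of_int (2 * n) * pi"
      by (simp add: complex_eq_iff)
    then have "k s = of_int n" by (simp add: k_def)
    then show ?thesis by simp
  qed
  have "k constant_on UNIV"
  proof (rule continuous_discrete_range_constant)
    show "continuous_on UNIV k" unfolding k_def by (intro continuous_intros cont) simp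
    have "1 \<le> norm (k y - k x)" if "k y \<noteq> k x" for x y
    proof -
      obtain n :: int where "k y - k x = of_int n" using Ints_diff[OF k_int k_int] by (auto elim!: Ints_cases)
      moreover from this that have "n \<noteq> 0" by auto
      then have "1 \<le> \<bar>n\<bar>" by simp
      ultimately show ?thesis by (simp flip: of_int_abs)
    qed
    then show "\<exists>e>0. \<forall>y. y \<in> UNIV \<and> k y \<noteq> k x \<longrightarrow> e \<le> norm (k y - k x)" for x
      using zero_less_one by blast
  qed simp
  then have "k s = k 0" by (auto simp: constant_on_def)
  then show ?thesis by (simp add: k_def)
qed

text \<open>The slope may depend on the line. Lines through 0 give homogeneity; on the line from x
  to y the midpoint value is the mean of the end values, and homogeneity turns this into
  additivity.\<close>

lemma affine_on_lines_imp_linear: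
  fixes f :: "'a::real_vector \<Rightarrow> real"
  assumes lines: "\<And>x v. \<exists>a. \<forall>s. f (x + s *\<^sub>R v) = f x + a * s" and "f 0 = 0"
  shows "linear f"
proof (rule linearI)
  have scale: "f (s *\<^sub>R v) = s * f v" for s v
  proof -
    obtain a where "\<And>s. f (0 + s *\<^sub>R v) = f 0 + a * s" using lines by blast
    from this[of s] this[of 1] show ?thesis using \<open>f 0 = 0\<close> by simp
  qed
  then show "f (s *\<^sub>R v) = s *\<^sub>R f v" for s v by simp
  show "f (x + y) = f x + f y" for x y
  proof -
    obtain a where a: "\<And>s. f (x + s *\<^sub>R (y - x)) = f x + a * s" using lines by blast
    have "x + (1 / 2) *\<^sub>R (y - x) = (1 / 2) *\<^sub>R (x + y)"
      by (simp add: algebra_simps flip: scaleR_add_left)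
    then have "f (x + y) = 2 * f (x + (1 / 2) *\<^sub>R (y - x))" by (simp add: scale)
    then show ?thesis using a[of "1 / 2"] a[of 1] by simp
  qed
qed

section \<open>Multi-indices of order at most one\<close>

definition unit_index :: "'n \<Rightarrow> 'n \<Rightarrow> nat" where
  "unit_index j i = (if i = j then 1 else 0)"

lemma unit_index_neq_0: "unit_index j \<noteq> (\<lambda>_. 0)"
proof
  assume "unit_index j = (\<lambda>_. 0)"
  then have "unit_index j j = 0" by simp
  then show False by (simp add: unit_index_def)
qed

lemma multi_indices_le_1:
  "{\<alpha> :: 'n::finite \<Rightarrow> nat. (\<Sum>i\<in>UNIV. \<alpha> i) \<le> 1} = insert (\<lambda>_. 0) (range unit_index)"
proof (intro equalityI subsetI)
  fix \<alpha> :: "'n \<Rightarrow> nat" assume "\<alpha> \<in> {\<alpha>. (\<Sum>i\<in>UNIV. \<alpha> i) \<le> 1}"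
  then have le: "(\<Sum>i\<in>UNIV. \<alpha> i) \<le> 1" by simp
  show "\<alpha> \<in> insert (\<lambda>_. 0) (range unit_index)"
  proof (cases "\<alpha> = (\<lambda>_. 0)")
    case False
    then obtain j where j: "\<alpha> j \<noteq> 0" by auto
    have "(\<Sum>i\<in>UNIV. \<alpha> i) = \<alpha> j + (\<Sum>i\<in>UNIV - {j}. \<alpha> i)" by (rule sum.remove) auto
    with le j have "\<alpha> j = 1" "(\<Sum>i\<in>UNIV - {j}. \<alpha> i) = 0" by linarith+
    then have "\<alpha> = unit_index j" by (auto simp: unit_index_def fun_eq_iff)
    then show ?thesis by blast
  qed simp
qed (auto simp: unit_index_def)

lemma sum_multi_indices_le_1:
  fixes \<xi> :: "real^'n::finite"
  shows "(\<Sum>\<alpha> | (\<Sum>i\<in>UNIV. \<alpha> i) \<le> 1. a \<alpha> * (\<Prod>i\<in>UNIV. \<xi> $ i ^ \<alpha> i))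
    = a (\<lambda>_. 0) + (\<Sum>j\<in>UNIV. a (unit_index j) * \<xi> $ j)"
proof -
  have ne: "(\<lambda>_. 0) \<notin> range (unit_index :: 'n \<Rightarrow> 'n \<Rightarrow> nat)"
    by (auto simp: image_iff unit_index_neq_0[symmetric])
  have inj: "inj (unit_index :: 'n \<Rightarrow> 'n \<Rightarrow> nat)"
  proof (rule injI)
    fix j k :: 'n assume "unit_index j = unit_index k"
    then have "unit_index j j = unit_index k j" by simp
    then show "j = k" by (simp add: unit_index_def split: if_splits)
  qed
  have "(\<Prod>i\<in>UNIV. \<xi> $ i ^ unit_index j i) = \<xi> $ j" for j
  proof -
    have "(\<Prod>i\<in>UNIV. \<xi> $ i ^ unit_index j i) = (\<Prod>i\<in>UNIV. if i = j then \<xi> $ i else 1)"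
      by (rule prod.cong) (auto simp: unit_index_def)
    then show ?thesis by simp
  qed
  then show ?thesis
    unfolding multi_indices_le_1 using ne by (simp add: sum.reindex[OF inj])
qed

text \<open>For this symbol the pairing is exp (-i a) times the inversion integral at p, hence a
  multiple of f p. Its vanishing for f p = 0 is all that the support sees, so inversion up to a
  constant suffices.\<close>

lemma affine_imp_singleton_support:
  fixes \<omega> :: "real^'n::finite \<Rightarrow> real"
  assumes \<omega>: "\<And>\<xi>. \<omega> \<xi> = a + \<xi> \<bullet> p"
  shows "tempered_support (tempered_inverse_fourier
    (regular_distribution (\<lambda>\<xi>. exp (- \<i> * of_real (\<omega> \<xi>))))) \<subseteq> {p}" (is "tempered_support ?u \<subseteq> _")
proof -
  have m: "(\<lambda>\<xi>. exp (- \<i> * complex_of_real (\<omega> \<xi>))) \<in> borel_measurable borel"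
    unfolding \<omega> by (intro borel_measurable_continuous_onI continuous_intros)
  let ?b = "\<lambda>x::real^'n. bump (x /\<^sub>R 1)"
  have null: "pairing ?u f = 0" if f: "f \<in> schwartz" "f p = 0" for f
  proof -
    have "?b 0 * (LINT \<xi>|lborel. inverse_fourier f \<xi> * exp (- (\<i> * of_real (\<xi> \<bullet> p)))) = 0"
      unfolding inverse_fourier_inversion[OF f(1) bump_dilate_schwartz[OF zero_less_one]] f(2) by simp
    then have 0: "(LINT \<xi>|lborel. inverse_fourier f \<xi> * exp (- (\<i> * of_real (\<xi> \<bullet> p)))) = 0"
      by (simp add: bump_eq_1)
    have "pairing ?u f = (LINT \<xi>|lborel. exp (- \<i> * of_real (\<omega> \<xi>)) * inverse_fourier f \<xi>)"
      by (rule pairing_fourier_multiplier[OF m _ f(1), of 1]) simp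
    also have "\<dots> = (LINT \<xi>|lborel. exp (- \<i> * of_real a) * (inverse_fourier f \<xi> * exp (- (\<i> * of_real (\<xi> \<bullet> p)))))"
      unfolding \<omega> by (simp add: distrib_left exp_add[symmetric] exp_diff exp_minus divide_inverse mult_ac exp_add)
    also have "\<dots> = 0" using 0 by simp
    finally show ?thesis .
  qed
  have "pairing ?u f = 0" if "test_function (- {p}) f" for f
    using that closure_subset[of "{x. f x \<noteq> 0}"]
    by (intro null test_function_schwartz[OF that]) (auto simp: test_function_def)
  then have "- {p} \<subseteq> \<Union>{U. open U \<and> (\<forall>f. test_function U f \<longrightarrow> pairing ?u f = 0)}"
    by (intro Union_upper) (simp add: open_Compl)
  then show ?thesis unfolding tempered_support_def by blast
qed

lemma compact_support_imp_affine:
  fixes \<omega> :: "real^'n::finite \<Rightarrow> real"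
  assumes cont: "continuous_on UNIV \<omega>" and "t \<noteq> 0"
    and supp: "compact (tempered_support (tempered_inverse_fourier
      (regular_distribution (\<lambda>\<xi>. exp (- \<i> * of_real t * of_real (\<omega> \<xi>))))))"
  shows "linear (\<lambda>\<xi>. \<omega> \<xi> - \<omega> 0)"
proof (rule affine_on_lines_imp_linear)
  let ?m = "\<lambda>\<xi>. exp (- \<i> * complex_of_real t * complex_of_real (\<omega> \<xi>))"
  have cis: "?m \<xi> = cis (- t * \<omega> \<xi>)" for \<xi> by (simp add: cis_conv_exp mult.assoc)
  have m: "continuous_on UNIV ?m" by (intro continuous_intros cont)
  have norm: "norm (?m \<xi>) = 1" for \<xi> unfolding cis by (rule norm_cis)
  then have norm_le: "norm (?m \<xi>) \<le> 1" for \<xi> by simp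
  obtain c \<Psi> where \<Psi>: "\<Psi> \<in> schwartz" "\<forall>x. ?m x = c * (LINT \<zeta>|lborel. ?m (x + \<zeta>) * \<Psi> \<zeta>)"
    by (rule compact_support_imp_reproducing[OF m norm_le supp])
  fix x v
  obtain A d where d: "d 0 = (\<lambda>s. ?m (x + s *\<^sub>R v))"
      "\<forall>k s. (d k has_vector_derivative d (Suc k) s) (at s)" "\<forall>k s. norm (d k s) \<le> A ^ k"
    by (rule reproducing_kernel_exponential_type[OF \<Psi>(1) borel_measurable_continuous_onI[OF m] norm_le
        \<Psi>(2)[rule_format]])
  have "norm (d 0 s) = 1" for s unfolding d(1) by (rule norm)
  then obtain a b where ab: "\<And>s. d 0 s = cis (a * s + b)"
    by (rule unimodular_exponential_type[OF d(2,3)[rule_format]]) auto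
  \<comment> \<open>The phases -t \<omega> and a s + b agree modulo 2 pi; continuity makes the
    multiple of 2 pi the same along the line.\<close>
  have line: "- t * \<omega> (x + s *\<^sub>R v) - (a * s + b) = - t * \<omega> (x + 0 *\<^sub>R v) - (a * 0 + b)" for s
  proof (rule cis_eq_imp_continuous_eq)
    show "continuous_on UNIV (\<lambda>s. - t * \<omega> (x + s *\<^sub>R v))"
      by (intro continuous_intros continuous_on_compose2[OF cont]) auto
    show "cis (- t * \<omega> (x + s *\<^sub>R v)) = cis (a * s + b)" for s
      using ab[of s] unfolding d(1) cis .
  qed (intro continuous_intros)
  have "\<omega> (x + s *\<^sub>R v) - \<omega> 0 = \<omega> x - \<omega> 0 + - a / t * s" for s
    using line[of s] \<open>t \<noteq> 0\<close> by (simp add: field_simps)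
  then show "\<exists>a. \<forall>s. \<omega> (x + s *\<^sub>R v) - \<omega> 0 = \<omega> x - \<omega> 0 + a * s" by blast
qed simp

theorem proposition1p1:
  fixes \<omega> :: "real^'n::finite \<Rightarrow> real" and K :: "real \<Rightarrow> 'n tempered"
  assumes "continuous_on UNIV \<omega>"
    and "\<And>t. K t = tempered_inverse_fourier
          (regular_distribution (\<lambda>\<xi>. exp (- \<i> * complex_of_real t * complex_of_real (\<omega> \<xi>))))"
  shows "(\<exists>a :: ('n \<Rightarrow> nat) \<Rightarrow> real. \<forall>\<xi>.
            \<omega> \<xi> = (\<Sum>\<alpha> | (\<Sum>i\<in>UNIV. \<alpha> i) \<le> 1. a \<alpha> * (\<Prod>i\<in>UNIV. \<xi> $ i ^ \<alpha> i))) \<longleftrightarrow>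
         (\<exists>t. t \<noteq> 0 \<and> compact (tempered_support (K t)))"
  unfolding sum_multi_indices_le_1
proof
  assume "\<exists>a. \<forall>\<xi>. \<omega> \<xi> = a (\<lambda>_. 0) + (\<Sum>j\<in>UNIV. a (unit_index j) * \<xi> $ j)"
  then obtain a where a: "\<And>\<xi>. \<omega> \<xi> = a (\<lambda>_. 0) + (\<Sum>j\<in>UNIV. a (unit_index j) * \<xi> $ j)" by blast
  have "\<omega> \<xi> = a (\<lambda>_. 0) + \<xi> \<bullet> (\<chi> j. a (unit_index j))" for \<xi>
    unfolding a by (simp add: inner_vec_def mult.commute)
  from affine_imp_singleton_support[OF this]
  have "tempered_support (K 1) \<subseteq> {\<chi> j. a (unit_index j)}" by (simp add: assms(2))
  then have "compact (tempered_support (K 1))"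
    using finite_subset finite_imp_compact by blast
  then show "\<exists>t. t \<noteq> 0 \<and> compact (tempered_support (K t))" by (intro exI[of _ 1]) simp
next
  assume "\<exists>t. t \<noteq> 0 \<and> compact (tempered_support (K t))"
  then have lin: "linear (\<lambda>\<xi>. \<omega> \<xi> - \<omega> 0)"
    using compact_support_imp_affine[OF assms(1)] unfolding assms(2) by blast
  \<comment> \<open>Evaluating \<omega> at the multi-index viewed as a vector treats both cases at
    once: \<omega> 0 for the zero index, and for a unit index the value of the linear part \<omega>
    - \<omega> 0 at a basis vector.\<close>
  define a where "a \<alpha> = \<omega> (\<chi> i. real (\<alpha> i)) - (if \<alpha> = (\<lambda>_. 0) then 0 else \<omega> 0)" for \<alpha> :: "'n \<Rightarrow> nat"
  have zero: "(\<chi> i. real ((\<lambda>_. 0) i)) = (0 :: real^'n)" by (simp add: vec_eq_iff)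
  have unit: "(\<chi> i. real (unit_index j i)) = (axis j 1 :: real^'n)" for j
    by (simp add: vec_eq_iff unit_index_def axis_def)
  have a_unit: "a (unit_index j) = \<omega> (axis j 1) - \<omega> 0" for j by (simp add: a_def unit unit_index_neq_0)
  have "\<omega> \<xi> = a (\<lambda>_. 0) + (\<Sum>j\<in>UNIV. a (unit_index j) * \<xi> $ j)" for \<xi>
  proof -
    have "\<omega> \<xi> - \<omega> 0 = \<omega> (\<Sum>j\<in>UNIV. \<xi> $ j *\<^sub>R axis j 1) - \<omega> 0"
      by (simp add: basis_expansion scalar_mult_eq_scaleR[symmetric])
    also have "\<dots> = (\<Sum>j\<in>UNIV. \<xi> $ j *\<^sub>R (\<omega> (axis j 1) - \<omega> 0))"
      using linear_sum[OF lin, of "\<lambda>j. \<xi> $ j *\<^sub>R axis j 1" UNIV] linear_cmul[OF lin] by simp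
    finally show ?thesis using zero by (simp add: a_unit a_def[of "\<lambda>_. 0"] mult.commute)
  qed
  then show "\<exists>a. \<forall>\<xi>. \<omega> \<xi> = a (\<lambda>_. 0) + (\<Sum>j\<in>UNIV. a (unit_index j) * \<xi> $ j)" by blast
qed

end
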